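(* Let $\Lambda:[0,1]\to\mathbb{R}$ be of class $C^1$ and assume that $\lambda:=\Lambda'$ is $L_{\mathrm{LC}}$-Lipschitz continuous on $[0,1]$. Let $m$ be a Borel probability measure on $\mathbb{R}$, let $u_0=H*m$ be its cumulative distribution function, and let $u$ be the entropy solution of $\partial_t u+\partial_x(\Lambda(u))=0$ with initial condition $u_0$. Then for all $n\ge 1$ and all $\mathrm{x}(n)=(x_1(n),\ldots,x_n(n))\in D_n$, $$\forall t\ge 0,\qquad \|u(t,\cdot)-u_n[\mathrm{x}(n)](t,\cdot)\|_{L^1(\mathbb{R})}\le W_1(m,\mu_0[\mathrm{x}(n)])+\frac{t\,L_{\mathrm{LC}}}{n}.$$ Moreover, when $m([a,b])=1$ with $-\infty<a<b<+\infty$ and $\mathrm{x}(n)$ is given by $x_k(n)=u_0^{-1}\left(\frac{2k-1}{2n}\right)$ for $k\in\{1,\ldots,n\}$, then for all $n\ge 1$, $$\forall t\ge 0,\qquad \|u(t,\cdot)-u_n[\mathrm{x}(n)](t,\cdot)\|_{L^1(\mathbb{R})}\le \frac{b-a+2t\,L_{\mathrm{LC}}}{2n}.$$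
   Context: $H(x)=\mathbf{1}_{\{x\ge 0\}}$, so $H*m(x)=m((-\infty,x])$ is the cumulative distribution function (CDF) of $m$. For a CDF $F$, $F^{-1}(v):=\inf\{x\in\mathbb{R}:F(x)\ge v\}$, $v\in(0,1)$. $W_1$ is the Wasserstein distance of order 1 on probability measures on $\mathbb{R}$ (for the cost $|x-x'|$), possibly equal to $+\infty$; one has $W_1(m,m')=\|H*m-H*m'\|_{L^1(\mathbb{R})}$. Entropy solution: the unique weak solution $u:[0,+\infty)\times\mathbb{R}\to[0,1]$ of $\partial_t u+\partial_x(\Lambda(u))=0$ with initial condition $u_0$ satisfying Kruzkov's entropy condition: for all $c\in[0,1]$, $\partial_t|u-c|+\partial_x(\mathrm{sgn}(u-c)(\Lambda(u)-\Lambda(c)))\le 0$ in the distributional sense (with initial datum $u_0$). For all $t\ge0$, $u(t,\cdot)$ coincides almost everywhere with the CDF of a probability measure (Kruzkov's theorem; the solution is taken continuous in time with values in $L^1_{\mathrm{loc}}(\mathbb{R})$). Sticky particle dynamics (SPD): $D_n:=\{(x_1,\ldots,x_n)\in\mathbb{R}^n:x_1\le\cdots\le x_n\}$. For $\mathrm{x}\in D_n$ and $\bar\lambda\in\mathbb{R}^n$, $\phi[\bar\lambda](\mathrm{x};t)\in D_n$ is the vector of positions at time $t$ of $n$ particles of mass $1/n$, the $k$-th one starting at $x_k$ with velocity $\bar\lambda_k$; particles move at constant velocity and stick together at collisions, with conservation of mass and momentum. Explicitly (also when several particles share the same initial position): let $Q_t$ be the function on $[0,1]$, linear on each $[(k-1)/n,k/n]$,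 with $Q_t(0)=0$ and $Q_t(k/n)=\sum_{k'=1}^k(x_{k'}+t\bar\lambda_{k'})$, and let $P_t$ be its convex hull (greatest convex minorant); then $\phi_k[\bar\lambda](\mathrm{x};t)=P_t(k/n)-P_t((k-1)/n)$. Throughout, the initial velocities are $\bar\lambda_k:=n\int_{(k-1)/n}^{k/n}\lambda(w)\,dw$. Set $\mu_t[\mathrm{x}]:=\frac1n\sum_{k=1}^n\delta_{\phi_k[\bar\lambda](\mathrm{x};t)}$ (so $\mu_0[\mathrm{x}]=\frac1n\sum_{k=1}^n\delta_{x_k}$) and $u_n[\mathrm{x}](t,x):=H*\mu_t[\mathrm{x}](x)=\frac1n\sum_{k=1}^n\mathbf{1}_{\{\phi_k[\bar\lambda](\mathrm{x};t)\le x\}}$. *)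

theory Defs
  imports "HOL-Probability.Probability"
begin

definition cdf_inverse :: "(real \<Rightarrow> real) \<Rightarrow> real \<Rightarrow> real" where
  "cdf_inverse F v = Inf {x. F x \<ge> v}"

definition couplings :: "real measure \<Rightarrow> real measure \<Rightarrow> (real \<times> real) measure set" where
  "couplings m m' = {\<pi>. prob_space \<pi> \<and> sets \<pi> = sets borel
      \<and> distr \<pi> borel fst = m \<and> distr \<pi> borel snd = m'}"

definition W1 :: "real measure \<Rightarrow> real measure \<Rightarrow> ennreal" where
  "W1 m m' = (INF \<pi>\<in>couplings m m'. \<integral>\<^sup>+ p. ennreal \<bar>fst p - snd p\<bar> \<partial>\<pi>)"

definition L1_dist :: "(real \<Rightarrow> real) \<Rightarrow> (real \<Rightarrow> real) \<Rightarrow> ennreal" where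
  "L1_dist f g = (\<integral>\<^sup>+ x. ennreal \<bar>f x - g x\<bar> \<partial>lborel)"

text \<open>Infinite differentiability: f is Frechet differentiable everywhere and all its
  directional derivatives are again infinitely differentiable (greatest such predicate).\<close>

coinductive smooth :: "('a::euclidean_space \<Rightarrow> real) \<Rightarrow> bool" where
  "(\<And>x. (f has_derivative f' x) (at x)) \<Longrightarrow> (\<And>h. smooth (\<lambda>x. f' x h)) \<Longrightarrow> smooth f"

text \<open>Test functions on the closed half plane \<open>[0,\<infinity>) \<times> \<real>\<close> are the restrictions of smooth
  compactly supported functions of \<open>(t, x)\<close> on the whole plane; they need not vanish at
  \<open>t = 0\<close>, so that the integral formulations below contain the initial condition.\<close>

definition test_function :: "(real \<times> real \<Rightarrow> real) \<Rightarrow> bool" where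
  "test_function \<phi> \<longleftrightarrow> smooth \<phi> \<and> compact (closure {p. \<phi> p \<noteq> 0})"

definition dt :: "(real \<times> real \<Rightarrow> real) \<Rightarrow> real \<Rightarrow> real \<Rightarrow> real" where
  "dt \<phi> t x = deriv (\<lambda>s. \<phi> (s, x)) t"

definition dx :: "(real \<times> real \<Rightarrow> real) \<Rightarrow> real \<Rightarrow> real \<Rightarrow> real" where
  "dx \<phi> t x = deriv (\<lambda>y. \<phi> (t, y)) x"

definition weak_solution ::
    "(real \<Rightarrow> real) \<Rightarrow> (real \<Rightarrow> real) \<Rightarrow> (real \<Rightarrow> real \<Rightarrow> real) \<Rightarrow> bool" where
  "weak_solution \<Lambda> u0 u \<longleftrightarrow>
     (\<forall>\<phi>. test_function \<phi> \<longrightarrow>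
        set_lebesgue_integral lborel ({0..} \<times> UNIV)
          (\<lambda>(t, x). u t x * dt \<phi> t x + \<Lambda> (u t x) * dx \<phi> t x)
        + (LBINT x. u0 x * \<phi> (0, x)) = 0)"

definition Kruzkov_condition ::
    "(real \<Rightarrow> real) \<Rightarrow> (real \<Rightarrow> real) \<Rightarrow> (real \<Rightarrow> real \<Rightarrow> real) \<Rightarrow> bool" where
  "Kruzkov_condition \<Lambda> u0 u \<longleftrightarrow>
     (\<forall>c\<in>{0..1}. \<forall>\<phi>. test_function \<phi> \<and> (\<forall>t\<ge>0. \<forall>x. \<phi> (t, x) \<ge> 0) \<longrightarrow>
        set_lebesgue_integral lborel ({0..} \<times> UNIV)
          (\<lambda>(t, x). \<bar>u t x - c\<bar> * dt \<phi> t x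
                    + sgn (u t x - c) * (\<Lambda> (u t x) - \<Lambda> c) * dx \<phi> t x)
        + (LBINT x. \<bar>u0 x - c\<bar> * \<phi> (0, x)) \<ge> 0)"

definition L1_loc_continuous :: "(real \<Rightarrow> real \<Rightarrow> real) \<Rightarrow> bool" where
  "L1_loc_continuous u \<longleftrightarrow>
     (\<forall>K. compact K \<longrightarrow> (\<forall>s\<ge>0.
        ((\<lambda>t. \<integral>\<^sup>+x\<in>K. ennreal \<bar>u t x - u s x\<bar> \<partial>lborel) \<longlongrightarrow> 0) (at s within {0..})))"

text \<open>Only the values \<open>u t x\<close> with \<open>t \<ge> 0\<close> are relevant. The continuity in time selects
  the representative for which \<open>u t\<close> is meaningful for every \<open>t \<ge> 0\<close>.\<close>

definition entropy_solution ::
    "(real \<Rightarrow> real) \<Rightarrow> (real \<Rightarrow> real) \<Rightarrow> (real \<Rightarrow> real \<Rightarrow> real) \<Rightarrow> bool" where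
  "entropy_solution \<Lambda> u0 u \<longleftrightarrow>
     set_borel_measurable borel ({0..} \<times> UNIV) (\<lambda>(t, x). u t x)
     \<and> (\<forall>t\<ge>0. \<forall>x. u t x \<in> {0..1})
     \<and> L1_loc_continuous u
     \<and> weak_solution \<Lambda> u0 u
     \<and> Kruzkov_condition \<Lambda> u0 u"

text \<open>Vectors of \<open>\<real>\<^sup>n\<close> are functions on \<open>nat\<close>, of which only the values at
  \<open>1, \<dots>, n\<close> are used.\<close>

definition D :: "nat \<Rightarrow> (nat \<Rightarrow> real) set" where
  "D n = {x. mono_on {1..n} x}"

text \<open>\<open>interp n y\<close> is linear on each \<open>[(k-1)/n, k/n]\<close>, with value \<open>y 1 + \<dots> + y k\<close>
  at \<open>k/n\<close>.\<close>

definition interp :: "nat \<Rightarrow> (nat \<Rightarrow> real) \<Rightarrow> real \<Rightarrow> real" where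
  "interp n y v =
     (let k = nat \<lfloor>real n * v\<rfloor> in (\<Sum>j=1..k. y j) + (real n * v - real k) * y (Suc k))"

definition convex_hull_fun :: "(real \<Rightarrow> real) \<Rightarrow> real \<Rightarrow> real" where
  "convex_hull_fun Q v =
     Sup {g v | g. convex_on {0..1} g \<and> (\<forall>w\<in>{0..1}. g w \<le> Q w)}"

definition spd :: "nat \<Rightarrow> (nat \<Rightarrow> real) \<Rightarrow> (nat \<Rightarrow> real) \<Rightarrow> real \<Rightarrow> nat \<Rightarrow> real" where
  "spd n lbar x t k =
     (let P = convex_hull_fun (interp n (\<lambda>j. x j + t * lbar j))
      in P (real k / real n) - P ((real k - 1) / real n))"

definition initial_velocity :: "(real \<Rightarrow> real) \<Rightarrow> nat \<Rightarrow> nat \<Rightarrow> real" where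
  "initial_velocity lam n k = real n * integral {(real k - 1) / real n .. real k / real n} lam"

text \<open>The measure \<open>1/n \<Sum> \<delta>\<^bsub>y k\<^esub>\<close>, as the image under \<open>y\<close> of the uniform distribution
  on \<open>{1..n}\<close>.\<close>

definition empirical_measure :: "nat \<Rightarrow> (nat \<Rightarrow> real) \<Rightarrow> real measure" where
  "empirical_measure n y = distr (uniform_count_measure {1..n}) borel y"

definition spd_measure :: "(real \<Rightarrow> real) \<Rightarrow> nat \<Rightarrow> (nat \<Rightarrow> real) \<Rightarrow> real \<Rightarrow> real measure" where
  "spd_measure lam n x t = empirical_measure n (spd n (initial_velocity lam n) x t)"

definition spd_cdf :: "(real \<Rightarrow> real) \<Rightarrow> nat \<Rightarrow> (nat \<Rightarrow> real) \<Rightarrow> real \<Rightarrow> real \<Rightarrow> real" where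
  "spd_cdf lam n x t = cdf (spd_measure lam n x t)"

end

theory Submission imports Defs begin

text \<open>
  Let \<open>c k = k / n\<close> and let \<open>X k t\<close> be the position of the \<open>k\<close>-th particle. The approximation equals \<open>c k\<close>
  between \<open>X k t\<close> and \<open>X (k + 1) t\<close>, so its distance to the entropy solution \<open>u\<close> is the integral of the sum over
  \<open>k\<close> of \<open>\<bar>u - c k\<bar>\<close> times the indicator of that interval. Each summand contains one of Kruzkov's entropies with
  a fixed constant. Smoothing the indicators in space gives admissible test functions, as long as
  the particles move along straight lines; the entropy inequalities for \<open>c 0, \<dots>, c n\<close> can then be added up
  (\<open>weak_energy_inequality\<close>).

  The derivatives of the smoothed indicators are concentrated at the fronts. After summation by parts the front of
  the \<open>k\<close>-th particle carries, at every point and with the value \<open>w\<close> of \<open>u\<close> there, the jump from \<open>c (k - 1)\<close> to \<open>c k\<close>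
  of the entropy flux of \<open>w\<close>, minus the particle velocity times the jump of the entropy (\<open>kruzkov_jump\<close>). The initial
  velocities are the slopes of the chords of \<open>\<Lambda>\<close> over \<open>[c (k - 1), c k]\<close>. For these velocities the contribution is
  zero unless \<open>w\<close> lies between the two states, and then it is twice the distance between \<open>\<Lambda>\<close> and its chord, which is at
  most \<open>L / n\<^sup>2\<close> (\<open>chord_above_flux\<close>). After collisions the velocities differ from the initial ones by differences
  of a defect of momentum. That defect is nonpositive and vanishes except between particles that move
  together, so its contributions cancel or have the right sign (\<open>sticky_dissipation\<close>). Adding up \<open>n\<close> fronts,
  the distance grows at rate at most \<open>L / n\<close> (\<open>energy_decay\<close>, \<open>L1_stability\<close>).

  The facts about the dynamics come from the convex envelope. At a node it is the minimum of the chords of the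
  data over that node (\<open>convex_hull_fun_node\<close>), hence a minimum of finitely many affine functions of time. So the
  velocities are constant on a short interval after any time, the envelope can only move away from the data in the
  course of time, and it is straight at the nodes where it differs from the data (\<open>spd_locally_affine\<close>).

  At time zero the \<open>L\<^sup>1\<close> distance of the distribution functions is at most the cost of any coupling
  (\<open>L1_dist_cdf_le_W1\<close>). For midpoint quantiles the distribution function of the particles is that of
  \<open>m\<close> rounded to multiples of \<open>1 / n\<close>, which gives the error \<open>(b - a) / (2 n)\<close> (\<open>midpoint_quantiles_L1\<close>).
\<close>

section \<open>Smooth functions and a smooth step\<close>

text \<open>Coinduction for infinite differentiability cannot be applied to a product alone, as its derivatives are sums
  of products. This class contains the test functions below and is closed under directional derivatives.\<close>

inductive smooth_alg :: "('a::euclidean_space \<Rightarrow> real) \<Rightarrow> bool" where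
  const: "smooth_alg (\<lambda>_. c)"
| add: "smooth_alg f \<Longrightarrow> smooth_alg g \<Longrightarrow> smooth_alg (\<lambda>x. f x + g x)"
| mult: "smooth_alg f \<Longrightarrow> smooth_alg g \<Longrightarrow> smooth_alg (\<lambda>x. f x * g x)"
| comp: "smooth (g :: real \<Rightarrow> real) \<Longrightarrow> bounded_linear l \<Longrightarrow> smooth_alg (\<lambda>x. g (l x + c))"

lemma smooth_alg_derivative:
  assumes "smooth_alg f"
  shows "\<exists>f'. (\<forall>x. (f has_derivative f' x) (at x)) \<and> (\<forall>h. smooth_alg (\<lambda>x. f' x h))"
  using assms
proof induction
  case (const c)
  show ?case by (rule exI[of _ "\<lambda>_ _. 0"]) (auto intro: smooth_alg.const)
next
  case (add f g)
  then obtain f' g' where "\<forall>x. (f has_derivative f' x) (at x)" "\<forall>h. smooth_alg (\<lambda>x. f' x h)"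
      "\<forall>x. (g has_derivative g' x) (at x)" "\<forall>h. smooth_alg (\<lambda>x. g' x h)"
    by blast
  then show ?case
    by (intro exI[of _ "\<lambda>x h. f' x h + g' x h"]) (auto intro: smooth_alg.add has_derivative_add)
next
  case (mult f g)
  then obtain f' g' where "\<forall>x. (f has_derivative f' x) (at x)" "\<forall>h. smooth_alg (\<lambda>x. f' x h)"
      "\<forall>x. (g has_derivative g' x) (at x)" "\<forall>h. smooth_alg (\<lambda>x. g' x h)"
    by blast
  with mult.hyps show ?case
    by (intro exI[of _ "\<lambda>x h. f x * g' x h + f' x h * g x"])
      (auto intro!: smooth_alg.add smooth_alg.mult has_derivative_mult)
next
  case (comp g l c)
  from comp(1) obtain g' where g': "\<And>x. (g has_derivative g' x) (at x)" "\<And>h. smooth (\<lambda>x. g' x h)"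
    by cases auto
  have "((\<lambda>x. g (l x + c)) has_derivative (\<lambda>h. g' (l x + c) (l h))) (at x)" for x
    by (rule has_derivative_compose[of "\<lambda>x. l x + c" l, OF _ g'(1)])
      (auto intro!: derivative_eq_intros bounded_linear_imp_has_derivative comp(2))
  moreover have "smooth_alg (\<lambda>x. g' (l x + c) (l h))" for h
    by (rule smooth_alg.comp[OF g'(2) comp(2)])
  ultimately show ?case by (intro exI[of _ "\<lambda>x h. g' (l x + c) (l h)"]) auto
qed

lemma smooth_algI: "smooth_alg f \<Longrightarrow> smooth f"
proof (coinduction arbitrary: f rule: smooth.coinduct)
  case smooth
  from smooth_alg_derivative[OF this] show ?case by blast
qed

lemma smooth_scale:
  fixes g :: "real \<Rightarrow> real"
  assumes "smooth g" shows "smooth (\<lambda>x. c * g (a * x + b))"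
  by (rule smooth_algI[OF smooth_alg.mult[OF smooth_alg.const
        smooth_alg.comp[OF assms bounded_linear_mult_right]]])

text \<open>The functions \<open>P (1/x) exp (-1/x)\<close> extended by zero. Keeping an arbitrary polynomial \<open>P\<close> makes
  the family closed under differentiation, which is what a coinductive proof of smoothness needs.\<close>

definition flat_exp :: "real poly \<Rightarrow> real \<Rightarrow> real" where
  "flat_exp P x = (if x > 0 then poly P (1/x) * exp (-1/x) else 0)"

lemma poly_exp_tendsto_0: "((\<lambda>y. poly P y * exp (-y)) \<longlongrightarrow> (0::real)) at_top"
proof -
  have "((\<lambda>y. \<Sum>i\<le>degree P. coeff P i * (y ^ i / exp y)) \<longlongrightarrow> (\<Sum>i\<le>degree P. coeff P i * 0)) at_top"
    by (intro tendsto_sum tendsto_mult tendsto_const tendsto_power_div_exp_0)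
  then show ?thesis
    by (simp add: poly_altdef exp_minus sum_distrib_right divide_inverse mult.assoc)
qed

lemma flat_tendsto_0: "(flat_exp P \<longlongrightarrow> 0) (at 0)"
proof -
  have "((\<lambda>x. poly P (inverse x) * exp (- (inverse x))) \<longlongrightarrow> 0) (at_right 0)"
    by (rule filterlim_compose[OF poly_exp_tendsto_0 filterlim_inverse_at_top_right])
  moreover have "eventually (\<lambda>x. poly P (inverse x) * exp (- (inverse x)) = flat_exp P x) (at_right 0)"
    using eventually_at_right_less[of 0] by eventually_elim (simp add: flat_exp_def divide_inverse)
  ultimately have r: "(flat_exp P \<longlongrightarrow> 0) (at_right 0)"
    by (rule Lim_transform_eventually)
  have "eventually (\<lambda>x. 0 = flat_exp P x) (at_left 0)"
    unfolding eventually_at_left_field flat_exp_def by (intro exI[of _ "-1"]) auto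
  then have l: "(flat_exp P \<longlongrightarrow> 0) (at_left 0)"
    by (rule Lim_transform_eventually[OF tendsto_const])
  show ?thesis using l r by (simp add: filterlim_at_split)
qed

text \<open>At the origin the difference quotient is again a member of the family, for the polynomial \<open>pCons 0 P\<close>, so that
  differentiability there is the limit already computed.\<close>

lemma flat_derivative:
  "(flat_exp P has_real_derivative flat_exp ([:0,0,1:] * (P - pderiv P)) x) (at x)"
proof -
  consider "x > 0" | "x < 0" | "x = 0" by linarith
  then show ?thesis
  proof cases
    case 1
    have d: "((\<lambda>x. poly P (1/x) * exp (-1/x)) has_real_derivative
        flat_exp ([:0,0,1:] * (P - pderiv P)) x) (at x)"
      using 1 by (auto intro!: derivative_eq_intros simp: flat_exp_def field_simps power2_eq_square)
    show ?thesis
      by (rule has_field_derivative_transform_within_open[OF d, of "{0<..}"])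
        (use 1 in \<open>auto simp: flat_exp_def\<close>)
  next
    case 2
    have d: "((\<lambda>x. 0) has_real_derivative flat_exp ([:0,0,1:] * (P - pderiv P)) x) (at x)"
      using 2 by (simp add: flat_exp_def)
    show ?thesis
      by (rule has_field_derivative_transform_within_open[OF d, of "{..<0}"])
        (use 2 in \<open>auto simp: flat_exp_def\<close>)
  next
    case 3
    have "((\<lambda>h. (flat_exp P (0 + h) - flat_exp P 0) / h) \<longlongrightarrow> 0) (at 0)"
    proof (rule Lim_transform_eventually[OF flat_tendsto_0[of "pCons 0 P"]])
      show "\<forall>\<^sub>F x in at 0. flat_exp (pCons 0 P) x = (flat_exp P (0 + x) - flat_exp P 0) / x"
        by (auto simp: flat_exp_def)
    qed
    then show ?thesis by (simp add: 3 DERIV_def flat_exp_def)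
  qed
qed

lemma smooth_flat: "smooth (flat_exp P)"
proof -
  have "\<exists>P. f = flat_exp P \<Longrightarrow> smooth f" for f
  proof (coinduction arbitrary: f rule: smooth.coinduct)
    case smooth
    then obtain P where f: "f = flat_exp P" by auto
    let ?Q = "[:0,0,1:] * (P - pderiv P)"
    have "(flat_exp P has_derivative (\<lambda>h. flat_exp ?Q x * h)) (at x)" for x
      using flat_derivative[of P x] by (simp only: has_field_derivative_def)
    moreover have "(\<lambda>x. flat_exp ?Q x * h) = flat_exp (smult h ?Q)" for h
      by (auto simp: flat_exp_def fun_eq_iff)
    ultimately show ?case using f by (intro exI[of _ f] exI[of _ "\<lambda>x h. flat_exp ?Q x * h"]) auto
  qed
  then show ?thesis by blast
qed

definition bump :: "real \<Rightarrow> real" where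
  "bump x = flat_exp 1 x * flat_exp 1 (1 - x)"

lemma smooth_bump: "smooth bump"
proof -
  have "smooth (\<lambda>x. flat_exp 1 (1 * x + 0) * flat_exp 1 ((-1) * x + 1))"
    by (rule smooth_algI[OF smooth_alg.mult[OF
          smooth_alg.comp[OF smooth_flat bounded_linear_mult_right]
          smooth_alg.comp[OF smooth_flat bounded_linear_mult_right]]])
  then show ?thesis by (simp add: bump_def[abs_def])
qed

lemma smooth_imp_continuous:
  assumes "smooth f" shows "continuous_on S f"
proof -
  from assms obtain f' where "\<And>x. (f has_derivative f' x) (at x)" by cases blast
  then have "isCont f x" for x by (rule has_derivative_continuous)
  then show ?thesis by (simp add: continuous_at_imp_continuous_on)
qed

lemma bump_nonneg: "bump x \<ge> 0"
  and bump_outside: "x \<le> 0 \<or> x \<ge> 1 \<Longrightarrow> bump x = 0"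
  and bump_pos: "0 < x \<Longrightarrow> x < 1 \<Longrightarrow> bump x > 0"
  by (auto simp: bump_def flat_exp_def)

definition step' :: "real \<Rightarrow> real" where
  "step' x = bump x / integral {0..1} bump"

text \<open>A primitive of a normalised bump on \<open>[0,1]\<close>: a smooth Heaviside function. Integrating from \<open>-1\<close>
  keeps the origin in the interior of the interval of integration.\<close>

definition step :: "real \<Rightarrow> real" where
  "step x = integral {-1..x} step'"

lemma integral_bump_pos: "integral {0..1} bump > 0"
proof -
  have c: "continuous_on {0..1} bump" by (rule smooth_imp_continuous[OF smooth_bump])
  have "integral {0..1} bump \<ge> 0"
    by (intro integral_nonneg integrable_continuous_real c) (auto simp: bump_nonneg)
  moreover have "integral {0..1} bump \<noteq> 0"
  proof
    assume "integral {0..1} bump = 0"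
    then have "\<forall>x\<in>{0..1}. bump x = 0"
      using c by (subst (asm) integral_eq_0_iff) (auto simp: bump_nonneg)
    then have "bump (1/2) = 0" by (rule bspec) auto
    then show False using bump_pos[of "1/2"] by simp
  qed
  ultimately show ?thesis by simp
qed

lemma smooth_step': "smooth step'"
proof -
  have "step' = (\<lambda>x. inverse (integral {0..1} bump) * bump (1 * x + 0))"
    by (simp add: step'_def fun_eq_iff divide_inverse)
  moreover have "smooth (\<lambda>x. inverse (integral {0..1} bump) * bump (1 * x + 0))"
    by (rule smooth_scale[OF smooth_bump])
  ultimately show ?thesis by (simp only:)
qed

lemma continuous_step': "continuous_on S step'"
  by (rule smooth_imp_continuous[OF smooth_step'])

lemma step'_nonneg: "step' x \<ge> 0"
  unfolding step'_def by (rule divide_nonneg_pos[OF bump_nonneg integral_bump_pos])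

lemma step'_outside: "x \<le> 0 \<or> x \<ge> 1 \<Longrightarrow> step' x = 0"
  unfolding step'_def using bump_outside[of x] by simp

lemma step_le_0: "x \<le> 0 \<Longrightarrow> step x = 0"
proof -
  assume "x \<le> 0"
  then have "integral {-1..x} step' = integral {-1..x} (\<lambda>_. 0)"
    by (intro integral_cong) (auto simp: step'_outside)
  then show ?thesis by (simp add: step_def)
qed

lemma step_derivative: "(step has_real_derivative step' x) (at x)"
proof (cases "x < 0")
  case True
  have d: "((\<lambda>x. 0) has_real_derivative step' x) (at x)" using True by (simp add: step'_outside)
  show ?thesis
    by (rule has_field_derivative_transform_within_open[OF d, of "{..<0}"])
      (use True in \<open>auto simp: step_le_0\<close>)
next
  case False
  have "((\<lambda>u. integral {-1..u} step') has_real_derivative step' x) (at x within {-1..x+1})"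
    using False by (intro integral_has_real_derivative continuous_step') auto
  then have "(step has_real_derivative step' x) (at x within {-1..x+1})"
    by (simp add: step_def[abs_def])
  moreover have "at x within {-1..x+1} = at x"
    using False by (intro at_within_interior) auto
  ultimately show ?thesis by simp
qed

lemma smooth_step: "smooth step"
proof (rule smooth.intros[where f' = "\<lambda>x h. step' x * h"])
  show "(step has_derivative (\<lambda>h. step' x * h)) (at x)" for x
    using step_derivative[of x] unfolding has_field_derivative_def .
next
  have *: "smooth (\<lambda>x. h * step' (1 * x + 0))" for h by (rule smooth_scale[OF smooth_step'])
  have eq: "(\<lambda>x. step' x * h) = (\<lambda>x. h * step' (1 * x + 0))" for h by (rule ext) simp
  show "smooth (\<lambda>x. step' x * h)" for h unfolding eq by (rule *)
qed

lemma mono_step: "mono step"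
proof (rule monoI)
  fix x y :: real assume "x \<le> y"
  then show "step x \<le> step y"
    by (rule DERIV_nonneg_imp_nondecreasing) (use step_derivative step'_nonneg in blast)
qed

lemma step_ge_1: "x \<ge> 1 \<Longrightarrow> step x = 1"
proof -
  have 1: "step 1 = 1"
  proof -
    have "integral {-1..1} step' = integral {-1..0} step' + integral {0..1} step'"
      by (rule Henstock_Kurzweil_Integration.integral_combine[symmetric, OF _ _
            integrable_continuous_real[OF continuous_step']]) simp_all
    also have "integral {-1..0} step' = 0" using step_le_0[of 0] by (simp add: step_def)
    also have "integral {0..1} step' = 1"
    proof -
      have "integral {0..1} step' = integral {0..1} (\<lambda>x. bump x / integral {0..1} bump)"
        by (rule integral_cong) (rule step'_def)
      then show ?thesis using integral_bump_pos by simp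
    qed
    finally show ?thesis by (simp add: step_def)
  qed
  assume "x \<ge> 1"
  have "step x = step 1"
  proof (cases "x = 1")
    case False
    with \<open>x \<ge> 1\<close> have "1 < x" by simp
    from MVT2[OF this step_derivative] obtain z where "1 < z" "step x - step 1 = (x - 1) * step' z" by auto
    then show ?thesis by (simp add: step'_outside)
  qed simp
  with 1 show ?thesis by simp
qed

lemma step_range: "0 \<le> step x" "step x \<le> 1"
  using monoD[OF mono_step, of "min 0 x" x] monoD[OF mono_step, of x "max 1 x"]
  by (auto simp: step_le_0 step_ge_1)

lemma continuous_step: "continuous_on S step"
  by (rule smooth_imp_continuous[OF smooth_step])

lemma step_chain [derivative_intros]:
  "(f has_real_derivative f') (at x within S) \<Longrightarrow>
    ((\<lambda>x. step (f x)) has_real_derivative step' (f x) * f') (at x within S)"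
  by (rule DERIV_chain2[OF step_derivative])

section \<open>Sticky particles as a minimum of affine functions of time\<close>

text \<open>The value at \<open>k\<close> of the line through \<open>(i, q i)\<close> and \<open>(j, q j)\<close>.\<close>

definition chord :: "(nat \<Rightarrow> real) \<Rightarrow> nat \<Rightarrow> nat \<Rightarrow> nat \<Rightarrow> real" where
  "chord q i j k = ((real j - real k) * q i + (real k - real i) * q j) / (real j - real i)"

definition chord_pairs :: "nat \<Rightarrow> nat \<Rightarrow> (nat \<times> nat) set" where
  "chord_pairs n k = {(i, j). i < k \<and> k < j \<and> j \<le> n}"

text \<open>The lower convex envelope of finitely many points, written as a minimum over chords. In this form
  it is a minimum of expressions linear in \<open>q\<close>, which exposes its dependence on time.\<close>

definition discrete_hull :: "nat \<Rightarrow> (nat \<Rightarrow> real) \<Rightarrow> nat \<Rightarrow> real" where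
  "discrete_hull n q k = Min (insert (q k) ((\<lambda>(i, j). chord q i j k) ` chord_pairs n k))"

lemma finite_chord_pairs: "finite (chord_pairs n k)"
  by (rule finite_subset[of _ "{..k} \<times> {..n}"]) (auto simp: chord_pairs_def)

lemma chord_ends: "i < j \<Longrightarrow> chord q i j i = q i" "i < j \<Longrightarrow> chord q i j j = q j"
  by (auto simp: chord_def)

lemma discrete_hull_le: "discrete_hull n q k \<le> q k"
  unfolding discrete_hull_def by (rule Min_le) (auto simp: finite_chord_pairs)

lemma discrete_hull_le_chord:
  assumes "i < j" "j \<le> n" "i \<le> k" "k \<le> j"
  shows "discrete_hull n q k \<le> chord q i j k"
proof -
  consider "k = i" | "k = j" | "i < k" "k < j" using assms by linarith
  then show ?thesis
  proof cases
    case 3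
    then have "(i, j) \<in> chord_pairs n k" using assms by (auto simp: chord_pairs_def)
    then have "chord q i j k \<in> (\<lambda>(i, j). chord q i j k) ` chord_pairs n k"
      by (metis (mono_tags, lifting) case_prod_conv image_eqI)
    then show ?thesis unfolding discrete_hull_def
      by (intro Min_le) (auto simp: finite_chord_pairs)
  qed (use assms discrete_hull_le chord_ends in auto)
qed

lemma discrete_hull_cases:
  obtains "discrete_hull n q k = q k"
  | i j where "i < k" "k < j" "j \<le> n" "discrete_hull n q k = chord q i j k"
proof -
  have "discrete_hull n q k \<in> insert (q k) ((\<lambda>(i, j). chord q i j k) ` chord_pairs n k)"
    unfolding discrete_hull_def by (rule Min_in) (auto simp: finite_chord_pairs)
  then show ?thesis using that by (auto simp: chord_pairs_def)
qed

lemma line_le_chord: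
  assumes "i < k" "k < j" "c + s * real i \<le> q i" "c + s * real j \<le> q j"
  shows "c + s * real k \<le> chord q i j k"
proof -
  have "(c + s * real k) * (real j - real i)
      = (real j - real k) * (c + s * real i) + (real k - real i) * (c + s * real j)"
    by (simp add: algebra_simps)
  also have "\<dots> \<le> (real j - real k) * q i + (real k - real i) * q j"
    using assms by (intro add_mono mult_left_mono) auto
  finally show ?thesis using assms by (simp add: chord_def pos_le_divide_eq)
qed

lemma line_le_discrete_hull:
  assumes "\<And>j. j \<le> n \<Longrightarrow> c + s * real j \<le> q j" "k \<le> n"
  shows "c + s * real k \<le> discrete_hull n q k"
  by (rule discrete_hull_cases[of n q k]) (use assms line_le_chord[of _ k _ c s q] in auto)

lemma separate_finite_sets:
  fixes A B :: "real set"
  assumes "finite A" "finite B" "\<And>a b. a \<in> A \<Longrightarrow> b \<in> B \<Longrightarrow> a \<le> b"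
  shows "\<exists>s. (\<forall>a\<in>A. a \<le> s) \<and> (\<forall>b\<in>B. s \<le> b)"
proof (cases "A = {}")
  case True
  then show ?thesis using assms(2) by (cases "B = {}") (auto intro!: exI[of _ "Min B"])
next
  case False
  then show ?thesis using assms by (intro exI[of _ "Max A"]) auto
qed

text \<open>The chords above the point \<open>(k, discrete_hull n q k)\<close> say exactly that every slope forced from the
  left is at most every slope forced from the right; any slope in between gives a supporting line.\<close>

lemma discrete_hull_supporting_line:
  assumes "k \<le> n"
  obtains s where "\<And>j. j \<le> n \<Longrightarrow> discrete_hull n q k + s * (real j - real k) \<le> q j"
proof -
  define c where "c = discrete_hull n q k"
  let ?A = "(\<lambda>i. (c - q i) / (real k - real i)) ` {..<k}"
  let ?B = "(\<lambda>j. (q j - c) / (real j - real k)) ` {k<..n}"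
  have "\<exists>s. (\<forall>a\<in>?A. a \<le> s) \<and> (\<forall>b\<in>?B. s \<le> b)"
  proof (rule separate_finite_sets)
    fix a b assume "a \<in> ?A" "b \<in> ?B"
    then obtain i j where ij: "i < k" "k < j" "j \<le> n"
      and a: "a = (c - q i) / (real k - real i)" and b: "b = (q j - c) / (real j - real k)" by auto
    have "c \<le> chord q i j k" unfolding c_def by (rule discrete_hull_le_chord) (use ij in auto)
    then have "c * (real j - real i) \<le> (real j - real k) * q i + (real k - real i) * q j"
      using ij by (simp add: chord_def pos_le_divide_eq)
    then have "(c - q i) * (real j - real k) \<le> (q j - c) * (real k - real i)"
      by (simp add: algebra_simps)
    then show "a \<le> b" using ij by (simp add: a b divide_simps mult.commute)
  qed auto
  then obtain s where s: "\<And>a. a \<in> ?A \<Longrightarrow> a \<le> s" "\<And>b. b \<in> ?B \<Longrightarrow> s \<le> b" by blast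
  show ?thesis
  proof (rule that[of s])
    fix j assume "j \<le> n"
    consider "j < k" | "j = k" | "k < j" by linarith
    then show "discrete_hull n q k + s * (real j - real k) \<le> q j"
    proof cases
      case 1
      then have "(c - q j) / (real k - real j) \<le> s" by (intro s) auto
      then show ?thesis using 1 by (simp add: pos_divide_le_eq c_def algebra_simps)
    next
      case 3
      then have "s \<le> (q j - c) / (real j - real k)" using \<open>j \<le> n\<close> by (intro s) auto
      then show ?thesis using 3 by (simp add: pos_le_divide_eq c_def algebra_simps)
    qed (simp add: discrete_hull_le)
  qed
qed

text \<open>A supporting line at the middle node lies below the data, hence below the envelope at the two
  neighbours.\<close>

lemma discrete_hull_convex:
  assumes "Suc k < n" shows "2 * discrete_hull n q (Suc k) \<le> discrete_hull n q k + discrete_hull n q (Suc (Suc k))"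
proof -
  let ?c = "discrete_hull n q (Suc k)"
  obtain s where s: "\<And>j. j \<le> n \<Longrightarrow> ?c + s * (real j - real (Suc k)) \<le> q j"
    using discrete_hull_supporting_line[of "Suc k" n q] assms by auto
  have *: "j \<le> n \<Longrightarrow> (?c - s * real (Suc k)) + s * real j \<le> q j" for j
    using s[of j] by (simp add: algebra_simps)
  from line_le_discrete_hull[where n=n and q=q, OF this, of k]
    line_le_discrete_hull[where n=n and q=q, OF this, of "Suc (Suc k)"]
  show ?thesis using assms by (simp add: algebra_simps)
qed

text \<open>Off the contact set the minimum is attained on a genuine chord, and that chord bounds the envelope
  from above at both neighbouring nodes. For the particles this says that two neighbours separated by
  a node off contact sit at the same place.\<close>

lemma discrete_hull_linear_off_contact:
  assumes "discrete_hull n q (Suc k) \<noteq> q (Suc k)" "Suc k < n"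
  shows "2 * discrete_hull n q (Suc k) = discrete_hull n q k + discrete_hull n q (Suc (Suc k))"
proof (rule discrete_hull_cases[of n q "Suc k"])
  fix i j assume ij: "i < Suc k" "Suc k < j" "j \<le> n" and eq: "discrete_hull n q (Suc k) = chord q i j (Suc k)"
  have "discrete_hull n q k + discrete_hull n q (Suc (Suc k)) \<le> chord q i j k + chord q i j (Suc (Suc k))"
    using ij by (intro add_mono discrete_hull_le_chord) auto
  also have "\<dots> = 2 * chord q i j (Suc k)"
    using ij by (simp add: chord_def add_divide_distrib[symmetric] algebra_simps)
  finally show ?thesis using discrete_hull_convex[OF assms(2), of q] eq by simp
qed (use assms in auto)

lemma chord_convex_combination:
  assumes "i < k" "k < j"
  obtains u where "0 \<le> u" "u \<le> 1" "real k = (1 - u) * real i + u * real j"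
    "\<And>q. chord q i j k = (1 - u) * q i + u * q j"
proof -
  let ?d = "real j - real i" and ?u = "(real k - real i) / (real j - real i)"
  have d: "?d \<noteq> 0" using assms by simp
  have u: "1 - ?u = (real j - real k) / ?d" using d by (simp add: diff_divide_eq_iff)
  show ?thesis
  proof (rule that[of ?u])
    have "real k * ?d = (real j - real k) * real i + (real k - real i) * real j"
      by (simp add: algebra_simps)
    then have "real k = ((real j - real k) * real i + (real k - real i) * real j) / ?d"
      using d by (simp add: eq_divide_eq)
    then show "real k = (1 - ?u) * real i + ?u * real j"
      unfolding u by (simp only: add_divide_distrib times_divide_eq_left)
    show "chord q i j k = (1 - ?u) * q i + ?u * q j" for q
      unfolding u chord_def by (simp only: add_divide_distrib times_divide_eq_left)
  qed (use assms in auto)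
qed

lemma interp_node:
  assumes "n \<ge> 1" shows "interp n y (real k / real n) = (\<Sum>j=1..k. y j)"
  using assms by (simp add: interp_def)

lemma affine_le_interp:
  assumes n: "n \<ge> 1" and v: "v \<in> {0..1}"
    and le: "\<And>k. k \<le> n \<Longrightarrow> c + s * real k \<le> (\<Sum>j=1..k. y j)"
  shows "c + s * (real n * v) \<le> interp n y v"
proof -
  define k where "k = nat \<lfloor>real n * v\<rfloor>"
  define f where "f = real n * v - real k"
  have f: "0 \<le> f" "f < 1" unfolding f_def k_def using v n by (auto simp: of_nat_nat) linarith
  have nv: "real n * v = real k + f" by (simp add: f_def)
  have "real n * v \<le> real n" using v n by (simp add: mult_left_le)
  then have "real k \<le> real n" using nv f by linarith
  then have "k \<le> n" by simp
  have I: "interp n y v = (\<Sum>j=1..k. y j) + f * y (Suc k)"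
    by (simp add: interp_def Let_def k_def[symmetric] f_def)
  show ?thesis
  proof (cases "k = n")
    case True
    then have "f = 0" using \<open>real n * v \<le> real n\<close> nv f by linarith
    then show ?thesis using I nv le[OF \<open>k \<le> n\<close>] by simp
  next
    case False
    then have "Suc k \<le> n" using \<open>k \<le> n\<close> by simp
    have "c + s * (real k + f) = (1 - f) * (c + s * real k) + f * (c + s * real (Suc k))"
      by (simp add: algebra_simps)
    also have "\<dots> \<le> (1 - f) * (\<Sum>j=1..k. y j) + f * (\<Sum>j=1..Suc k. y j)"
      using f le[OF \<open>k \<le> n\<close>] le[OF \<open>Suc k \<le> n\<close>] by (intro add_mono mult_left_mono) auto
    also have "\<dots> = interp n y v" by (simp add: I algebra_simps)
    finally show ?thesis by (simp add: nv)
  qed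
qed

text \<open>One inequality is convexity along chords; for the other, the discrete supporting line is itself
  admissible in the supremum, since a line below the nodes is below the piecewise linear interpolant.\<close>

lemma convex_hull_fun_node:
  assumes n: "n \<ge> 1" and k: "k \<le> n"
  shows "convex_hull_fun (interp n y) (real k / real n) = discrete_hull n (\<lambda>k. \<Sum>j=1..k. y j) k"
proof -
  let ?q = "\<lambda>k. \<Sum>j=1..k. y j" and ?v = "\<lambda>k. real k / real n"
  let ?G = "{g. convex_on {0..1} g \<and> (\<forall>w\<in>{0..1}. g w \<le> interp n y w)}"
  have v01: "?v k \<in> {0..1}" if "k \<le> n" for k using n that by auto
  obtain s where s: "\<And>j. j \<le> n \<Longrightarrow> discrete_hull n ?q k + s * (real j - real k) \<le> ?q j"
    using discrete_hull_supporting_line[of k n ?q, OF k] by auto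
  define supp where "supp v = (discrete_hull n ?q k - s * real k) + s * (real n * v)" for v
  have "supp v \<le> interp n y v" if "v \<in> {0..1}" for v
    unfolding supp_def by (rule affine_le_interp[OF n that]) (use s in \<open>auto simp: algebra_simps\<close>)
  moreover have "convex_on {0..1} supp"
    by (intro convex_onI) (simp_all add: supp_def algebra_simps)
  ultimately have supp: "supp \<in> ?G" by auto
  have suppk: "supp (?v k) = discrete_hull n ?q k" using n by (simp add: supp_def)
  have le: "g (?v k) \<le> discrete_hull n ?q k" if "g \<in> ?G" for g
  proof (rule discrete_hull_cases[of n ?q k])
    assume "discrete_hull n ?q k = ?q k"
    moreover have "g (?v k) \<le> interp n y (?v k)" using that v01[OF k] by blast
    ultimately show ?thesis by (simp only: interp_node[OF n])
  next
    fix i j assume ij: "i < k" "k < j" "j \<le> n" and eq: "discrete_hull n ?q k = chord ?q i j k"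
    obtain u where u: "0 \<le> u" "u \<le> 1" and uk: "real k = (1 - u) * real i + u * real j"
      and uq: "\<And>q. chord q i j k = (1 - u) * q i + u * q j"
      using chord_convex_combination[OF ij(1,2)] by blast
    have comb: "?v k = (1 - u) * ?v i + u * ?v j"
      unfolding uk by (simp only: add_divide_distrib times_divide_eq_right)
    have vij: "?v i \<in> {0..1}" "?v j \<in> {0..1}" using v01[of i] v01[of j] ij by auto
    have gc: "convex_on {0..1} g" and gle: "\<And>w. w \<in> {0..1} \<Longrightarrow> g w \<le> interp n y w" using that by auto
    have "g (?v k) \<le> (1 - u) * g (?v i) + u * g (?v j)"
      using convex_onD[OF gc u vij] unfolding comb by simp
    also have "\<dots> \<le> (1 - u) * ?q i + u * ?q j"
      using u gle[OF vij(1)] gle[OF vij(2)] unfolding interp_node[OF n]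
      by (intro add_mono mult_left_mono) auto
    finally show ?thesis unfolding eq uq .
  qed
  have "Sup {g (?v k) | g. g \<in> ?G} = discrete_hull n ?q k"
  proof (rule cSup_eq_maximum)
    show "discrete_hull n ?q k \<in> {g (?v k) | g. g \<in> ?G}" using supp suppk by (metis (mono_tags, lifting) mem_Collect_eq)
  next
    fix z assume "z \<in> {g (?v k) | g. g \<in> ?G}"
    then obtain g where "g \<in> ?G" "z = g (?v k)" by blast
    then show "z \<le> discrete_hull n ?q k" using le by blast
  qed
  then show ?thesis unfolding convex_hull_fun_def mem_Collect_eq .
qed

lemma spd_discrete_hull:
  assumes "n \<ge> 1" "Suc k \<le> n"
  shows "spd n l x t (Suc k) = discrete_hull n (\<lambda>k. \<Sum>j=1..k. x j + t * l j) (Suc k)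
      - discrete_hull n (\<lambda>k. \<Sum>j=1..k. x j + t * l j) k"
  using convex_hull_fun_node[OF assms, of "\<lambda>j. x j + t * l j"]
    convex_hull_fun_node[OF assms(1), of k "\<lambda>j. x j + t * l j"] assms
  by (simp add: spd_def Let_def)

lemma spd_sorted:
  assumes "n \<ge> 1" "1 \<le> k" "k < n"
  shows "spd n l x t k \<le> spd n l x t (Suc k)"
proof -
  obtain m where m: "k = Suc m" using assms by (cases k) auto
  show ?thesis
    using discrete_hull_convex[of m n "\<lambda>k. \<Sum>j=1..k. x j + t * l j"] assms
    by (simp add: m spd_discrete_hull)
qed

text \<open>The affine functions of time \<open>a + b t\<close> whose minimum is the envelope at node \<open>k\<close> of the data
  \<open>A + t B\<close>.\<close>

definition hull_lines :: "nat \<Rightarrow> (nat \<Rightarrow> real) \<Rightarrow> (nat \<Rightarrow> real) \<Rightarrow> nat \<Rightarrow> (real \<times> real) set" where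
  "hull_lines n A B k = insert (A k, B k) ((\<lambda>(i, j). (chord A i j k, chord B i j k)) ` chord_pairs n k)"

lemma finite_hull_lines: "finite (hull_lines n A B k)" "hull_lines n A B k \<noteq> {}"
  by (auto simp: hull_lines_def finite_chord_pairs)

lemma chord_affine: "chord (\<lambda>k. A k + t * B k) i j k = chord A i j k + chord B i j k * t"
  by (simp add: chord_def add_divide_distrib[symmetric] algebra_simps)

lemma discrete_hull_affine:
  "discrete_hull n (\<lambda>k. A k + t * B k) k = Min ((\<lambda>(a, b). a + b * t) ` hull_lines n A B k)"
  by (simp add: discrete_hull_def hull_lines_def image_image chord_affine case_prod_beta mult.commute)

lemma Min_affine_continuous:
  assumes "finite F" "F \<noteq> {}"
  shows "continuous_on UNIV (\<lambda>t::real. Min ((\<lambda>(a, b). a + b * t) ` F))"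
  using assms
proof (induction rule: finite_ne_induct)
  case (insert f F)
  then show ?case
    by (cases f) (auto intro!: continuous_intros)
qed (auto intro!: continuous_intros simp: case_prod_beta)

text \<open>Among the lines minimal at time \<open>s\<close>, one of least slope stays minimal for a while; a line that is
  not minimal at \<open>s\<close> needs time proportional to its gap to catch up.\<close>

lemma Min_affine_right:
  fixes F :: "(real \<times> real) set" and s :: real
  assumes F: "finite F" "F \<noteq> {}"
  shows "\<exists>\<delta>>0. \<exists>(a, b)\<in>F. \<forall>t\<in>{s..s+\<delta>}. Min ((\<lambda>(a, b). a + b * t) ` F) = a + b * t"
proof -
  define m where "m = Min ((\<lambda>(a, b). a + b * s) ` F)"
  define F' where "F' = {f \<in> F. fst f + snd f * s = m}"
  have "m \<in> (\<lambda>(a, b). a + b * s) ` F" unfolding m_def using F by (intro Min_in) auto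
  then have F': "finite F'" "F' \<noteq> {}" using F by (auto simp: F'_def)
  have m_le: "m \<le> fst f + snd f * s" if "f \<in> F" for f
    unfolding m_def using F that by (intro Min_le) (auto simp: case_prod_beta)
  have "Min (snd ` F') \<in> snd ` F'" using F' by (intro Min_in) auto
  then obtain f0 where f0: "f0 \<in> F'" "snd f0 = Min (snd ` F')" by auto
  have b_le: "snd f0 \<le> snd f" if "f \<in> F'" for f using f0(2) F' that by auto
  have f0m: "f0 \<in> F" "fst f0 + snd f0 * s = m" using f0(1) by (auto simp: F'_def)
  have "\<exists>d>0. \<forall>t\<in>{s..s+d}. fst f0 + snd f0 * t \<le> fst f + snd f * t" if "f \<in> F" for f
  proof (cases "f \<in> F'")
    case True
    have "fst f0 + snd f0 * t \<le> fst f + snd f * t" if "t \<ge> s" for t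
    proof -
      have "snd f0 * (t - s) \<le> snd f * (t - s)" using b_le[OF True] that by (intro mult_right_mono) auto
      then show ?thesis using f0m True by (simp add: F'_def algebra_simps)
    qed
    then show ?thesis by (intro exI[of _ 1]) auto
  next
    case False
    define g where "g = fst f + snd f * s - m"
    have "g > 0" using m_le[OF that] False that by (auto simp: g_def F'_def)
    define d where "d = g / (\<bar>snd f0 - snd f\<bar> + 1)"
    have "fst f0 + snd f0 * t \<le> fst f + snd f * t" if "t \<in> {s..s+d}" for t
    proof -
      have "(snd f0 - snd f) * (t - s) \<le> (\<bar>snd f0 - snd f\<bar> + 1) * d"
        using that by (intro mult_mono) auto
      also have "\<dots> = g" by (simp add: d_def)
      finally show ?thesis using f0m by (simp add: g_def algebra_simps)
    qed
    moreover have "d > 0" using \<open>g > 0\<close> by (simp add: d_def)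
    ultimately show ?thesis by blast
  qed
  then obtain d where d: "\<And>f. f \<in> F \<Longrightarrow> d f > (0::real)"
    "\<And>f t. f \<in> F \<Longrightarrow> t \<in> {s..s + d f} \<Longrightarrow> fst f0 + snd f0 * t \<le> fst f + snd f * t"
    by metis
  let ?d = "Min (d ` F)"
  have "Min ((\<lambda>(a, b). a + b * t) ` F) = fst f0 + snd f0 * t" if t: "t \<in> {s..s + ?d}" for t
  proof (rule Min_eqI)
    fix y assume "y \<in> (\<lambda>(a, b). a + b * t) ` F"
    then obtain f where f: "f \<in> F" "y = fst f + snd f * t" by auto
    have "?d \<le> d f" using F f by auto
    then show "fst f0 + snd f0 * t \<le> y" using d(2)[OF f(1)] t f by auto
  qed (use F f0m in \<open>auto simp: case_prod_beta\<close>)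
  moreover have "?d > 0" using F d by auto
  ultimately show ?thesis using f0m
    by (intro exI[of _ ?d]) (auto simp: case_prod_beta intro!: bexI[of _ f0])
qed

lemma partial_sums_affine:
  "(\<lambda>k. \<Sum>j=1..k. x j + t * l j) = (\<lambda>k. (\<Sum>j=1..k. x j) + t * (\<Sum>j=1..k. l j :: real))"
  by (simp add: sum.distrib sum_distrib_left)

lemma spd_continuous:
  assumes "n \<ge> 1" "1 \<le> k" "k \<le> n"
  shows "continuous_on UNIV (\<lambda>t. spd n l x t k)"
proof -
  obtain m where m: "k = Suc m" using assms by (cases k) auto
  have "continuous_on UNIV (\<lambda>t. discrete_hull n (\<lambda>k. \<Sum>j=1..k. x j + t * l j) (Suc m)
      - discrete_hull n (\<lambda>k. \<Sum>j=1..k. x j + t * l j) m)"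
    unfolding partial_sums_affine discrete_hull_affine
    by (intro continuous_on_diff Min_affine_continuous finite_hull_lines)
  then show ?thesis using assms by (simp add: m spd_discrete_hull)
qed

text \<open>The partial sums of a nondecreasing sequence are convex: at time zero nothing sticks, and the
  envelope is the data.\<close>

lemma chord_partial_sums_ge:
  assumes x: "x \<in> D n" and ij: "i < k" "k < j" "j \<le> n"
  shows "(\<Sum>j=1..k. x j) \<le> chord (\<lambda>k. \<Sum>j=1..k. x j) i j k"
proof -
  let ?A = "\<lambda>k. \<Sum>j=1..k. x j"
  have mono: "x a \<le> x b" if "1 \<le> a" "a \<le> b" "b \<le> n" for a b
    using x that by (auto simp: D_def mono_on_def)
  have "?A k - ?A i = (\<Sum>a\<in>{i<..k}. x a)"
  proof -
    have "{1..k} = {1..i} \<union> {i<..k}" using ij by auto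
    then have "?A k = sum x ({1..i} \<union> {i<..k})" by (simp only:)
    also have "\<dots> = ?A i + sum x {i<..k}" by (rule sum.union_disjoint) auto
    finally show ?thesis by simp
  qed
  also have "\<dots> \<le> (\<Sum>a\<in>{i<..k}. x k)" using ij by (intro sum_mono mono) auto
  also have "\<dots> = (real k - real i) * x k" using ij by (simp add: of_nat_diff)
  finally have 1: "?A k - ?A i \<le> (real k - real i) * x k" .
  have "(real j - real k) * x k = (\<Sum>a\<in>{k<..j}. x k)" using ij by (simp add: of_nat_diff)
  also have "\<dots> \<le> (\<Sum>a\<in>{k<..j}. x a)" using ij by (intro sum_mono mono) auto
  also have "\<dots> = ?A j - ?A k"
  proof -
    have "{1..j} = {1..k} \<union> {k<..j}" using ij by auto
    then have "?A j = sum x ({1..k} \<union> {k<..j})" by (simp only:)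
    also have "\<dots> = ?A k + sum x {k<..j}" by (rule sum.union_disjoint) auto
    finally show ?thesis by simp
  qed
  finally have 2: "(real j - real k) * x k \<le> ?A j - ?A k" .
  have "(real j - real k) * (?A k - ?A i) \<le> (real j - real k) * ((real k - real i) * x k)"
    using 1 ij by (intro mult_left_mono) auto
  moreover have "(real k - real i) * ((real j - real k) * x k) \<le> (real k - real i) * (?A j - ?A k)"
    using 2 ij by (intro mult_left_mono) auto
  ultimately have "?A k * (real j - real i) \<le> (real j - real k) * ?A i + (real k - real i) * ?A j"
    by (simp add: algebra_simps)
  then show ?thesis using ij by (simp add: chord_def pos_le_divide_eq)
qed

text \<open>On a short interval to the right of any time, every node of the envelope follows one line
  \<open>a k + b k t\<close>. The defect \<open>e k\<close> is \<open>b k\<close> minus the slope in time of the data. It is nonpositive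
  because that line lies above the data at time zero and below it later, and where it is nonzero the
  node leaves contact, so that the neighbouring particles move together.\<close>

lemma spd_locally_affine:
  assumes n: "n \<ge> 1" and x: "x \<in> D n" and s: "s \<ge> 0"
  obtains \<delta> \<alpha> \<beta> e where "\<delta> > 0"
    "\<And>t k. t \<in> {s..s+\<delta>} \<Longrightarrow> k \<in> {1..n} \<Longrightarrow> spd n l x t k = \<alpha> k + \<beta> k * t"
    "\<And>k. k \<in> {1..n} \<Longrightarrow> \<beta> k = l k + e k - e (k - 1)"
    "e 0 = 0" "e n = 0" "\<And>k. k \<le> n \<Longrightarrow> e k \<le> 0"
    "\<And>k. 1 \<le> k \<Longrightarrow> k < n \<Longrightarrow> e k \<noteq> 0 \<Longrightarrow> \<alpha> k = \<alpha> (Suc k) \<and> \<beta> k = \<beta> (Suc k)"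
proof -
  let ?A = "\<lambda>k. \<Sum>j=1..k. x j" and ?B = "\<lambda>k. \<Sum>j=1..k. l j"
  let ?q = "\<lambda>t k. \<Sum>j=1..k. x j + t * l j"
  let ?p = "\<lambda>t. discrete_hull n (?q t)"
  let ?H = "hull_lines n ?A ?B"
  have q: "?q t k = ?A k + ?B k * t" for t k by (simp add: sum.distrib sum_distrib_left mult.commute)
  have "\<exists>\<delta>>0. \<exists>ab\<in>?H k. \<forall>t\<in>{s..s+\<delta>}. ?p t k = fst ab + snd ab * t" for k
    using Min_affine_right[OF finite_hull_lines[of n ?A ?B k], of s]
    unfolding partial_sums_affine discrete_hull_affine by (auto simp: case_prod_beta)
  then have "\<forall>k. \<exists>d ab. d > (0::real) \<and> ab \<in> ?H k \<and> (\<forall>t\<in>{s..s+d}. ?p t k = fst ab + snd ab * t)"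
    by blast
  then obtain d ab where "\<forall>k. d k > (0::real) \<and> ab k \<in> ?H k \<and>
      (\<forall>t\<in>{s..s + d k}. ?p t k = fst (ab k) + snd (ab k) * t)"
    unfolding choice_iff by blast
  then have d: "d k > 0" "ab k \<in> ?H k" "t \<in> {s..s + d k} \<Longrightarrow> ?p t k = fst (ab k) + snd (ab k) * t" for k t
    by blast+
  define \<delta> where "\<delta> = Min (d ` {..n})"
  define a b where "a k = fst (ab k)" and "b k = snd (ab k)" for k
  have \<delta>: "\<delta> > 0" using d(1) by (auto simp: \<delta>_def)
  have p: "?p t k = a k + b k * t" if "t \<in> {s..s+\<delta>}" "k \<le> n" for t k
  proof -
    have "\<delta> \<le> d k" using that by (auto simp: \<delta>_def)
    then show ?thesis using d(3)[of t k] that by (auto simp: a_def b_def)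
  qed
  define \<alpha> \<beta> e where "\<alpha> k = a k - a (k - 1)" and "\<beta> k = b k - b (k - 1)" and "e k = b k - ?B k" for k
  have spd: "spd n l x t k = ?p t k - ?p t (k - 1)" if "k \<in> {1..n}" for t k
    using that n spd_discrete_hull[of n "k - 1" l x t] by simp
  have ab: "(a k = ?A k \<and> b k = ?B k) \<or> (\<exists>i j. i < k \<and> k < j \<and> j \<le> n \<and> a k = chord ?A i j k)" for k
  proof -
    consider "ab k = (?A k, ?B k)" | i j where "(i, j) \<in> chord_pairs n k" "ab k = (chord ?A i j k, chord ?B i j k)"
      using d(2)[of k] unfolding hull_lines_def
      by (elim insertE imageE) (force simp del: One_nat_def)+
    then show ?thesis
    proof cases
      case 1
      then show ?thesis by (simp add: a_def b_def)
    next
      case 2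
      then have "i < k \<and> k < j \<and> j \<le> n \<and> a k = chord ?A i j k" by (simp add: a_def chord_pairs_def)
      then show ?thesis by blast
    qed
  qed
  show ?thesis
  proof (rule that[of \<delta> \<alpha> \<beta> e])
    show "\<delta> > 0" by (rule \<delta>)
    show aff: "spd n l x t k = \<alpha> k + \<beta> k * t" if "t \<in> {s..s+\<delta>}" "k \<in> {1..n}" for t k
    proof -
      have "?p t k = a k + b k * t" "?p t (k - 1) = a (k - 1) + b (k - 1) * t"
        by (rule p; use that in auto)+
      then show ?thesis unfolding spd[OF that(2)] by (simp add: \<alpha>_def \<beta>_def algebra_simps)
    qed
    show "\<beta> k = l k + e k - e (k - 1)" if k: "k \<in> {1..n}" for k
    proof -
      obtain m where "k = Suc m" using k by (cases k) auto
      then have "?B k = ?B (k - 1) + l k" by simp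
      then show ?thesis by (simp add: \<beta>_def e_def)
    qed
    show "e 0 = 0" "e n = 0" using ab[of 0] ab[of n] by (auto simp: e_def)
    show "e k \<le> 0" if "k \<le> n" for k
    proof -
      have "?A k \<le> a k" using ab[of k] chord_partial_sums_ge[OF x, of _ k] by auto
      have "a k + b k * (s + \<delta>) \<le> ?A k + ?B k * (s + \<delta>)"
        using p[of "s + \<delta>" k] discrete_hull_le[of n "?q (s + \<delta>)" k] \<delta> that q by simp
      with \<open>?A k \<le> a k\<close> have "b k * (s + \<delta>) \<le> ?B k * (s + \<delta>)" by linarith
      then show ?thesis using s \<delta> by (simp add: e_def)
    qed
    show "\<alpha> k = \<alpha> (Suc k) \<and> \<beta> k = \<beta> (Suc k)" if k: "1 \<le> k" "k < n" and e: "e k \<noteq> 0" for k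
    proof -
      obtain m where m: "k = Suc m" using k by (cases k) auto
      have off: "\<alpha> k + \<beta> k * t = \<alpha> (Suc k) + \<beta> (Suc k) * t"
        if t: "t \<in> {s..s+\<delta>}" and ne: "?p t k \<noteq> ?q t k" for t
      proof -
        have "2 * ?p t k = ?p t m + ?p t (Suc k)"
          using discrete_hull_linear_off_contact[of n "?q t" m] ne k by (simp add: m)
        then have "spd n l x t k = spd n l x t (Suc k)" using k by (simp add: spd m)
        then show ?thesis using aff[OF t, of k] aff[OF t, of "Suc k"] k by simp
      qed
      \<comment> \<open>Two affine functions with different slopes meet at most once, so two of the three
        times below avoid the contact.\<close>
      have contact: "t = t'" if "t \<in> {s..s+\<delta>}" "t' \<in> {s..s+\<delta>}" "?p t k = ?q t k" "?p t' k = ?q t' k" for t t'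
      proof -
        have "a k + b k * t = ?A k + ?B k * t" "a k + b k * t' = ?A k + ?B k * t'"
          using p[of t k] p[of t' k] that k q by auto
        then have "e k * (t - t') = 0" by (simp add: e_def algebra_simps)
        then show ?thesis using e by simp
      qed
      have "\<exists>t t'. t \<noteq> t' \<and> t \<in> {s..s+\<delta>} \<and> t' \<in> {s..s+\<delta>} \<and> ?p t k \<noteq> ?q t k \<and> ?p t' k \<noteq> ?q t' k"
      proof -
        have I: "s \<in> {s..s+\<delta>}" "s + \<delta>/2 \<in> {s..s+\<delta>}" "s + \<delta> \<in> {s..s+\<delta>}" using \<delta> by auto
        have ne: "s \<noteq> s + \<delta>/2" "s \<noteq> s + \<delta>" "s + \<delta>/2 \<noteq> s + \<delta>" using \<delta> by auto
        show ?thesis using contact I ne by (metis (no_types, lifting))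
      qed
      then obtain t t' where tt: "t \<noteq> t'" "\<alpha> k + \<beta> k * t = \<alpha> (Suc k) + \<beta> (Suc k) * t"
        "\<alpha> k + \<beta> k * t' = \<alpha> (Suc k) + \<beta> (Suc k) * t'" using off by blast
      then have "(\<beta> k - \<beta> (Suc k)) * (t - t') = 0" by (simp add: algebra_simps)
      then have "\<beta> k = \<beta> (Suc k)" using tt(1) by simp
      then show ?thesis using tt(2) by simp
    qed
  qed
qed

section \<open>Entropy dissipation of the sticky shocks\<close>

lemma abel_summation:
  fixes a r :: "nat \<Rightarrow> real"
  shows "(\<Sum>k\<le>n. a k * (r k - r (Suc k)))
    = a 0 * r 0 - a n * r (Suc n) + (\<Sum>k=1..n. r k * (a k - a (k - 1)))"
proof (induction n)
  case (Suc n)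
  show ?case unfolding sum.atMost_Suc Suc.IH by (simp add: algebra_simps)
qed (simp add: algebra_simps)

lemma mean_value_01:
  assumes \<Lambda>: "\<forall>v\<in>{0..1}. (\<Lambda> has_real_derivative lam v) (at v within {0..1})"
    and ab: "0 \<le> a" "a \<le> b" "b \<le> 1"
  obtains z where "a \<le> z" "z \<le> b" "\<Lambda> b - \<Lambda> a = lam z * (b - a)"
proof -
  have "(\<Lambda> has_derivative (*) (lam v)) (at v within {a..b})" if "a \<le> v" "v \<le> b" for v
  proof -
    have "(\<Lambda> has_real_derivative lam v) (at v within {a..b})"
    proof (rule has_field_derivative_subset)
      show "(\<Lambda> has_real_derivative lam v) (at v within {0..1})" using \<Lambda> that ab by simp
    qed (use ab in auto)
    then show ?thesis by (simp only: has_field_derivative_def)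
  qed
  then obtain z where "z \<in> {a..b}" "\<Lambda> b - \<Lambda> a = lam z * (b - a)"
    using mvt_very_simple[OF ab(2), of \<Lambda> "\<lambda>v. (*) (lam v)"] by blast
  then show ?thesis using that[of z] by simp
qed

text \<open>The mean value theorem on both sides of the intermediate point bounds the chord error by the
  oscillation of the speed, times \<open>s (1 - s) h\<close>.\<close>

lemma chord_above_flux:
  assumes \<Lambda>: "\<forall>v\<in>{0..1}. (\<Lambda> has_real_derivative lam v) (at v within {0..1})"
    and lip: "L-lipschitz_on {0..1} lam"
    and c: "0 \<le> c" "0 \<le> h" "c + h \<le> 1" and s: "0 \<le> s" "s \<le> 1"
  shows "2 * ((1 - s) * \<Lambda> c + s * \<Lambda> (c + h) - \<Lambda> (c + s * h)) \<le> L * h\<^sup>2"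
proof -
  have sh: "0 \<le> s * h" "s * h \<le> h" using s c by (simp_all add: mult_left_le_one_le)
  obtain z where z: "c \<le> z" "z \<le> c + s * h" "\<Lambda> (c + s * h) - \<Lambda> c = lam z * (c + s * h - c)"
    by (rule mean_value_01[OF \<Lambda>, of c "c + s * h"]) (use sh c in linarith)+
  obtain y where y: "c + s * h \<le> y" "y \<le> c + h" "\<Lambda> (c + h) - \<Lambda> (c + s * h) = lam y * (c + h - (c + s * h))"
    by (rule mean_value_01[OF \<Lambda>, of "c + s * h" "c + h"]) (use sh c in linarith)+
  have L: "L \<ge> 0" using lip by (rule lipschitz_on_nonneg)
  have "lam y - lam z \<le> L * \<bar>y - z\<bar>"
  proof -
    have "y \<in> {0..1}" "z \<in> {0..1}" using y(1,2) z(1,2) c sh by simp_all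
    then have "\<bar>lam y - lam z\<bar> \<le> L * \<bar>y - z\<bar>"
      using lipschitz_onD[OF lip, of y z] by (simp add: dist_real_def)
    then show ?thesis by linarith
  qed
  also have "\<dots> \<le> L * h" by (rule mult_left_mono[OF _ L]) (use y(1,2) z(1,2) sh in linarith)
  finally have lam: "lam y - lam z \<le> L * h" .
  have "2 * ((1 - s) * \<Lambda> c + s * \<Lambda> (c + h) - \<Lambda> (c + s * h))
      = 2 * (s * (\<Lambda> (c + h) - \<Lambda> (c + s * h)) - (1 - s) * (\<Lambda> (c + s * h) - \<Lambda> c))"
    by (simp add: algebra_simps)
  also have "\<dots> = 2 * (s * (1 - s)) * h * (lam y - lam z)" unfolding y(3) z(3) by (simp add: algebra_simps)
  also have "\<dots> \<le> 2 * (s * (1 - s)) * h * (L * h)"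
    by (rule mult_left_mono[OF lam]) (use s c in simp)
  also have "\<dots> \<le> 1 * h * (L * h)"
  proof (intro mult_right_mono)
    have "0 \<le> (1 - 2 * s)\<^sup>2" by simp
    then show "2 * (s * (1 - s)) \<le> 1" by (simp add: power2_eq_square algebra_simps)
  qed (use c L in auto)
  finally show ?thesis by (simp add: power2_eq_square mult_ac)
qed

text \<open>The flux that belongs to Kruzkov's entropy \<open>\<bar>w - c\<bar>\<close>.\<close>

definition kruzkov_flux :: "(real \<Rightarrow> real) \<Rightarrow> real \<Rightarrow> real \<Rightarrow> real" where
  "kruzkov_flux \<Lambda> w c = sgn (w - c) * (\<Lambda> w - \<Lambda> c)"

text \<open>The production of a front of speed \<open>\<beta>\<close> that joins the values \<open>c\<close> and \<open>c + h\<close>, seen by a state \<open>w\<close>.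
  If \<open>w\<close> lies outside \<open>[c, c + h]\<close> the production is, up to sign,
  the defect of the speed from the chord slope of the flux, times \<open>h\<close>. If \<open>w\<close> lies inside, it is
  twice the chord error plus a multiple of the defects.
  The signed defects on the right are chosen so that they telescope along the fronts.\<close>

lemma kruzkov_jump:
  assumes \<Lambda>: "\<forall>v\<in>{0..1}. (\<Lambda> has_real_derivative lam v) (at v within {0..1})"
    and lip: "L-lipschitz_on {0..1} lam"
    and c: "0 \<le> c" "c + h \<le> 1" and h: "0 < h"
    and e: "e\<^sub>0 \<le> 0" "e\<^sub>1 \<le> 0"
    and \<beta>: "\<beta> * h = \<Lambda> (c + h) - \<Lambda> c + (e\<^sub>1 - e\<^sub>0) * h"
  shows "kruzkov_flux \<Lambda> w (c + h) - kruzkov_flux \<Lambda> w c - \<beta> * (\<bar>w - (c + h)\<bar> - \<bar>w - c\<bar>)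
    \<le> (if c + h < w then e\<^sub>1 else - e\<^sub>1) * h - (if c < w then e\<^sub>0 else - e\<^sub>0) * h + L * h\<^sup>2"
proof -
  have L: "L \<ge> 0" using lip by (rule lipschitz_on_nonneg)
  have Ln: "0 \<le> L * h\<^sup>2" using L by simp
  consider "c + h < w" | "w \<le> c" | "c < w" "w \<le> c + h" by linarith
  then show ?thesis
  proof cases
    case 1
    then have *: "c < w" "sgn (w - (c + h)) = 1" "sgn (w - c) = 1" "\<bar>w - (c + h)\<bar> = w - (c + h)" "\<bar>w - c\<bar> = w - c"
      using h by simp_all
    have "kruzkov_flux \<Lambda> w (c + h) - kruzkov_flux \<Lambda> w c - \<beta> * (\<bar>w - (c + h)\<bar> - \<bar>w - c\<bar>)
        = \<Lambda> c - \<Lambda> (c + h) + \<beta> * h" unfolding kruzkov_flux_def * by (simp add: algebra_simps)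
    also have "\<dots> = e\<^sub>1 * h - e\<^sub>0 * h" unfolding \<beta> by (simp add: algebra_simps)
    finally show ?thesis using Ln 1 *(1) by simp
  next
    case 2
    then have *: "w < c + h" "sgn (w - (c + h)) = -1" "\<bar>w - (c + h)\<bar> = (c + h) - w" "\<bar>w - c\<bar> = c - w"
      using h by simp_all
    have **: "kruzkov_flux \<Lambda> w c = \<Lambda> c - \<Lambda> w"
      using 2 by (cases "w = c") (simp_all add: kruzkov_flux_def)
    have "kruzkov_flux \<Lambda> w (c + h) - kruzkov_flux \<Lambda> w c - \<beta> * (\<bar>w - (c + h)\<bar> - \<bar>w - c\<bar>)
        = \<Lambda> (c + h) - \<Lambda> c - \<beta> * h" unfolding ** unfolding kruzkov_flux_def * by (simp add: algebra_simps)
    also have "\<dots> = - e\<^sub>1 * h - - e\<^sub>0 * h" unfolding \<beta> by (simp add: algebra_simps)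
    finally show ?thesis using Ln 2 *(1) by simp
  next
    case 3
    define s where "s = (w - c) / h"
    have s: "0 \<le> s" "s \<le> 1" using 3 h by (auto simp: s_def pos_divide_le_eq)
    have sh: "w = c + s * h" using h by (simp add: s_def)
    have err: "2 * ((1 - s) * \<Lambda> c + s * \<Lambda> (c + h) - \<Lambda> w) \<le> L * h\<^sup>2"
      using chord_above_flux[OF \<Lambda> lip c(1) _ c(2) s] h unfolding sh by simp
    have *: "kruzkov_flux \<Lambda> w (c + h) = \<Lambda> (c + h) - \<Lambda> w"
      using 3 by (cases "w = c + h") (simp_all add: kruzkov_flux_def)
    have **: "sgn (w - c) = 1" "\<bar>w - (c + h)\<bar> = (c + h) - w" "\<bar>w - c\<bar> = w - c" using 3 by simp_all
    have "kruzkov_flux \<Lambda> w (c + h) - kruzkov_flux \<Lambda> w c - \<beta> * (\<bar>w - (c + h)\<bar> - \<bar>w - c\<bar>)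
        = \<Lambda> (c + h) + \<Lambda> c - 2 * \<Lambda> w - (1 - 2 * s) * (\<beta> * h)"
    proof -
      have "\<beta> * ((c + h) - w - (w - c)) = (1 - 2 * s) * (\<beta> * h)" unfolding sh by (simp add: algebra_simps)
      then show ?thesis unfolding * unfolding kruzkov_flux_def ** by simp
    qed
    also have "\<dots> = 2 * ((1 - s) * \<Lambda> c + s * \<Lambda> (c + h) - \<Lambda> w) + (- e\<^sub>1 * h - e\<^sub>0 * h)
          + 2 * (s * e\<^sub>1 + (1 - s) * e\<^sub>0) * h"
      unfolding \<beta> by (simp add: algebra_simps)
    also have "\<dots> \<le> L * h\<^sup>2 + (- e\<^sub>1 * h - e\<^sub>0 * h) + 0"
    proof (intro add_mono err order_refl)
      have "s * e\<^sub>1 \<le> 0" "(1 - s) * e\<^sub>0 \<le> 0" using s e by (auto intro: mult_nonneg_nonpos)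
      then show "2 * (s * e\<^sub>1 + (1 - s) * e\<^sub>0) * h \<le> 0"
        using h by (intro mult_nonpos_nonneg[of "2 * _"]) auto
    qed
    finally show ?thesis using 3 by simp
  qed
qed

text \<open>The weights \<open>r\<close> are the values of a bump attached to each front. Summation by parts moves the
  differences from the signed defects to the weights, and each resulting term vanishes: where the
  defect is nonzero, the two fronts coincide and carry the same weight. What remains is one
  chord error per front. This is where conservation of mass and momentum at collisions is used.\<close>

lemma sticky_dissipation:
  assumes \<Lambda>: "\<forall>v\<in>{0..1}. (\<Lambda> has_real_derivative lam v) (at v within {0..1})"
    and lip: "L-lipschitz_on {0..1} lam"
    and e: "e 0 = 0" "e n = 0" "\<And>k. k \<le> n \<Longrightarrow> e k \<le> 0"
    and \<beta>: "\<And>k. k \<in> {1..n} \<Longrightarrow>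
      \<beta> k = real n * (\<Lambda> (real k / real n) - \<Lambda> (real (k - 1) / real n)) + e k - e (k - 1)"
    and r: "\<And>k. r k \<ge> 0" "r 0 = 0" "r (Suc n) = 0"
      "\<And>k. 1 \<le> k \<Longrightarrow> k < n \<Longrightarrow> e k \<noteq> 0 \<Longrightarrow> r k = r (Suc k)"
  shows "(\<Sum>k=1..n. r k * (kruzkov_flux \<Lambda> w (real k / real n) - kruzkov_flux \<Lambda> w (real (k - 1) / real n)
      - \<beta> k * (\<bar>w - real k / real n\<bar> - \<bar>w - real (k - 1) / real n\<bar>)))
    \<le> L / (real n)\<^sup>2 * (\<Sum>k=1..n. r k)"
proof -
  \<comment> \<open>The sign changes at the state \<open>w\<close>, where the entropy changes from decreasing to increasing in the front index.\<close>
  define a where "a k = (if real k / real n < w then e k else - e k) / real n" for k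
  have "(\<Sum>k=1..n. r k * (kruzkov_flux \<Lambda> w (real k / real n) - kruzkov_flux \<Lambda> w (real (k - 1) / real n)
      - \<beta> k * (\<bar>w - real k / real n\<bar> - \<bar>w - real (k - 1) / real n\<bar>)))
    \<le> (\<Sum>k=1..n. r k * (a k - a (k - 1) + L / (real n)\<^sup>2))"
  proof (intro sum_mono mult_left_mono r(1))
    fix k assume k: "k \<in> {1..n}"
    let ?h = "1 / real n" and ?c = "real (k - 1) / real n"
    have n: "real n > 0" using k by auto
    have ck: "real k / real n = ?c + ?h"
      using k by (simp add: add_divide_distrib[symmetric] of_nat_diff)
    have \<beta>k: "\<beta> k * ?h = \<Lambda> (?c + ?h) - \<Lambda> ?c + (e k - e (k - 1)) * ?h"
    proof -
      have "(real n * X + a - b) * ?h = X + (a - b) * ?h" for X a b using n by (simp add: field_simps)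
      then show ?thesis unfolding \<beta>[OF k] unfolding ck .
    qed
    have le1: "?c + ?h \<le> 1" unfolding ck[symmetric] using k n by simp
    have "k \<le> n" "k - 1 \<le> n" using k by auto
    note kruzkov_jump[OF \<Lambda> lip _ le1 _ e(3)[OF this(2)] e(3)[OF this(1)] \<beta>k, of w]
    then show "kruzkov_flux \<Lambda> w (real k / real n) - kruzkov_flux \<Lambda> w (real (k - 1) / real n)
      - \<beta> k * (\<bar>w - real k / real n\<bar> - \<bar>w - real (k - 1) / real n\<bar>)
      \<le> a k - a (k - 1) + L / (real n)\<^sup>2"
      using n unfolding a_def ck by (simp add: power_divide)
  qed
  also have "\<dots> = (\<Sum>k=1..n. r k * (a k - a (k - 1))) + L / (real n)\<^sup>2 * (\<Sum>k=1..n. r k)"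
    unfolding sum_distrib_left by (simp only: distrib_left sum.distrib mult.commute)
  also have "(\<Sum>k=1..n. r k * (a k - a (k - 1))) = (\<Sum>k\<le>n. a k * (r k - r (Suc k)))"
    unfolding abel_summation by (simp add: r)
  also have "\<dots> = 0"
  proof (rule sum.neutral, rule ballI)
    fix k assume "k \<in> {..n}"
    show "a k * (r k - r (Suc k)) = 0"
    proof (cases "e k = 0")
      case False
      then have "k \<noteq> 0" "k \<noteq> n" using e by metis+
      then have "1 \<le> k" "k < n" using \<open>k \<in> {..n}\<close> by auto
      then show ?thesis using r(4) False by simp
    qed (simp add: a_def)
  qed
  finally show ?thesis by simp
qed

lemma initial_velocity_eq:
  assumes \<Lambda>: "\<forall>v\<in>{0..1}. (\<Lambda> has_real_derivative lam v) (at v within {0..1})" and k: "k \<in> {1..n}"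
  shows "initial_velocity lam n k = real n * (\<Lambda> (real k / real n) - \<Lambda> (real (k - 1) / real n))"
proof -
  have n: "real n > 0" using k by auto
  have k1: "real k - 1 = real (k - 1)" using k by (simp add: of_nat_diff)
  have sub: "{real (k - 1) / real n..real k / real n} \<subseteq> {0..1}"
    using k n by (simp add: atLeastatMost_subset_iff)
  have "(lam has_integral \<Lambda> (real k / real n) - \<Lambda> (real (k - 1) / real n)) {real (k - 1) / real n..real k / real n}"
  proof (rule fundamental_theorem_of_calculus)
    show "real (k - 1) / real n \<le> real k / real n" using n by (simp add: divide_right_mono)
    fix v assume v: "v \<in> {real (k - 1) / real n..real k / real n}"
    then have "(\<Lambda> has_real_derivative lam v) (at v within {real (k - 1) / real n..real k / real n})"
    proof (intro has_field_derivative_subset[OF _ sub])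
      show "(\<Lambda> has_real_derivative lam v) (at v within {0..1})" using \<Lambda> sub v by blast
    qed
    then show "(\<Lambda> has_vector_derivative lam v) (at v within {real (k - 1) / real n..real k / real n})"
      by (simp only: has_real_derivative_iff_has_vector_derivative)
  qed
  then show ?thesis unfolding initial_velocity_def k1 by (simp add: integral_unique)
qed

section \<open>Test functions\<close>

lemma smooth_partial_derivatives:
  fixes \<phi> :: "real \<times> real \<Rightarrow> real"
  assumes "smooth \<phi>"
  obtains \<phi>' where "\<And>p. (\<phi> has_derivative \<phi>' p) (at p)"
    "\<And>t x. dt \<phi> t x = \<phi>' (t, x) (1, 0)" "\<And>t x. dx \<phi> t x = \<phi>' (t, x) (0, 1)"
    "\<And>h. continuous_on UNIV (\<lambda>p. \<phi>' p h)"
proof -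
  from assms obtain \<phi>' where \<phi>': "\<And>p. (\<phi> has_derivative \<phi>' p) (at p)" "\<And>h. smooth (\<lambda>p. \<phi>' p h)"
    by cases blast
  have lin: "\<phi>' p (c *\<^sub>R h) = c * \<phi>' p h" for p c h
    using linear_scale[OF has_derivative_linear[OF \<phi>'(1)[of p]], of c h] by simp
  have "dt \<phi> t x = \<phi>' (t, x) (1, 0)" for t x
  proof -
    have "((\<lambda>s. \<phi> (s, x)) has_derivative (\<lambda>h. \<phi>' (t, x) (h, 0))) (at t)"
      by (rule has_derivative_compose[of "\<lambda>s. (s, x)", OF _ \<phi>'(1)]) (auto intro!: derivative_eq_intros)
    moreover have eq: "(\<lambda>h. \<phi>' (t, x) (h, 0)) = (*) (\<phi>' (t, x) (1, 0))"
    proof (rule ext)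
      show "\<phi>' (t, x) (h, 0) = \<phi>' (t, x) (1, 0) * h" for h
        using lin[of "(t, x)" h "(1, 0)"] by (simp add: mult.commute)
    qed
    ultimately have "((\<lambda>s. \<phi> (s, x)) has_real_derivative \<phi>' (t, x) (1, 0)) (at t)"
      unfolding has_field_derivative_def eq by blast
    then show ?thesis unfolding dt_def by (rule DERIV_imp_deriv)
  qed
  moreover have "dx \<phi> t x = \<phi>' (t, x) (0, 1)" for t x
  proof -
    have "((\<lambda>y. \<phi> (t, y)) has_derivative (\<lambda>h. \<phi>' (t, x) (0, h))) (at x)"
      by (rule has_derivative_compose[of "\<lambda>y. (t, y)", OF _ \<phi>'(1)]) (auto intro!: derivative_eq_intros)
    moreover have eq: "(\<lambda>h. \<phi>' (t, x) (0, h)) = (*) (\<phi>' (t, x) (0, 1))"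
    proof (rule ext)
      show "\<phi>' (t, x) (0, h) = \<phi>' (t, x) (0, 1) * h" for h
        using lin[of "(t, x)" h "(0, 1)"] by (simp add: mult.commute)
    qed
    ultimately have "((\<lambda>y. \<phi> (t, y)) has_real_derivative \<phi>' (t, x) (0, 1)) (at x)"
      unfolding has_field_derivative_def eq by blast
    then show ?thesis unfolding dx_def by (rule DERIV_imp_deriv)
  qed
  ultimately show ?thesis using that[of \<phi>'] \<phi>' smooth_imp_continuous by blast
qed

lemma bounded_compact_support_integrable:
  fixes f g :: "'a::euclidean_space \<Rightarrow> real"
  assumes K: "compact K" and f: "f \<in> borel_measurable borel" "\<And>p. \<bar>f p\<bar> \<le> B"
    and g: "continuous_on UNIV g" "\<And>p. p \<notin> K \<Longrightarrow> g p = 0"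
  shows "integrable lborel (\<lambda>p. f p * g p)"
proof -
  have "bounded (g ` K)"
    using K g(1) by (intro compact_imp_bounded compact_continuous_image) (auto intro: continuous_on_subset)
  then obtain C where C: "\<And>p. p \<in> K \<Longrightarrow> \<bar>g p\<bar> \<le> C" by (auto simp: bounded_iff)
  show ?thesis
  proof (rule integrableI_bounded_set[where A=K and B="B * C"])
    show "K \<in> sets lborel" using K by (simp add: borel_compact)
    show "(\<lambda>p. f p * g p) \<in> borel_measurable lborel"
      using f(1) borel_measurable_continuous_onI[OF g(1)] by simp
    show "emeasure lborel K < \<infinity>" using K by (rule emeasure_compact_finite)
    show "AE p in lborel. p \<in> K \<longrightarrow> norm (f p * g p) \<le> B * C"
    proof (intro AE_I2 impI)
      fix p assume "p \<in> K"
      have "0 \<le> B" using f(2)[of p] by linarith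
      then show "norm (f p * g p) \<le> B * C"
        unfolding real_norm_def abs_mult using f(2)[of p] C[OF \<open>p \<in> K\<close>] by (intro mult_mono) auto
    qed
    show "AE p in lborel. p \<notin> K \<longrightarrow> f p * g p = 0" using g(2) by simp
  qed
qed

lemma test_function_derivatives:
  assumes "test_function \<phi>"
  shows "continuous_on UNIV (\<lambda>p. dt \<phi> (fst p) (snd p))" "continuous_on UNIV (\<lambda>p. dx \<phi> (fst p) (snd p))"
    and "p \<notin> closure {p. \<phi> p \<noteq> 0} \<Longrightarrow> dt \<phi> (fst p) (snd p) = 0"
    and "p \<notin> closure {p. \<phi> p \<noteq> 0} \<Longrightarrow> dx \<phi> (fst p) (snd p) = 0"
proof -
  obtain \<phi>' where \<phi>': "\<And>p. (\<phi> has_derivative \<phi>' p) (at p)"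
    "\<And>t x. dt \<phi> t x = \<phi>' (t, x) (1, 0)" "\<And>t x. dx \<phi> t x = \<phi>' (t, x) (0, 1)"
    "\<And>h. continuous_on UNIV (\<lambda>p. \<phi>' p h)"
    using assms smooth_partial_derivatives unfolding test_function_def by blast
  show "continuous_on UNIV (\<lambda>p. dt \<phi> (fst p) (snd p))" "continuous_on UNIV (\<lambda>p. dx \<phi> (fst p) (snd p))"
    using \<phi>'(4) by (simp_all add: \<phi>'(2,3))
  let ?K = "closure {p. \<phi> p \<noteq> 0}"
  have "\<phi>' p = (\<lambda>_. 0)" if "p \<notin> ?K" for p
  proof (rule has_derivative_unique[OF \<phi>'(1)])
    have out: "\<phi> q = 0" if "q \<in> - ?K" for q using that closure_subset[of "{p. \<phi> p \<noteq> 0}"] by auto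
    show "(\<phi> has_derivative (\<lambda>_. 0)) (at p)"
    proof (rule has_derivative_transform_within_open)
      show "((\<lambda>_. 0) has_derivative (\<lambda>_. 0)) (at p)" by (rule has_derivative_const)
      show "open (- ?K)" by (intro open_Compl closed_closure)
      show "p \<in> - ?K" using \<open>p \<notin> ?K\<close> by blast
      show "0 = \<phi> q" if "q \<in> - ?K" for q using out[OF that] by (rule sym)
    qed
  qed
  then show "p \<notin> ?K \<Longrightarrow> dt \<phi> (fst p) (snd p) = 0" "p \<notin> ?K \<Longrightarrow> dx \<phi> (fst p) (snd p) = 0"
    by (simp_all add: \<phi>'(2,3))
qed

lemma smooth_alg_step:
  assumes "\<And>p. f p = a * fst p + b * snd p + c"
  shows "smooth_alg (\<lambda>p::real\<times>real. step (f p))"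
proof -
  have "bounded_linear (\<lambda>p::real\<times>real. a * fst p + b * snd p)"
    by (intro bounded_linear_add bounded_linear_compose[OF bounded_linear_mult_right]
        bounded_linear_fst bounded_linear_snd)
  from smooth_alg.comp[OF smooth_step this, of c] show ?thesis unfolding assms .
qed

lemma smooth_alg_diff: "smooth_alg f \<Longrightarrow> smooth_alg g \<Longrightarrow> smooth_alg (\<lambda>x. f x - g x)"
  using smooth_alg.add[OF _ smooth_alg.mult[OF smooth_alg.const[of "-1"]], of f g] by simp

section \<open>Time cut-offs\<close>

text \<open>An approximate Dirac mass just to the right of \<open>p\<close>, and the derivative of the scaled smooth step.\<close>

definition mollifier :: "real \<Rightarrow> real \<Rightarrow> real \<Rightarrow> real" where
  "mollifier d p t = step' ((t - p) / d) / d"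

text \<open>A smooth indicator of the time interval from \<open>p\<close> to \<open>q\<close>. Its derivative is a difference of two
  one-sided approximate Dirac masses, so that testing with it compares the times \<open>p\<close> and \<open>q\<close>.\<close>

definition plateau :: "real \<Rightarrow> real \<Rightarrow> real \<Rightarrow> real \<Rightarrow> real" where
  "plateau d p q t = step ((t - p) / d) - step ((t - q) / d)"

lemma continuous_mollifier: "continuous_on S (mollifier d p)"
  unfolding mollifier_def[abs_def] divide_inverse
  by (intro continuous_intros continuous_on_compose2[OF continuous_step'[of UNIV]]) auto

lemma mollifier_nonneg: "d > 0 \<Longrightarrow> mollifier d p t \<ge> 0"
  by (simp add: mollifier_def step'_nonneg)

lemma mollifier_outside: "d > 0 \<Longrightarrow> t \<notin> {p..p+d} \<Longrightarrow> mollifier d p t = 0"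
  by (auto simp: mollifier_def not_le field_simps intro!: step'_outside)

lemma mollifier_integral:
  assumes "d > 0"
  shows "integrable lborel (mollifier d p)" "(LBINT t. mollifier d p t) = 1"
proof -
  have "integrable lborel (\<lambda>t. 1 * mollifier d p t)"
    by (rule bounded_compact_support_integrable[where K="{p..p+d}" and B=1])
      (auto simp: continuous_mollifier mollifier_outside assms)
  then show "integrable lborel (mollifier d p)" by simp
  have "(LBINT x. step' x * indicator {0..1} x) = step 1 - step 0"
    by (rule integral_FTC_Icc_real)
      (auto intro: step_derivative continuous_on_interior[OF continuous_step'[of UNIV]])
  moreover have "step' x * indicator {0..1} x = step' x" for x
    by (cases "x \<in> {0..1}") (auto simp: not_le intro!: step'_outside)
  ultimately have 1: "(LBINT x. step' x) = 1" by (simp add: step_le_0 step_ge_1)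
  have "(LBINT x. step' x) = \<bar>1/d\<bar> *\<^sub>R (LBINT x. step' (- p / d + 1/d * x))"
    using assms by (intro lborel_integral_real_affine) auto
  also have "\<dots> = (LBINT t. (1/d) * step' (- p / d + 1/d * t))"
    using assms by simp
  also have "(\<lambda>t. (1/d) * step' (- p / d + 1/d * t)) = mollifier d p"
    by (auto simp: mollifier_def fun_eq_iff diff_divide_distrib)
  finally show "(LBINT t. mollifier d p t) = 1" using 1 by simp
qed

lemma plateau_derivative:
  "(plateau d p q has_real_derivative mollifier d p t - mollifier d q t) (at t)"
  unfolding plateau_def[abs_def] mollifier_def divide_inverse
  by (auto intro!: derivative_eq_intros)

lemma plateau_range:
  assumes "d > 0" "p \<le> q"
  shows "0 \<le> plateau d p q t" "plateau d p q t \<le> 1"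
proof -
  have "step ((t - q) / d) \<le> step ((t - p) / d)"
    using assms by (intro monoD[OF mono_step] divide_right_mono) auto
  then show "0 \<le> plateau d p q t" by (simp add: plateau_def)
  show "plateau d p q t \<le> 1"
    using step_range(2)[of "(t - p) / d"] step_range(1)[of "(t - q) / d"] by (simp add: plateau_def)
qed

lemma plateau_outside:
  assumes "d > 0" "p \<le> q" "t \<le> p \<or> q + d \<le> t"
  shows "plateau d p q t = 0"
proof -
  consider "t \<le> p" | "q + d \<le> t" using assms by blast
  then show ?thesis
  proof cases
    case 1
    then have "(t - p) / d \<le> 0" "(t - q) / d \<le> 0" using assms by (auto simp: divide_le_0_iff)
    then show ?thesis by (simp add: plateau_def step_le_0)
  next
    case 2
    then have "1 \<le> (t - p) / d" "1 \<le> (t - q) / d" using assms by (auto simp: pos_le_divide_eq)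
    then show ?thesis by (simp add: plateau_def step_ge_1)
  qed
qed

lemma continuous_plateau: "continuous_on S (plateau d p q)"
  by (rule continuous_at_imp_continuous_on) (use DERIV_isCont[OF plateau_derivative] in blast)

lemma mollified_average:
  assumes d: "d > 0" and p: "p \<ge> 0" and E: "continuous_on {0..} E"
    and near: "\<And>t. t \<in> {p..p+d} \<Longrightarrow> \<bar>E t - E p\<bar> \<le> \<eta>"
  shows "integrable lborel (\<lambda>t. indicator {0..} t * (mollifier d p t * E t))"
    and "\<bar>(LBINT t. indicator {0..} t * (mollifier d p t * E t)) - E p\<bar> \<le> \<eta>"
proof -
  let ?f = "\<lambda>t. indicator {0..} t * (mollifier d p t * E t)"
  let ?g = "\<lambda>t. mollifier d p t * E p"
  have Em: "(\<lambda>t. indicator {0..} t *\<^sub>R E t) \<in> borel_measurable borel"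
    using E by (intro borel_measurable_continuous_on_indicator) auto
  have mm: "mollifier d p \<in> borel_measurable borel"
    by (rule borel_measurable_continuous_onI[OF continuous_mollifier])
  have fm: "?f \<in> borel_measurable borel"
    using borel_measurable_times[OF mm Em] by (simp add: mult.left_commute)
  have gi: "integrable lborel ?g" using mollifier_integral(1)[OF d] by simp
  have bd: "\<bar>?f t - ?g t\<bar> \<le> mollifier d p t * \<eta>" for t
  proof (cases "t \<in> {p..p+d}")
    case True
    then have "?f t - ?g t = mollifier d p t * (E t - E p)" using p by (simp add: right_diff_distrib)
    then show ?thesis
      using near[OF True] mollifier_nonneg[OF d, of p t] by (simp add: abs_mult mult_left_mono)
  next
    case False
    then show ?thesis using mollifier_outside[OF d False] by simp
  qed
  have "integrable lborel (\<lambda>t. ?f t - ?g t)"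
    by (rule Bochner_Integration.integrable_bound[where f="\<lambda>t. mollifier d p t * \<eta>"])
      (use bd fm borel_measurable_integrable[OF gi] mollifier_integral(1)[OF d] in
        \<open>auto intro: order_trans[OF _ abs_ge_self]\<close>)
  from Bochner_Integration.integrable_add[OF this gi] show fi: "integrable lborel ?f" by simp
  have "\<bar>(LBINT t. ?f t - ?g t)\<bar> \<le> (LBINT t. mollifier d p t * \<eta>)"
    using mollifier_integral(1)[OF d] bd \<open>integrable lborel (\<lambda>t. ?f t - ?g t)\<close>
    by (intro order_trans[OF integral_abs_bound] integral_mono) auto
  also have "\<dots> = \<eta>" using mollifier_integral[OF d] by simp
  also have "(LBINT t. ?f t - ?g t) = (LBINT t. ?f t) - E p"
    using mollifier_integral[OF d] fi gi by simp
  finally show "\<bar>(LBINT t. ?f t) - E p\<bar> \<le> \<eta>" .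
qed

section \<open>The regularised distance to a moving step function\<close>

text \<open>A smooth indicator of a backward light cone with base \<open>[-R, R]\<close> at time \<open>T\<close>. The cone shrinks at the
  maximal speed \<open>M\<close>, so no mass can enter it through its sides.\<close>

definition cutoff :: "real \<Rightarrow> real \<Rightarrow> real \<Rightarrow> real \<Rightarrow> real \<Rightarrow> real" where
  "cutoff M R T t x = step (R + 1 + M * (T - t) - x) * step (R + 1 + M * (T - t) + x)"

text \<open>A smoothed version of the indicator of \<open>{X k t..}\<close>. The conventions for \<open>k = 0\<close> and \<open>k > n\<close> are those of
  particles at \<open>-\<infinity>\<close> and \<open>+\<infinity>\<close>; they let the sums over the constant states run over all of \<open>{..n}\<close>.\<close>

definition front :: "real \<Rightarrow> nat \<Rightarrow> (nat \<Rightarrow> real \<Rightarrow> real) \<Rightarrow> nat \<Rightarrow> real \<Rightarrow> real \<Rightarrow> real" where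
  "front \<epsilon> n X k t x = (if k = 0 then 1 else if k \<le> n then step ((x - X k t) / \<epsilon>) else 0)"

text \<open>The regularised indicator of the region where the step function equals \<open>k / n\<close>. These form a partition
  of unity when the fronts are ordered.\<close>

definition layer :: "real \<Rightarrow> nat \<Rightarrow> (nat \<Rightarrow> real \<Rightarrow> real) \<Rightarrow> nat \<Rightarrow> real \<Rightarrow> real \<Rightarrow> real" where
  "layer \<epsilon> n X k t x = front \<epsilon> n X k t x - front \<epsilon> n X (Suc k) t x"

text \<open>A regularisation of \<open>\<bar>w - v\<bar>\<close>, where \<open>v\<close> is the step function with jumps \<open>1/n\<close> at the points \<open>X k t\<close>. Each
  state \<open>k / n\<close> occurs in its own Kruzkov entropy, multiplied by its regularised indicator.\<close>

definition discrepancy :: "real \<Rightarrow> nat \<Rightarrow> (nat \<Rightarrow> real \<Rightarrow> real) \<Rightarrow> real \<Rightarrow> real \<Rightarrow> real \<Rightarrow> real" where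
  "discrepancy \<epsilon> n X w t x = (\<Sum>k\<le>n. \<bar>w - real k / real n\<bar> * layer \<epsilon> n X k t x)"

definition energy :: "real \<Rightarrow> nat \<Rightarrow> (nat \<Rightarrow> real \<Rightarrow> real) \<Rightarrow> (real \<Rightarrow> real \<Rightarrow> real) \<Rightarrow> (real \<Rightarrow> real) \<Rightarrow> real \<Rightarrow> real" where
  "energy \<epsilon> n X w v t = (LBINT x. w t x * discrepancy \<epsilon> n X (v x) t x)"

lemma front_range: "0 \<le> front \<epsilon> n X k t x" "front \<epsilon> n X k t x \<le> 1"
  by (simp_all add: front_def step_range)

lemma layer_abs_le: "\<bar>layer \<epsilon> n X k t x\<bar> \<le> 1"
  using front_range[of \<epsilon> n X k t x] front_range[of \<epsilon> n X "Suc k" t x] by (simp add: layer_def abs_le_iff)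

lemma layer_nonneg:
  assumes "\<epsilon> > 0" "\<And>k. 1 \<le> k \<Longrightarrow> k < n \<Longrightarrow> X k t \<le> X (Suc k) t"
  shows "0 \<le> layer \<epsilon> n X k t x"
proof (cases "1 \<le> k \<and> k < n")
  case True
  then have "step ((x - X (Suc k) t) / \<epsilon>) \<le> step ((x - X k t) / \<epsilon>)"
    using assms by (intro monoD[OF mono_step] divide_right_mono) auto
  then show ?thesis using True by (simp add: layer_def front_def)
next
  case False
  then have "k = 0 \<or> Suc k > n" by linarith
  then show ?thesis using step_range by (auto simp: layer_def front_def)
qed

lemma cutoff_range: "0 \<le> cutoff M R T t x" "cutoff M R T t x \<le> 1"
  by (simp_all add: cutoff_def step_range mult_le_one)

lemma cutoff_outside:
  assumes "x \<notin> {-(R + 1 + M * (T - t))..R + 1 + M * (T - t)}"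
  shows "cutoff M R T t x = 0"
proof -
  have "R + 1 + M * (T - t) - x \<le> 0 \<or> R + 1 + M * (T - t) + x \<le> 0" using assms by auto
  then show ?thesis by (auto simp: cutoff_def step_le_0)
qed

lemma continuous_step_compose: "continuous_on S f \<Longrightarrow> continuous_on S (\<lambda>x. step (f x))"
  by (rule continuous_on_compose2[OF continuous_step[of UNIV]]) auto

lemma continuous_step'_compose: "continuous_on S f \<Longrightarrow> continuous_on S (\<lambda>x. step' (f x))"
  by (rule continuous_on_compose2[OF continuous_step'[of UNIV]]) auto

lemma continuous_cutoff [continuous_intros]:
  "continuous_on S f \<Longrightarrow> continuous_on S g \<Longrightarrow> continuous_on S (\<lambda>z. cutoff M R T (f z) (g z))"
  unfolding cutoff_def by (intro continuous_intros continuous_step_compose)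

lemma continuous_layer:
  assumes "\<epsilon> > 0" "\<And>k. k \<in> {1..n} \<Longrightarrow> continuous_on S (\<lambda>z. X k (f z))" "continuous_on S g"
  shows "continuous_on S (\<lambda>z. layer \<epsilon> n X k (f z) (g z))"
proof -
  have "continuous_on S (\<lambda>z. front \<epsilon> n X k (f z) (g z))" for k
  proof (cases "k \<in> {1..n}")
    case True
    then have "continuous_on S (\<lambda>z. step ((g z - X k (f z)) / \<epsilon>))"
      using assms by (intro continuous_step_compose continuous_intros) auto
    then show ?thesis using True by (simp add: front_def)
  next
    case False
    then have "(\<lambda>z. front \<epsilon> n X k (f z) (g z)) = (\<lambda>z. if k = 0 then 1 else 0)"
      by (auto simp: front_def fun_eq_iff)
    then show ?thesis by (simp only: continuous_on_const)
  qed
  then show ?thesis unfolding layer_def by (intro continuous_on_diff)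
qed

lemma continuous_discrepancy:
  assumes "\<epsilon> > 0" "\<And>k. k \<in> {1..n} \<Longrightarrow> continuous_on S (\<lambda>z. X k (f z))" "continuous_on S g"
  shows "continuous_on S (\<lambda>z. discrepancy \<epsilon> n X w (f z) (g z))"
  unfolding discrepancy_def by (intro continuous_intros continuous_layer assms)

lemma abs_diff_grid_le: "w \<in> {0..1::real} \<Longrightarrow> k \<le> n \<Longrightarrow> \<bar>w - real k / real n\<bar> \<le> 1"
proof -
  assume w: "w \<in> {0..1}" and k: "k \<le> n"
  have "0 \<le> real k / real n" "real k / real n \<le> 1" using k by (auto simp: divide_le_eq_1)
  then show ?thesis using w unfolding abs_le_iff atLeastAtMost_iff by linarith
qed

lemma discrepancy_lipschitz:
  "\<bar>discrepancy \<epsilon> n X w t x - discrepancy \<epsilon> n X v t x\<bar> \<le> real (Suc n) * \<bar>w - v\<bar>"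
proof -
  have "\<bar>discrepancy \<epsilon> n X w t x - discrepancy \<epsilon> n X v t x\<bar>
      = \<bar>\<Sum>k\<le>n. (\<bar>w - real k / real n\<bar> - \<bar>v - real k / real n\<bar>) * layer \<epsilon> n X k t x\<bar>"
    by (simp add: discrepancy_def sum_subtractf left_diff_distrib)
  also have "\<dots> \<le> (\<Sum>k\<le>n. \<bar>(\<bar>w - real k / real n\<bar> - \<bar>v - real k / real n\<bar>) * layer \<epsilon> n X k t x\<bar>)"
    by (rule sum_abs)
  also have "\<dots> \<le> (\<Sum>k\<le>n. \<bar>w - v\<bar> * 1)"
    unfolding abs_mult by (intro sum_mono mult_mono layer_abs_le) auto
  finally show ?thesis by simp
qed

lemma discrepancy_abs_le:
  assumes "w \<in> {0..1}" shows "\<bar>discrepancy \<epsilon> n X w t x\<bar> \<le> real (Suc n)"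
proof -
  have "\<bar>discrepancy \<epsilon> n X w t x\<bar> \<le> (\<Sum>k\<le>n. \<bar>\<bar>w - real k / real n\<bar> * layer \<epsilon> n X k t x\<bar>)"
    unfolding discrepancy_def by (rule sum_abs)
  also have "\<dots> \<le> (\<Sum>k\<le>n. 1 * 1)"
    unfolding abs_mult using assms abs_diff_grid_le by (intro sum_mono mult_mono layer_abs_le) auto
  finally show ?thesis by simp
qed

lemma discrepancy_measurable:
  assumes "\<epsilon> > 0" "v \<in> borel_measurable borel"
  shows "(\<lambda>x. discrepancy \<epsilon> n X (v x) t x) \<in> borel_measurable borel"
proof -
  have "(\<lambda>x. layer \<epsilon> n X k t x) \<in> borel_measurable borel" for k
    by (intro borel_measurable_continuous_onI continuous_layer assms(1)) (auto intro: continuous_intros)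
  then show ?thesis unfolding discrepancy_def using assms(2) by measurable
qed

lemma energy_integrable:
  assumes "\<epsilon> > 0" "v \<in> borel_measurable borel" "\<And>x. v x \<in> {0..1}"
  shows "integrable lborel (\<lambda>x. cutoff M R T t x * discrepancy \<epsilon> n X (v x) t x)"
proof -
  have "integrable lborel (\<lambda>x. discrepancy \<epsilon> n X (v x) t x * cutoff M R T t x)"
    by (rule bounded_compact_support_integrable[where B="real (Suc n)"
          and K="{-(R + 1 + M * (T - t))..R + 1 + M * (T - t)}"])
      (use assms discrepancy_abs_le in \<open>auto intro: discrepancy_measurable cutoff_outside continuous_intros
        simp del: of_nat_Suc\<close>)
  then show ?thesis by (simp add: mult.commute)
qed

lemma tendsto_0_of_ennreal_bound:
  fixes a :: "'b \<Rightarrow> real"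
  assumes "\<And>i. ennreal \<bar>a i\<bar> \<le> ennreal c * N i" "(N \<longlongrightarrow> 0) F"
  shows "(a \<longlongrightarrow> 0) F"
proof -
  have lim: "((\<lambda>i. ennreal c * N i) \<longlongrightarrow> 0) F"
    using ennreal_tendsto_cmult[of "ennreal c", OF _ assms(2)] by simp
  have "((\<lambda>i. ennreal \<bar>a i\<bar>) \<longlongrightarrow> 0) F"
  proof (rule tendsto_sandwich[OF _ _ tendsto_const lim])
    show "\<forall>\<^sub>F i in F. 0 \<le> ennreal \<bar>a i\<bar>" by simp
    show "\<forall>\<^sub>F i in F. ennreal \<bar>a i\<bar> \<le> ennreal c * N i" using assms(1) by simp
  qed
  then have "((\<lambda>i. ennreal \<bar>a i\<bar>) \<longlongrightarrow> ennreal 0) F" by simp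
  then have "((\<lambda>i. \<bar>a i\<bar>) \<longlongrightarrow> 0) F" by (rule tendsto_ennrealD) auto
  then show ?thesis by (rule tendsto_rabs_zero_cancel)
qed

text \<open>Two causes of change are separated: the solution varies continuously in local \<open>L\<^sup>1\<close>, and for a
  frozen state the fronts move continuously, where dominated convergence applies.\<close>

lemma energy_continuous:
  assumes eps: "\<epsilon> > 0" and M: "M \<ge> 0" and X: "\<And>k. k \<in> {1..n} \<Longrightarrow> continuous_on UNIV (X k)"
    and loc: "L1_loc_continuous u" and meas: "\<And>t. t \<ge> 0 \<Longrightarrow> u t \<in> borel_measurable borel"
    and u01: "\<And>t x. t \<ge> 0 \<Longrightarrow> u t x \<in> {0..1}"
  shows "continuous_on {0..} (\<lambda>t. energy \<epsilon> n X (cutoff M R T) (u t) t)"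
proof (unfold continuous_on_sequentially, intro allI ballI impI)
  fix \<tau> :: "nat \<Rightarrow> real" and s assume s: "s \<in> {0..}" and "(\<forall>i. \<tau> i \<in> {0..}) \<and> \<tau> \<longlonglongrightarrow> s"
  then have \<tau>: "\<And>i. \<tau> i \<ge> 0" "\<tau> \<longlonglongrightarrow> s" "s \<ge> 0" by auto
  let ?\<Phi> = "\<lambda>v t x. cutoff M R T t x * discrepancy \<epsilon> n X (v x) t x"
  define b where "b = R + 1 + M * T"
  let ?K = "{-b..b}"
  have cutoff0: "cutoff M R T t x = 0" if "t \<ge> 0" "x \<notin> ?K" for t x
  proof (rule cutoff_outside)
    have "M * (T - t) \<le> M * T" using M that by (intro mult_left_mono) auto
    then show "x \<notin> {-(R + 1 + M * (T - t))..R + 1 + M * (T - t)}" using that by (auto simp: b_def)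
  qed
  have cutoff_le: "\<bar>cutoff M R T t x\<bar> \<le> indicator ?K x" if "t \<ge> 0" for t x
    using cutoff_range[of M R T t x] cutoff0[OF that, of x] by (cases "x \<in> ?K") auto
  have int: "integrable lborel (?\<Phi> (u t) r)" if "t \<ge> 0" for t r
    by (rule energy_integrable[OF eps meas u01]) (use that in auto)
  have "(\<lambda>i. (LBINT x. ?\<Phi> (u (\<tau> i)) (\<tau> i) x) - (LBINT x. ?\<Phi> (u s) (\<tau> i) x)) \<longlonglongrightarrow> 0"
  proof (rule tendsto_0_of_ennreal_bound[where c="real (Suc n)"])
    let ?N = "\<lambda>t. \<integral>\<^sup>+x\<in>?K. ennreal \<bar>u t x - u s x\<bar> \<partial>lborel"
    show "ennreal \<bar>(LBINT x. ?\<Phi> (u (\<tau> i)) (\<tau> i) x) - (LBINT x. ?\<Phi> (u s) (\<tau> i) x)\<bar> \<le> ennreal (real (Suc n)) * ?N (\<tau> i)" for i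
    proof -
      have ms: "(\<lambda>x. ennreal \<bar>u (\<tau> i) x - u s x\<bar> * indicator ?K x) \<in> borel_measurable lborel"
        using meas[OF \<tau>(1)[of i]] meas[OF \<tau>(3)] by simp
      have "(LBINT x. ?\<Phi> (u (\<tau> i)) (\<tau> i) x) - (LBINT x. ?\<Phi> (u s) (\<tau> i) x)
          = (LBINT x. ?\<Phi> (u (\<tau> i)) (\<tau> i) x - ?\<Phi> (u s) (\<tau> i) x)"
        using int \<tau> by simp
      then have "ennreal \<bar>(LBINT x. ?\<Phi> (u (\<tau> i)) (\<tau> i) x) - (LBINT x. ?\<Phi> (u s) (\<tau> i) x)\<bar>
          \<le> (\<integral>\<^sup>+x. norm (?\<Phi> (u (\<tau> i)) (\<tau> i) x - ?\<Phi> (u s) (\<tau> i) x) \<partial>lborel)"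
        using integral_norm_bound_ennreal[of lborel "\<lambda>x. ?\<Phi> (u (\<tau> i)) (\<tau> i) x - ?\<Phi> (u s) (\<tau> i) x"] int \<tau>
        by simp
      also have "\<dots> \<le> (\<integral>\<^sup>+x. ennreal (real (Suc n)) * (ennreal \<bar>u (\<tau> i) x - u s x\<bar> * indicator ?K x) \<partial>lborel)"
      proof (rule nn_integral_mono)
        fix x
        have "norm (?\<Phi> (u (\<tau> i)) (\<tau> i) x - ?\<Phi> (u s) (\<tau> i) x)
            = \<bar>cutoff M R T (\<tau> i) x\<bar> * \<bar>discrepancy \<epsilon> n X (u (\<tau> i) x) (\<tau> i) x - discrepancy \<epsilon> n X (u s x) (\<tau> i) x\<bar>"
          unfolding real_norm_def abs_mult[symmetric] by (simp only: right_diff_distrib)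
        also have "\<dots> \<le> indicator ?K x * (real (Suc n) * \<bar>u (\<tau> i) x - u s x\<bar>)"
          by (intro mult_mono cutoff_le discrepancy_lipschitz \<tau>) auto
        finally have "ennreal (norm (?\<Phi> (u (\<tau> i)) (\<tau> i) x - ?\<Phi> (u s) (\<tau> i) x))
            \<le> ennreal (indicator ?K x * (real (Suc n) * \<bar>u (\<tau> i) x - u s x\<bar>))" by (rule ennreal_leI)
        also have "\<dots> = ennreal (real (Suc n)) * (ennreal \<bar>u (\<tau> i) x - u s x\<bar> * indicator ?K x)"
          by (cases "x \<in> ?K") (simp_all add: ennreal_mult)
        finally show "ennreal (norm (?\<Phi> (u (\<tau> i)) (\<tau> i) x - ?\<Phi> (u s) (\<tau> i) x))
            \<le> ennreal (real (Suc n)) * (ennreal \<bar>u (\<tau> i) x - u s x\<bar> * indicator ?K x)" .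
      qed
      also have "\<dots> = ennreal (real (Suc n)) * ?N (\<tau> i)" by (rule nn_integral_cmult[OF ms])
      finally show ?thesis .
    qed
    have "(?N \<longlongrightarrow> ?N s) (at s within {0..})"
      using loc \<tau>(3) unfolding L1_loc_continuous_def by (auto simp: compact_Icc)
    then have "continuous (at s within {0..}) ?N" by (simp only: continuous_within)
    then have "(?N \<circ> \<tau>) \<longlonglongrightarrow> ?N s"
      unfolding continuous_within_sequentially using \<tau> by (auto simp del: nn_integral_0_iff_AE)
    then show "(\<lambda>i. ?N (\<tau> i)) \<longlonglongrightarrow> 0" by (simp add: comp_def)
  qed
  moreover have "(\<lambda>i. LBINT x. ?\<Phi> (u s) (\<tau> i) x) \<longlonglongrightarrow> (LBINT x. ?\<Phi> (u s) s x)"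
  proof (rule integral_dominated_convergence[where w="\<lambda>x. indicator ?K x * real (Suc n)"])
    show "?\<Phi> (u s) s \<in> borel_measurable lborel" "\<And>i. ?\<Phi> (u s) (\<tau> i) \<in> borel_measurable lborel"
      using int[OF \<tau>(3)] by blast+
    have "integrable lborel (indicator ?K :: real \<Rightarrow> real)"
      by (intro integrable_real_indicator) (simp_all add: emeasure_lborel_Icc_eq)
    then show "integrable lborel (\<lambda>x. indicator ?K x * real (Suc n))" by simp
    show "AE x in lborel. (\<lambda>i. ?\<Phi> (u s) (\<tau> i) x) \<longlonglongrightarrow> ?\<Phi> (u s) s x"
    proof (rule AE_I2)
      fix x
      have "continuous_on UNIV (\<lambda>t. cutoff M R T t x * discrepancy \<epsilon> n X (u s x) t x)"
        by (intro continuous_intros continuous_discrepancy eps X) auto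
      then have "isCont (\<lambda>t. cutoff M R T t x * discrepancy \<epsilon> n X (u s x) t x) s"
        by (simp add: continuous_on_eq_continuous_at)
      then show "(\<lambda>i. ?\<Phi> (u s) (\<tau> i) x) \<longlonglongrightarrow> ?\<Phi> (u s) s x"
        by (rule isCont_tendsto_compose) (rule \<tau>(2))
    qed
    show "AE x in lborel. norm (?\<Phi> (u s) (\<tau> i) x) \<le> indicator ?K x * real (Suc n)" for i
      unfolding real_norm_def abs_mult
      by (intro AE_I2 mult_mono cutoff_le discrepancy_abs_le u01 \<tau>) auto
  qed
  ultimately have "(\<lambda>i. (LBINT x. ?\<Phi> (u (\<tau> i)) (\<tau> i) x) - (LBINT x. ?\<Phi> (u s) (\<tau> i) x)
      + (LBINT x. ?\<Phi> (u s) (\<tau> i) x)) \<longlonglongrightarrow> 0 + (LBINT x. ?\<Phi> (u s) s x)"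
    by (rule tendsto_add)
  then show "((\<lambda>t. energy \<epsilon> n X (cutoff M R T) (u t) t) \<circ> \<tau>) \<longlonglongrightarrow> energy \<epsilon> n X (cutoff M R T) (u s) s"
    by (simp add: energy_def comp_def)
qed

section \<open>The comparison test functions\<close>

lemma abs_kruzkov_flux_le:
  "\<bar>\<Lambda> w - \<Lambda> c\<bar> \<le> M * \<bar>w - c\<bar> \<Longrightarrow> \<bar>kruzkov_flux \<Lambda> w c\<bar> \<le> M * \<bar>w - c\<bar>"
  by (auto simp: kruzkov_flux_def abs_mult sgn_if)

text \<open>The derivative in space of the smoothed front: a bump of mass one, placed at the front.\<close>

definition peak :: "real \<Rightarrow> nat \<Rightarrow> (nat \<Rightarrow> real \<Rightarrow> real) \<Rightarrow> nat \<Rightarrow> real \<Rightarrow> real \<Rightarrow> real" where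
  "peak \<epsilon> n X k t x = (if k \<in> {1..n} then mollifier \<epsilon> (X k t) x else 0)"

lemma front_derivative:
  assumes "\<epsilon> > 0" and X: "\<And>k t. X k t = \<alpha> k + \<beta> k * t"
  shows "((\<lambda>s. front \<epsilon> n X k s x) has_real_derivative - \<beta> k * peak \<epsilon> n X k t x) (at t)"
    and "((\<lambda>y. front \<epsilon> n X k t y) has_real_derivative peak \<epsilon> n X k t x) (at x)"
proof -
  have "((\<lambda>s. step ((x - X k s) / \<epsilon>)) has_real_derivative - \<beta> k * mollifier \<epsilon> (X k t) x) (at t)"
    "((\<lambda>y. step ((y - X k t) / \<epsilon>)) has_real_derivative mollifier \<epsilon> (X k t) x) (at x)"
    unfolding X mollifier_def divide_inverse by (auto intro!: derivative_eq_intros)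
  then show "((\<lambda>s. front \<epsilon> n X k s x) has_real_derivative - \<beta> k * peak \<epsilon> n X k t x) (at t)"
    and "((\<lambda>y. front \<epsilon> n X k t y) has_real_derivative peak \<epsilon> n X k t x) (at x)"
    by (cases "k \<in> {1..n}"; cases "k = 0"; simp add: front_def peak_def)+
qed

lemma peak_integral:
  assumes "\<epsilon> > 0" "k \<in> {1..n}"
  shows "integrable lborel (peak \<epsilon> n X k t)" "(LBINT x. peak \<epsilon> n X k t x) = 1"
proof -
  have "peak \<epsilon> n X k t = mollifier \<epsilon> (X k t)" using assms(2) by (auto simp: peak_def fun_eq_iff)
  then show "integrable lborel (peak \<epsilon> n X k t)" "(LBINT x. peak \<epsilon> n X k t x) = 1"
    using mollifier_integral[OF assms(1)] by simp_all
qed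

lemma peak_nonneg: "\<epsilon> > 0 \<Longrightarrow> peak \<epsilon> n X k t x \<ge> 0"
  by (simp add: peak_def mollifier_nonneg)

lemma continuous_peak:
  assumes "\<epsilon> > 0" "k \<in> {1..n} \<Longrightarrow> continuous_on S (\<lambda>z. X k (f z))" "continuous_on S g"
  shows "continuous_on S (\<lambda>z. peak \<epsilon> n X k (f z) (g z))"
proof (cases "k \<in> {1..n}")
  case True
  then have "continuous_on S (\<lambda>z. step' ((g z - X k (f z)) / \<epsilon>) / \<epsilon>)"
    using assms by (intro continuous_intros continuous_step'_compose) auto
  then show ?thesis using True by (simp add: peak_def mollifier_def)
next
  case False
  then have "(\<lambda>z. peak \<epsilon> n X k (f z) (g z)) = (\<lambda>_. 0)" by (simp only: peak_def if_False)
  then show ?thesis by (simp only: continuous_on_const)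
qed

definition cutoff_left :: "real \<Rightarrow> real \<Rightarrow> real \<Rightarrow> real \<Rightarrow> real \<Rightarrow> real" where
  "cutoff_left M R T t x = step (R + 1 + M * (T - t) - x) * step' (R + 1 + M * (T - t) + x)"

definition cutoff_right :: "real \<Rightarrow> real \<Rightarrow> real \<Rightarrow> real \<Rightarrow> real \<Rightarrow> real" where
  "cutoff_right M R T t x = step' (R + 1 + M * (T - t) - x) * step (R + 1 + M * (T - t) + x)"

lemma cutoff_derivative:
  "((\<lambda>s. cutoff M R T s x) has_real_derivative - M * (cutoff_left M R T t x + cutoff_right M R T t x)) (at t)"
  "((\<lambda>y. cutoff M R T t y) has_real_derivative cutoff_left M R T t x - cutoff_right M R T t x) (at x)"
  unfolding cutoff_def cutoff_left_def cutoff_right_def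
  by (auto intro!: derivative_eq_intros simp: algebra_simps)

lemma cutoff_side_nonneg: "0 \<le> cutoff_left M R T t x" "0 \<le> cutoff_right M R T t x"
  by (simp_all add: cutoff_left_def cutoff_right_def step_range step'_nonneg)

text \<open>The Kruzkov flux is at most \<open>M\<close> times the entropy, and the cone shrinks with speed \<open>M\<close>.\<close>

lemma cutoff_decreases_along_characteristics:
  assumes "\<bar>j\<bar> \<le> M * d"
  shows "d * (- M * (cutoff_left M R T t x + cutoff_right M R T t x))
    + j * (cutoff_left M R T t x - cutoff_right M R T t x) \<le> 0"
proof -
  let ?P = "cutoff_left M R T t x" and ?Q = "cutoff_right M R T t x"
  have "(j - M * d) * ?P \<le> 0" "(- j - M * d) * ?Q \<le> 0"
    using assms cutoff_side_nonneg[of M R T t x] by (auto intro!: mult_nonpos_nonneg)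
  then show ?thesis by (simp add: algebra_simps)
qed

text \<open>The test function for the state \<open>k / n\<close>. It is smooth only while the fronts move along straight
  lines, so it is used between two changes of the particle velocities.\<close>

definition comparison_test :: "real \<Rightarrow> nat \<Rightarrow> (nat \<Rightarrow> real \<Rightarrow> real) \<Rightarrow> real \<Rightarrow> real \<Rightarrow> real \<Rightarrow>
    real \<Rightarrow> real \<Rightarrow> real \<Rightarrow> nat \<Rightarrow> real \<times> real \<Rightarrow> real" where
  "comparison_test \<epsilon> n X M R T d p q k z =
     plateau d p q (fst z) * (cutoff M R T (fst z) (snd z) * layer \<epsilon> n X k (fst z) (snd z))"

lemma plateau_cutoff_outside:
  assumes "M \<ge> 0" "d > 0" "p \<le> q"
    and "z \<notin> {p..q + d} \<times> {-(R + 1 + M * (T - p))..R + 1 + M * (T - p)}"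
  shows "plateau d p q (fst z) * cutoff M R T (fst z) (snd z) = 0"
proof (cases "fst z \<in> {p..q + d}")
  case True
  then have "M * (T - fst z) \<le> M * (T - p)" using assms(1) by (intro mult_left_mono) auto
  moreover have "snd z \<notin> {-(R + 1 + M * (T - p))..R + 1 + M * (T - p)}"
    using True assms(4) by (cases z) auto
  ultimately have "snd z \<notin> {-(R + 1 + M * (T - fst z))..R + 1 + M * (T - fst z)}" by auto
  then show ?thesis by (simp add: cutoff_outside)
next
  case False
  then have "fst z \<le> p \<or> q + d \<le> fst z" by auto
  then show ?thesis using plateau_outside[OF assms(2,3)] by simp
qed

lemma smooth_comparison_test:
  assumes "\<epsilon> > 0" and X: "\<And>k t. X k t = \<alpha> k + \<beta> k * t"
  shows "smooth (comparison_test \<epsilon> n X M R T d p q k)"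
proof -
  have pl: "smooth_alg (\<lambda>z::real\<times>real. plateau d p q (fst z))"
    unfolding plateau_def
    by (intro smooth_alg_diff smooth_alg_step[where a="1/d" and b=0 and c="-p/d"]
        smooth_alg_step[where a="1/d" and b=0 and c="-q/d"]) (simp_all add: diff_divide_distrib)
  have cu: "smooth_alg (\<lambda>z::real\<times>real. cutoff M R T (fst z) (snd z))"
    unfolding cutoff_def
    by (intro smooth_alg.mult smooth_alg_step[where a="-M" and b="-1" and c="R + 1 + M * T"]
        smooth_alg_step[where a="-M" and b=1 and c="R + 1 + M * T"]) (simp_all add: algebra_simps)
  have fr: "smooth_alg (\<lambda>z::real\<times>real. front \<epsilon> n X k (fst z) (snd z))" for k
  proof -
    have "smooth_alg (\<lambda>z::real\<times>real. step ((snd z - X k (fst z)) / \<epsilon>))"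
      unfolding X by (rule smooth_alg_step[where a="- \<beta> k / \<epsilon>" and b="1/\<epsilon>" and c="- \<alpha> k / \<epsilon>"])
        (simp add: diff_divide_distrib add_divide_distrib)
    then show ?thesis
      unfolding front_def using smooth_alg.const[of 1] smooth_alg.const[of 0]
      by (cases "k = 0"; cases "k \<le> n"; simp)
  qed
  have "smooth_alg (\<lambda>z::real\<times>real. plateau d p q (fst z) * (cutoff M R T (fst z) (snd z) * layer \<epsilon> n X k (fst z) (snd z)))"
    unfolding layer_def by (intro smooth_alg.mult smooth_alg_diff pl cu fr)
  then show ?thesis unfolding comparison_test_def[abs_def] by (rule smooth_algI)
qed

lemma comparison_test_outside:
  assumes "M \<ge> 0" "d > 0" "p \<le> q"
    and "z \<notin> {p..q + d} \<times> {-(R + 1 + M * (T - p))..R + 1 + M * (T - p)}"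
  shows "comparison_test \<epsilon> n X M R T d p q k z = 0"
  using plateau_cutoff_outside[OF assms] unfolding comparison_test_def mult.assoc[symmetric] by simp

lemma test_function_comparison_test:
  assumes "\<epsilon> > 0" and X: "\<And>k t. X k t = \<alpha> k + \<beta> k * t" and "M \<ge> 0" "d > 0" "p \<le> q"
  shows "test_function (comparison_test \<epsilon> n X M R T d p q k)"
  unfolding test_function_def
proof
  show "smooth (comparison_test \<epsilon> n X M R T d p q k)" by (rule smooth_comparison_test[OF assms(1) X])
  let ?K = "{p..q + d} \<times> {-(R + 1 + M * (T - p))..R + 1 + M * (T - p)}"
  have "compact ?K" by (intro compact_Times compact_Icc)
  then have "bounded {z. comparison_test \<epsilon> n X M R T d p q k z \<noteq> 0}"
    by (rule bounded_subset[OF compact_imp_bounded]) (use comparison_test_outside[OF assms(3-5)] in blast)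
  then show "compact (closure {z. comparison_test \<epsilon> n X M R T d p q k z \<noteq> 0})"
    by (simp add: compact_closure)
qed

lemma comparison_test_derivatives:
  assumes "\<epsilon> > 0" and X: "\<And>k t. X k t = \<alpha> k + \<beta> k * t"
  shows "dt (comparison_test \<epsilon> n X M R T d p q k) t x =
      (mollifier d p t - mollifier d q t) * (cutoff M R T t x * layer \<epsilon> n X k t x)
    + plateau d p q t * (- M * (cutoff_left M R T t x + cutoff_right M R T t x) * layer \<epsilon> n X k t x
      + (- (\<beta> k * peak \<epsilon> n X k t x) + \<beta> (Suc k) * peak \<epsilon> n X (Suc k) t x) * cutoff M R T t x)" (is ?dt)
    and "dx (comparison_test \<epsilon> n X M R T d p q k) t x =
      plateau d p q t * ((cutoff_left M R T t x - cutoff_right M R T t x) * layer \<epsilon> n X k t x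
      + (peak \<epsilon> n X k t x - peak \<epsilon> n X (Suc k) t x) * cutoff M R T t x)" (is ?dx)
proof -
  note fr = front_derivative[OF assms(1), of X \<alpha> \<beta>, OF X]
  have lt: "((\<lambda>s. layer \<epsilon> n X k s x) has_real_derivative
      - (\<beta> k * peak \<epsilon> n X k t x) + \<beta> (Suc k) * peak \<epsilon> n X (Suc k) t x) (at t)"
    unfolding layer_def using DERIV_diff[OF fr(1)[of n k x t] fr(1)[of n "Suc k" x t]] by simp
  have lx: "((\<lambda>y. layer \<epsilon> n X k t y) has_real_derivative
      peak \<epsilon> n X k t x - peak \<epsilon> n X (Suc k) t x) (at x)"
    unfolding layer_def by (rule DERIV_diff[OF fr(2) fr(2)])
  show ?dt
    unfolding dt_def comparison_test_def fst_conv snd_conv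
    by (rule DERIV_imp_deriv,
        rule DERIV_cong[OF DERIV_mult[OF plateau_derivative DERIV_mult[OF cutoff_derivative(1) lt]]])
      (simp add: mult.commute)
  show ?dx
    unfolding dx_def comparison_test_def fst_conv snd_conv
    by (rule DERIV_imp_deriv,
        rule DERIV_cong[OF DERIV_cmult[OF DERIV_mult[OF cutoff_derivative(2) lx]]])
      (simp add: mult.commute)
qed

text \<open>The derivatives fall on the time cut-off, on the cone and on the layers. The first part is the change of
  the energy, the second has a sign, and the third is located at the fronts, where
  \<open>sticky_dissipation\<close> applies at every point with the value of the solution there.\<close>

lemma comparison_pointwise:
  assumes \<Lambda>: "\<forall>v\<in>{0..1}. (\<Lambda> has_real_derivative lam v) (at v within {0..1})"
    and lip: "L-lipschitz_on {0..1} lam"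
    and M: "\<And>a b. a \<in> {0..1} \<Longrightarrow> b \<in> {0..1} \<Longrightarrow> \<bar>\<Lambda> a - \<Lambda> b\<bar> \<le> M * \<bar>a - b\<bar>"
    and eps: "\<epsilon> > 0" and X: "\<And>k t. X k t = \<alpha> k + \<beta> k * t"
    and d: "d > 0" "p \<le> q" and w: "w \<in> {0..1}"
    and e: "e 0 = 0" "e n = 0" "\<And>k. k \<le> n \<Longrightarrow> e k \<le> 0"
    and \<beta>: "\<And>k. k \<in> {1..n} \<Longrightarrow>
      \<beta> k = real n * (\<Lambda> (real k / real n) - \<Lambda> (real (k - 1) / real n)) + e k - e (k - 1)"
    and stick: "\<And>k. 1 \<le> k \<Longrightarrow> k < n \<Longrightarrow> e k \<noteq> 0 \<Longrightarrow> \<alpha> k = \<alpha> (Suc k) \<and> \<beta> k = \<beta> (Suc k)"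
    and sorted: "\<And>k. p < t \<Longrightarrow> t < q + d \<Longrightarrow> 1 \<le> k \<Longrightarrow> k < n \<Longrightarrow> X k t \<le> X (Suc k) t"
  shows "(\<Sum>k\<le>n. \<bar>w - real k / real n\<bar> * dt (comparison_test \<epsilon> n X M R T d p q k) t x
      + kruzkov_flux \<Lambda> w (real k / real n) * dx (comparison_test \<epsilon> n X M R T d p q k) t x)
    \<le> (mollifier d p t - mollifier d q t) * (cutoff M R T t x * discrepancy \<epsilon> n X w t x)
      + plateau d p q t * cutoff M R T t x * (L / (real n)\<^sup>2 * (\<Sum>k=1..n. peak \<epsilon> n X k t x))"
proof -
  let ?d = "\<lambda>k. \<bar>w - real k / real n\<bar>" and ?j = "\<lambda>k. kruzkov_flux \<Lambda> w (real k / real n)"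
  let ?r = "\<lambda>k. peak \<epsilon> n X k t x" and ?l = "\<lambda>k. layer \<epsilon> n X k t x"
  let ?C = "cutoff M R T t x" and ?P = "cutoff_left M R T t x" and ?Q = "cutoff_right M R T t x"
  let ?\<theta> = "plateau d p q t" and ?m = "mollifier d p t - mollifier d q t"
  let ?A = "\<lambda>k. ?d k * (- M * (?P + ?Q)) + ?j k * (?P - ?Q)"
  let ?B = "\<lambda>k. ?d k * (- (\<beta> k * ?r k) + \<beta> (Suc k) * ?r (Suc k)) + ?j k * (?r k - ?r (Suc k))"
  have "(\<Sum>k\<le>n. ?d k * dt (comparison_test \<epsilon> n X M R T d p q k) t x
      + ?j k * dx (comparison_test \<epsilon> n X M R T d p q k) t x)
    = (\<Sum>k\<le>n. (?m * ?C) * (?d k * ?l k) + ?\<theta> * (?l k * ?A k) + (?\<theta> * ?C) * ?B k)"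
    unfolding comparison_test_derivatives[OF eps X] by (intro sum.cong refl) (simp add: algebra_simps)
  also have "\<dots> = ?m * (?C * discrepancy \<epsilon> n X w t x) + (\<Sum>k\<le>n. ?\<theta> * (?l k * ?A k)) + ?\<theta> * ?C * (\<Sum>k\<le>n. ?B k)"
    by (simp only: sum.distrib sum_distrib_left[symmetric] discrepancy_def mult.assoc)
  also have "\<dots> \<le> ?m * (?C * discrepancy \<epsilon> n X w t x) + 0 + ?\<theta> * ?C * (L / (real n)\<^sup>2 * (\<Sum>k=1..n. ?r k))"
  proof (intro add_mono order_refl)
    show "(\<Sum>k\<le>n. ?\<theta> * (?l k * ?A k)) \<le> 0"
    proof (intro sum_nonpos)
      fix k assume "k \<in> {..n}"
      show "?\<theta> * (?l k * ?A k) \<le> 0"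
      proof (cases "p < t \<and> t < q + d")
        case True
        have "real k / real n \<in> {0..1}" using \<open>k \<in> {..n}\<close> by (auto simp: divide_le_eq_1)
        then have "\<bar>?j k\<bar> \<le> M * ?d k" by (intro abs_kruzkov_flux_le M w)
        then have "?A k \<le> 0" by (rule cutoff_decreases_along_characteristics)
        moreover have "0 \<le> ?l k" using True by (intro layer_nonneg[OF eps] sorted) auto
        ultimately show ?thesis
          using plateau_range(1)[OF d] by (intro mult_nonneg_nonpos) auto
      next
        case False
        then show ?thesis using plateau_outside[OF d, of t] by auto
      qed
    qed
    have r0: "?r 0 = 0" "?r (Suc n) = 0" by (simp_all add: peak_def)
    have "(\<Sum>k\<le>n. ?B k) = (\<Sum>k\<le>n. ?j k * (?r k - ?r (Suc k))) - (\<Sum>k\<le>n. ?d k * (\<beta> k * ?r k - \<beta> (Suc k) * ?r (Suc k)))"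
      unfolding sum_subtractf[symmetric] by (intro sum.cong refl) (simp add: algebra_simps)
    also have "\<dots> = (\<Sum>k=1..n. ?r k * (?j k - ?j (k - 1))) - (\<Sum>k=1..n. \<beta> k * ?r k * (?d k - ?d (k - 1)))"
      using abel_summation[of ?j ?r n] abel_summation[of ?d "\<lambda>k. \<beta> k * ?r k" n] by (simp only: r0)
    also have "\<dots> = (\<Sum>k=1..n. ?r k * (?j k - ?j (k - 1) - \<beta> k * (?d k - ?d (k - 1))))"
      unfolding sum_subtractf[symmetric] by (intro sum.cong refl) (simp add: algebra_simps)
    also have "\<dots> \<le> L / (real n)\<^sup>2 * (\<Sum>k=1..n. ?r k)"
    proof (rule sticky_dissipation[OF \<Lambda> lip e \<beta> peak_nonneg[OF eps] r0])
      fix k assume k: "1 \<le> k" "k < n" "e k \<noteq> 0"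
      then have "X k t = X (Suc k) t" using stick[OF k] by (simp add: X)
      then show "?r k = ?r (Suc k)" using k by (simp add: peak_def)
    qed
    finally show "?\<theta> * ?C * (\<Sum>k\<le>n. ?B k) \<le> ?\<theta> * ?C * (L / (real n)\<^sup>2 * (\<Sum>k=1..n. ?r k))"
      using plateau_range(1)[OF d] cutoff_range(1) by (intro mult_left_mono mult_nonneg_nonneg)
  qed
  finally show ?thesis by simp
qed

section \<open>The summed entropy inequalities\<close>

text \<open>The constant \<open>M\<close> bounds the speed of propagation.\<close>

locale entropy_comparison =
  fixes \<Lambda> lam :: "real \<Rightarrow> real" and L M :: real and u0 :: "real \<Rightarrow> real" and u :: "real \<Rightarrow> real \<Rightarrow> real"
  assumes flux: "\<forall>v\<in>{0..1}. (\<Lambda> has_real_derivative lam v) (at v within {0..1})"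
    and lip: "L-lipschitz_on {0..1} lam"
    and speed: "\<And>a b. a \<in> {0..1} \<Longrightarrow> b \<in> {0..1} \<Longrightarrow> \<bar>\<Lambda> a - \<Lambda> b\<bar> \<le> M * \<bar>a - b\<bar>"
    and M: "M \<ge> 0"
    and sol: "entropy_solution \<Lambda> u0 u"
    and u0: "u0 \<in> borel_measurable borel" "\<And>x. u0 x \<in> {0..1}"
begin

text \<open>Only the values at nonnegative times are constrained; extension by zero gives a function that is
  measurable on the whole plane.\<close>

definition U :: "real \<times> real \<Rightarrow> real" where
  "U z = indicator ({0..} \<times> UNIV) z * u (fst z) (snd z)"

lemma U_eq: "fst z \<ge> 0 \<Longrightarrow> U z = u (fst z) (snd z)"
  by (cases z) (simp add: U_def)

lemma U_range: "U z \<in> {0..1}"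
  using sol by (cases z) (auto simp: U_def entropy_solution_def indicator_def)

lemma u_range: "t \<ge> 0 \<Longrightarrow> u t x \<in> {0..1}"
  using sol by (auto simp: entropy_solution_def)

lemma U_measurable: "U \<in> borel_measurable borel"
  using sol by (simp add: entropy_solution_def set_borel_measurable_def U_def[abs_def] case_prod_beta)

lemma u_measurable: assumes "t \<ge> 0" shows "u t \<in> borel_measurable borel"
proof -
  have "(\<lambda>x. (t, x)) \<in> borel_measurable (borel :: real measure)"
    by (intro borel_measurable_continuous_onI continuous_intros)
  from measurable_compose[OF this U_measurable] show ?thesis
    using assms by (simp add: U_eq)
qed

lemma flux_continuous: "continuous_on {0..1} \<Lambda>"
  using flux by (intro DERIV_continuous_on) auto

lemma kruzkov_flux_measurable: "(\<lambda>z. kruzkov_flux \<Lambda> (U z) c) \<in> borel_measurable borel"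
proof -
  have "continuous_on UNIV (\<lambda>v. \<Lambda> (max 0 (min 1 v)))"
    by (rule continuous_on_compose2[OF flux_continuous]) (auto intro!: continuous_intros)
  then have "(\<lambda>z. \<Lambda> (max 0 (min 1 (U z)))) \<in> borel_measurable borel"
    by (intro measurable_compose[OF U_measurable] borel_measurable_continuous_onI)
  moreover have "max 0 (min 1 (U z)) = U z" for z using U_range[of z] by auto
  ultimately have "(\<lambda>z. \<Lambda> (U z)) \<in> borel_measurable borel" by simp
  then show ?thesis unfolding kruzkov_flux_def sgn_if using U_measurable by measurable
qed

lemma grid_01: "k \<le> n \<Longrightarrow> real k / real n \<in> {0..1}"
  by (auto simp: divide_le_eq_1)

lemma kruzkov_flux_bounded: "k \<le> n \<Longrightarrow> \<bar>kruzkov_flux \<Lambda> (U z) (real k / real n)\<bar> \<le> M"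
proof -
  assume k: "k \<le> n"
  have "\<bar>kruzkov_flux \<Lambda> (U z) (real k / real n)\<bar> \<le> M * \<bar>U z - real k / real n\<bar>"
    by (intro abs_kruzkov_flux_le speed U_range grid_01 k)
  also have "\<dots> \<le> M * 1" using M abs_diff_grid_le[OF U_range k] by (intro mult_left_mono) auto
  finally show ?thesis by simp
qed

text \<open>The sum over \<open>k\<close> of Kruzkov's inequalities for the constants \<open>k / n\<close>, integrated first in space. The
  initial datum contributes only if the plateau does not vanish at time zero.\<close>

lemma weak_energy_inequality:
  assumes n: "n \<ge> 1" and eps: "\<epsilon> > 0" and X: "\<And>k t. X k t = \<alpha> k + \<beta> k * t"
    and d: "d > 0" "p \<le> q" "0 \<le> q"
    and e: "e 0 = 0" "e n = 0" "\<And>k. k \<le> n \<Longrightarrow> e k \<le> 0"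
    and \<beta>: "\<And>k. k \<in> {1..n} \<Longrightarrow>
      \<beta> k = real n * (\<Lambda> (real k / real n) - \<Lambda> (real (k - 1) / real n)) + e k - e (k - 1)"
    and stick: "\<And>k. 1 \<le> k \<Longrightarrow> k < n \<Longrightarrow> e k \<noteq> 0 \<Longrightarrow> \<alpha> k = \<alpha> (Suc k) \<and> \<beta> k = \<beta> (Suc k)"
    and sorted: "\<And>k t. 0 \<le> t \<Longrightarrow> p < t \<Longrightarrow> t < q + d \<Longrightarrow> 1 \<le> k \<Longrightarrow> k < n \<Longrightarrow> X k t \<le> X (Suc k) t"
  shows "0 \<le> (LBINT t. indicator {0..} t * ((mollifier d p t - mollifier d q t) * energy \<epsilon> n X (cutoff M R T) (u t) t))
      + L / real n * (q + d - max 0 p) + plateau d p q 0 * energy \<epsilon> n X (cutoff M R T) u0 0"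
proof -
  let ?S = "{0..} \<times> UNIV :: (real \<times> real) set"
  let ?K = "{p..q + d} \<times> {-(R + 1 + M * (T - p))..R + 1 + M * (T - p)}"
  let ?c = "\<lambda>k. real k / real n"
  let ?\<phi> = "comparison_test \<epsilon> n X M R T d p q"
  let ?m = "\<lambda>t. mollifier d p t - mollifier d q t"
  let ?E = "\<lambda>t. energy \<epsilon> n X (cutoff M R T) (u t) t"
  have L: "L \<ge> 0" using lip by (rule lipschitz_on_nonneg)
  have K: "compact ?K" by (intro compact_Times compact_Icc)
  have Xc: "continuous_on S (\<lambda>z. X k (f z))" if "continuous_on S f" for k S and f :: "'z::topological_space \<Rightarrow> real"
    unfolding X using that by (intro continuous_intros)
  have tf: "test_function (?\<phi> k)" for k by (rule test_function_comparison_test[OF eps X M d(1,2)])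
  have \<phi>_nonneg: "?\<phi> k (t, x) \<ge> 0" if "t \<ge> 0" for k t x
  proof (cases "p < t \<and> t < q + d")
    case True
    then have "0 \<le> layer \<epsilon> n X k t x" using that by (intro layer_nonneg[OF eps] sorted) auto
    then show ?thesis
      using plateau_range(1)[OF d(1,2)] cutoff_range(1) by (simp add: comparison_test_def)
  next
    case False
    then show ?thesis using plateau_outside[OF d(1,2), of t] by (auto simp: comparison_test_def)
  qed
  \<comment> \<open>The entropy inequalities, summed over the values of the step function.\<close>
  define F where "F k z = indicator ?S z * (\<bar>U z - ?c k\<bar> * dt (?\<phi> k) (fst z) (snd z)
      + kruzkov_flux \<Lambda> (U z) (?c k) * dx (?\<phi> k) (fst z) (snd z))" for k z
  define J where "J k = (LBINT x. \<bar>u0 x - ?c k\<bar> * ?\<phi> k (0, x))" for k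
  have Sm: "(indicator ?S :: real \<times> real \<Rightarrow> real) \<in> borel_measurable borel"
    by (intro borel_measurable_indicator borel_closed closed_Times) auto
  have kr: "0 \<le> (LINT z|lborel. F k z) + J k" if "k \<le> n" for k
  proof -
    have "0 \<le> set_lebesgue_integral lborel ?S
          (\<lambda>(t, x). \<bar>u t x - ?c k\<bar> * dt (?\<phi> k) t x + sgn (u t x - ?c k) * (\<Lambda> (u t x) - \<Lambda> (?c k)) * dx (?\<phi> k) t x)
        + (LBINT x. \<bar>u0 x - ?c k\<bar> * ?\<phi> k (0, x))"
      using sol grid_01[OF that] tf \<phi>_nonneg
      unfolding entropy_solution_def Kruzkov_condition_def by blast
    also have "set_lebesgue_integral lborel ?S
          (\<lambda>(t, x). \<bar>u t x - ?c k\<bar> * dt (?\<phi> k) t x + sgn (u t x - ?c k) * (\<Lambda> (u t x) - \<Lambda> (?c k)) * dx (?\<phi> k) t x)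
        = (LINT z|lborel. F k z)"
      unfolding set_lebesgue_integral_def
      by (intro Bochner_Integration.integral_cong refl)
        (auto simp: F_def U_def kruzkov_flux_def indicator_def)
    finally show ?thesis by (simp add: J_def)
  qed
  have intF: "integrable lborel (F k)" if "k \<le> n" for k
  proof -
    have "integrable lborel (\<lambda>z. (indicator ?S z * \<bar>U z - ?c k\<bar>) * dt (?\<phi> k) (fst z) (snd z))"
    proof (rule bounded_compact_support_integrable[where B=1])
      show "compact (closure {z. ?\<phi> k z \<noteq> 0})" using tf by (simp add: test_function_def)
      show "(\<lambda>z. indicator ?S z * \<bar>U z - ?c k\<bar>) \<in> borel_measurable borel"
        using Sm U_measurable by measurable
      show "\<bar>indicator ?S z * \<bar>U z - ?c k\<bar>\<bar> \<le> 1" for z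
        using abs_diff_grid_le[OF U_range[of z] that] by (auto simp: indicator_def)
    qed (rule test_function_derivatives[OF tf]; assumption)+
    moreover have "integrable lborel (\<lambda>z. (indicator ?S z * kruzkov_flux \<Lambda> (U z) (?c k)) * dx (?\<phi> k) (fst z) (snd z))"
    proof (rule bounded_compact_support_integrable[where B=M])
      show "compact (closure {z. ?\<phi> k z \<noteq> 0})" using tf by (simp add: test_function_def)
      show "(\<lambda>z. indicator ?S z * kruzkov_flux \<Lambda> (U z) (?c k)) \<in> borel_measurable borel"
        using Sm kruzkov_flux_measurable[of "?c k"] by measurable
      show "\<bar>indicator ?S z * kruzkov_flux \<Lambda> (U z) (?c k)\<bar> \<le> M" for z
        using kruzkov_flux_bounded[OF that, of z] M by (auto simp: indicator_def)
    qed (rule test_function_derivatives[OF tf]; assumption)+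
    ultimately show ?thesis
      unfolding F_def[abs_def] distrib_left mult.assoc[symmetric] by (rule Bochner_Integration.integrable_add)
  qed
  have J: "(\<Sum>k\<le>n. J k) = plateau d p q 0 * energy \<epsilon> n X (cutoff M R T) u0 0"
  proof -
    have int: "integrable lborel (\<lambda>x. \<bar>u0 x - ?c k\<bar> * (cutoff M R T 0 x * layer \<epsilon> n X k 0 x))" if "k \<le> n" for k
    proof (rule bounded_compact_support_integrable[where B=1 and K="{-(R + 1 + M * (T - 0))..R + 1 + M * (T - 0)}"])
      show "(\<lambda>x. \<bar>u0 x - ?c k\<bar>) \<in> borel_measurable borel" using u0(1) by measurable
      show "\<bar>\<bar>u0 x - ?c k\<bar>\<bar> \<le> 1" for x using abs_diff_grid_le[OF u0(2) that] by simp
      show "continuous_on UNIV (\<lambda>x. cutoff M R T 0 x * layer \<epsilon> n X k 0 x)"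
        by (intro continuous_on_mult continuous_cutoff continuous_layer[OF eps] Xc continuous_intros)
    qed (simp_all add: cutoff_outside)
    have "(\<Sum>k\<le>n. J k) = (\<Sum>k\<le>n. plateau d p q 0 * (LBINT x. \<bar>u0 x - ?c k\<bar> * (cutoff M R T 0 x * layer \<epsilon> n X k 0 x)))"
      unfolding J_def comparison_test_def fst_conv snd_conv
      by (intro sum.cong refl) (simp add: mult.left_commute)
    also have "\<dots> = plateau d p q 0 * (LBINT x. (\<Sum>k\<le>n. \<bar>u0 x - ?c k\<bar> * (cutoff M R T 0 x * layer \<epsilon> n X k 0 x)))"
      unfolding sum_distrib_left[symmetric] using int by (subst Bochner_Integration.integral_sum) auto
    also have "(\<lambda>x. \<Sum>k\<le>n. \<bar>u0 x - ?c k\<bar> * (cutoff M R T 0 x * layer \<epsilon> n X k 0 x))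
        = (\<lambda>x. cutoff M R T 0 x * discrepancy \<epsilon> n X (u0 x) 0 x)"
      by (simp add: discrepancy_def sum_distrib_left mult.left_commute)
    finally show ?thesis by (simp add: energy_def)
  qed
  define H1 where "H1 z = indicator ?S z * (?m (fst z) * (cutoff M R T (fst z) (snd z)
      * discrepancy \<epsilon> n X (U z) (fst z) (snd z)))" for z
  define H2 where "H2 z = indicator ?S z * (plateau d p q (fst z) * cutoff M R T (fst z) (snd z)
      * (L / (real n)\<^sup>2 * (\<Sum>k=1..n. peak \<epsilon> n X k (fst z) (snd z))))" for z
  have m_cutoff: "?m (fst z) * cutoff M R T (fst z) (snd z) = 0" if "z \<notin> ?K" for z
  proof (cases "fst z \<in> {p..q + d}")
    case True
    then have "M * (T - fst z) \<le> M * (T - p)" using M by (intro mult_left_mono) auto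
    moreover have "snd z \<notin> {-(R + 1 + M * (T - p))..R + 1 + M * (T - p)}"
      using True that by (cases z) auto
    ultimately have "snd z \<notin> {-(R + 1 + M * (T - fst z))..R + 1 + M * (T - fst z)}" by auto
    then show ?thesis by (simp add: cutoff_outside)
  next
    case False
    then have "fst z \<notin> {p..p + d}" "fst z \<notin> {q..q + d}" using d by auto
    then show ?thesis by (simp add: mollifier_outside[OF d(1)])
  qed
  have int1: "integrable lborel H1"
  proof -
    have "integrable lborel (\<lambda>z. (indicator ?S z * \<bar>U z - ?c k\<bar>)
        * (?m (fst z) * cutoff M R T (fst z) (snd z) * layer \<epsilon> n X k (fst z) (snd z)))" if "k \<le> n" for k
    proof (rule bounded_compact_support_integrable[OF K, where B=1])
      show "(\<lambda>z. indicator ?S z * \<bar>U z - ?c k\<bar>) \<in> borel_measurable borel"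
        using Sm U_measurable by measurable
      show "\<bar>indicator ?S z * \<bar>U z - ?c k\<bar>\<bar> \<le> 1" for z
        using abs_diff_grid_le[OF U_range[of z] that] by (auto simp: indicator_def)
      show "continuous_on UNIV (\<lambda>z. ?m (fst z) * cutoff M R T (fst z) (snd z) * layer \<epsilon> n X k (fst z) (snd z))"
        by (intro continuous_on_mult continuous_on_diff continuous_cutoff continuous_layer[OF eps] Xc
            continuous_on_compose2[OF continuous_mollifier[of UNIV]] continuous_intros) auto
    qed (simp add: m_cutoff)
    then have "integrable lborel (\<lambda>z. \<Sum>k\<le>n. (indicator ?S z * \<bar>U z - ?c k\<bar>)
        * (?m (fst z) * cutoff M R T (fst z) (snd z) * layer \<epsilon> n X k (fst z) (snd z)))"
      by (intro Bochner_Integration.integrable_sum) auto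
    also have "(\<lambda>z. \<Sum>k\<le>n. (indicator ?S z * \<bar>U z - ?c k\<bar>)
        * (?m (fst z) * cutoff M R T (fst z) (snd z) * layer \<epsilon> n X k (fst z) (snd z))) = H1"
      unfolding H1_def discrepancy_def sum_distrib_left by (intro ext sum.cong refl) (simp only: mult_ac)
    finally show ?thesis .
  qed
  have int2: "integrable lborel H2"
    unfolding H2_def[abs_def]
  proof (rule bounded_compact_support_integrable[OF K Sm, where B=1])
    show "continuous_on UNIV (\<lambda>z. plateau d p q (fst z) * cutoff M R T (fst z) (snd z)
      * (L / (real n)\<^sup>2 * (\<Sum>k=1..n. peak \<epsilon> n X k (fst z) (snd z))))"
      by (intro continuous_on_mult continuous_on_sum continuous_cutoff continuous_peak[OF eps] Xc
            continuous_on_compose2[OF continuous_plateau[of UNIV]] continuous_intros) auto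
  qed (use plateau_cutoff_outside[OF M d(1,2)] in \<open>simp_all\<close>)
  have pw: "(\<Sum>k\<le>n. F k z) \<le> H1 z + H2 z" for z
  proof (cases "z \<in> ?S")
    case True
    then have t: "0 \<le> fst z" by auto
    have "(\<Sum>k\<le>n. F k z) = (\<Sum>k\<le>n. \<bar>U z - ?c k\<bar> * dt (?\<phi> k) (fst z) (snd z)
        + kruzkov_flux \<Lambda> (U z) (?c k) * dx (?\<phi> k) (fst z) (snd z))"
      using True by (simp add: F_def)
    also have "\<dots> \<le> ?m (fst z) * (cutoff M R T (fst z) (snd z) * discrepancy \<epsilon> n X (U z) (fst z) (snd z))
      + plateau d p q (fst z) * cutoff M R T (fst z) (snd z)
        * (L / (real n)\<^sup>2 * (\<Sum>k=1..n. peak \<epsilon> n X k (fst z) (snd z)))"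
      by (rule comparison_pointwise[OF flux lip speed eps X d(1,2) U_range e \<beta> stick sorted[OF t]])
    also have "\<dots> = H1 z + H2 z" using True by (simp add: H1_def H2_def)
    finally show ?thesis .
  qed (simp add: F_def H1_def H2_def)
  have "0 \<le> (\<Sum>k\<le>n. (LINT z|lborel. F k z) + J k)" using kr by (intro sum_nonneg) auto
  also have "\<dots> = (LINT z|lborel. (\<Sum>k\<le>n. F k z)) + (\<Sum>k\<le>n. J k)"
    using intF by (simp add: sum.distrib Bochner_Integration.integral_sum)
  also have "\<dots> \<le> (LINT z|lborel. H1 z + H2 z) + (\<Sum>k\<le>n. J k)"
    using intF int1 int2 pw by (intro add_mono integral_mono order_refl) auto
  also have "(LINT z|lborel. H1 z + H2 z) = (LINT z|lborel. H1 z) + (LINT z|lborel. H2 z)"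
    using int1 int2 by simp
  also have "(LINT z|lborel. H1 z) = (LBINT t. LBINT x. H1 (t, x))"
    using lborel_pair.integral_fst'[of H1] int1 by (simp add: lborel_prod)
  also have "\<dots> = (LBINT t. indicator {0..} t * (?m t * ?E t))"
  proof (intro Bochner_Integration.integral_cong refl)
    fix t :: real
    show "(LBINT x. H1 (t, x)) = indicator {0..} t * (?m t * ?E t)"
    proof (cases "t \<ge> 0")
      case True
      then show ?thesis by (simp add: H1_def U_eq energy_def)
    qed (simp add: H1_def)
  qed
  also have "(LINT z|lborel. H2 z) \<le> L / real n * (q + d - max 0 p)"
  proof -
    have i2: "integrable lborel (\<lambda>t. LBINT x. H2 (t, x))"
      using lborel_pair.integrable_fst'[of H2] int2 by (simp add: lborel_prod)
    have "(LINT z|lborel. H2 z) = (LBINT t. LBINT x. H2 (t, x))"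
      using lborel_pair.integral_fst'[of H2] int2 by (simp add: lborel_prod)
    also have "\<dots> \<le> (LBINT t. L / real n * indicator {max 0 p..q + d} t)"
    proof (rule integral_mono[OF i2])
      show "integrable lborel (\<lambda>t. L / real n * indicator {max 0 p..q + d} t)"
        by (intro integrable_mult_right integrable_real_indicator) (simp_all add: emeasure_lborel_Icc_eq)
      fix t :: real
      show "(LBINT x. H2 (t, x)) \<le> L / real n * indicator {max 0 p..q + d} t"
      proof (cases "t \<in> {max 0 p..q + d}")
        case True
        have pk: "integrable lborel (peak \<epsilon> n X k t)" "(LBINT x. peak \<epsilon> n X k t x) = 1" if "k \<in> {1..n}" for k
          using peak_integral[OF eps that] by auto
        have "(LBINT x. H2 (t, x)) \<le> (LBINT x. L / (real n)\<^sup>2 * (\<Sum>k=1..n. peak \<epsilon> n X k t x))"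
        proof (rule integral_mono')
          show "integrable lborel (\<lambda>x. L / (real n)\<^sup>2 * (\<Sum>k=1..n. peak \<epsilon> n X k t x))"
            using pk(1) by (intro integrable_mult_right Bochner_Integration.integrable_sum) auto
          fix x
          have nn: "0 \<le> L / (real n)\<^sup>2 * (\<Sum>k=1..n. peak \<epsilon> n X k t x)"
            using L by (intro mult_nonneg_nonneg sum_nonneg peak_nonneg eps) auto
          then show "0 \<le> L / (real n)\<^sup>2 * (\<Sum>k=1..n. peak \<epsilon> n X k t x)" .
          have "plateau d p q t * cutoff M R T t x \<le> 1"
            using plateau_range[OF d(1,2)] cutoff_range by (intro mult_le_one)
          then have "plateau d p q t * cutoff M R T t x * (L / (real n)\<^sup>2 * (\<Sum>k=1..n. peak \<epsilon> n X k t x))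
              \<le> 1 * (L / (real n)\<^sup>2 * (\<Sum>k=1..n. peak \<epsilon> n X k t x))"
            by (rule mult_right_mono[OF _ nn])
          then show "H2 (t, x) \<le> L / (real n)\<^sup>2 * (\<Sum>k=1..n. peak \<epsilon> n X k t x)"
            using True by (simp add: H2_def)
        qed
        also have "\<dots> = L / (real n)\<^sup>2 * (\<Sum>k=1..n. 1)"
          using pk by (simp add: Bochner_Integration.integral_sum)
        also have "\<dots> = L / real n" using n by (simp add: power2_eq_square)
        finally show ?thesis using True by simp
      next
        case False
        have "H2 (t, x) = 0" for x
        proof (cases "0 \<le> t")
          case True
          then have "t \<le> p \<or> q + d \<le> t" using False by auto
          then show ?thesis using plateau_outside[OF d(1,2), of t] by (simp add: H2_def)
        qed (simp add: H2_def)
        then show ?thesis using False by simp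
      qed
    qed
    also have "\<dots> = L / real n * (q + d - max 0 p)"
      using d by simp
    finally show ?thesis .
  qed
  finally show ?thesis unfolding J by simp
qed

end

section \<open>Decay of the regularised distance\<close>

text \<open>The infimum of the bad times could neither be bad itself, by continuity, nor a limit of bad times
  from the right.\<close>

lemma right_nonincreasing_le:
  fixes f :: "real \<Rightarrow> real"
  assumes cont: "continuous_on {0..} f"
    and right: "\<And>s. s \<ge> 0 \<Longrightarrow> \<exists>\<delta>>0. \<forall>q\<in>{s<..<s+\<delta>}. f q \<le> f s" and t: "t \<ge> 0"
  shows "f t \<le> f 0"
proof (rule ccontr)
  assume bad: "\<not> f t \<le> f 0"
  let ?B = "{r. 0 \<le> r \<and> f 0 < f r}"
  define s where "s = Inf ?B"
  have B: "t \<in> ?B" "bdd_below ?B" using bad t by (auto intro: bdd_belowI[of _ 0])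
  have s0: "s \<ge> 0" unfolding s_def by (rule cInf_greatest) (use B in auto)
  have below: "f r \<le> f 0" if "0 \<le> r" "r < s" for r
  proof (rule ccontr)
    assume "\<not> f r \<le> f 0"
    then have "s \<le> r" unfolding s_def using that B(2) by (intro cInf_lower) auto
    then show False using that by simp
  qed
  have fs: "f s \<le> f 0"
  proof (rule ccontr)
    assume c: "\<not> f s \<le> f 0"
    then have "s > 0" using s0 by (cases "s = 0") auto
    from c have "0 < f s - f 0" by simp
    then obtain d where d: "d > 0" "\<And>r. r \<in> {0..} \<Longrightarrow> dist r s < d \<Longrightarrow> dist (f r) (f s) < f s - f 0"
      using cont s0 unfolding continuous_on_iff by (metis atLeast_iff)
    let ?r = "max 0 (s - d/2)"
    have "dist (f ?r) (f s) < f s - f 0" using d(1) s0 by (intro d(2)) (auto simp: dist_real_def)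
    then have "f 0 < f ?r" by (simp add: dist_real_def)
    moreover have "f ?r \<le> f 0" using \<open>s > 0\<close> d(1) by (intro below) auto
    ultimately show False by simp
  qed
  obtain \<delta> where \<delta>: "\<delta> > 0" "\<And>q. q \<in> {s<..<s+\<delta>} \<Longrightarrow> f q \<le> f s" using right[OF s0] by blast
  have "s + \<delta> \<le> Inf ?B"
  proof (rule cInf_greatest)
    fix r assume r: "r \<in> ?B"
    show "s + \<delta> \<le> r"
    proof (rule ccontr)
      assume "\<not> s + \<delta> \<le> r"
      then consider "r < s" | "r = s" | "r \<in> {s<..<s+\<delta>}" by fastforce
      then have "f r \<le> f 0" using below[of r] fs \<delta>(2)[of r] r by cases auto
      then show False using r by simp
    qed
  qed (use B in auto)
  then show False using \<delta>(1) by (simp add: s_def)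
qed

text \<open>What is used about the dynamics on a time interval without change of velocities. The number \<open>e k\<close> is
  the defect of momentum: the total velocity of the first \<open>k\<close> particles, compared with free motion. It is
  nonzero only inside a cluster.\<close>

definition affine_motion :: "(real \<Rightarrow> real) \<Rightarrow> nat \<Rightarrow> (nat \<Rightarrow> real \<Rightarrow> real) \<Rightarrow> real set \<Rightarrow>
    (nat \<Rightarrow> real) \<Rightarrow> (nat \<Rightarrow> real) \<Rightarrow> (nat \<Rightarrow> real) \<Rightarrow> bool" where
  "affine_motion \<Lambda> n X I \<alpha> \<beta> e \<longleftrightarrow>
     (\<forall>t\<in>I. \<forall>k\<in>{1..n}. X k t = \<alpha> k + \<beta> k * t) \<and>
     (\<forall>k\<in>{1..n}. \<beta> k = real n * (\<Lambda> (real k / real n) - \<Lambda> (real (k - 1) / real n)) + e k - e (k - 1)) \<and>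
     e 0 = 0 \<and> e n = 0 \<and> (\<forall>k\<le>n. e k \<le> 0) \<and>
     (\<forall>k. 1 \<le> k \<longrightarrow> k < n \<longrightarrow> e k \<noteq> 0 \<longrightarrow> \<alpha> k = \<alpha> (Suc k) \<and> \<beta> k = \<beta> (Suc k))"

definition sticky_motion :: "(real \<Rightarrow> real) \<Rightarrow> nat \<Rightarrow> (nat \<Rightarrow> real \<Rightarrow> real) \<Rightarrow> bool" where
  "sticky_motion \<Lambda> n X \<longleftrightarrow>
     (\<forall>k\<in>{1..n}. continuous_on UNIV (X k)) \<and>
     (\<forall>t k. 1 \<le> k \<longrightarrow> k < n \<longrightarrow> X k t \<le> X (Suc k) t) \<and>
     (\<forall>s\<ge>0. \<exists>\<delta>>0. \<exists>\<alpha> \<beta> e. affine_motion \<Lambda> n X {s..s+\<delta>} \<alpha> \<beta> e)"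

lemma energy_cong:
  assumes "\<And>k. k \<in> {1..n} \<Longrightarrow> X k t = Y k t"
  shows "energy \<epsilon> n X w v t = energy \<epsilon> n Y w v t"
proof -
  have "front \<epsilon> n X k t x = front \<epsilon> n Y k t x" for k x using assms[of k] by (auto simp: front_def)
  then show ?thesis by (simp add: energy_def discrepancy_def layer_def)
qed

context entropy_comparison
begin

text \<open>The width of the time cut-off is sent to zero. A plateau that starts before time zero brings in the
  given initial datum, one that starts at \<open>s\<close> brings in the solution at time \<open>s\<close>.\<close>

lemma energy_local_decay:
  fixes R T \<delta> :: real
  assumes n: "n \<ge> 1" and eps: "\<epsilon> > 0" and X: "\<And>k t. X k t = \<alpha> k + \<beta> k * t"
    and s: "s \<ge> 0" and q: "s < q" "q < s + \<delta>"
    and e: "e 0 = 0" "e n = 0" "\<And>k. k \<le> n \<Longrightarrow> e k \<le> 0"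
    and \<beta>: "\<And>k. k \<in> {1..n} \<Longrightarrow>
      \<beta> k = real n * (\<Lambda> (real k / real n) - \<Lambda> (real (k - 1) / real n)) + e k - e (k - 1)"
    and stick: "\<And>k. 1 \<le> k \<Longrightarrow> k < n \<Longrightarrow> e k \<noteq> 0 \<Longrightarrow> \<alpha> k = \<alpha> (Suc k) \<and> \<beta> k = \<beta> (Suc k)"
    and sorted: "\<And>k t. t \<in> {s..s+\<delta>} \<Longrightarrow> 1 \<le> k \<Longrightarrow> k < n \<Longrightarrow> X k t \<le> X (Suc k) t"
  defines "E \<equiv> \<lambda>t. energy \<epsilon> n X (cutoff M R T) (u t) t"
  shows "E q \<le> E s + L / real n * (q - s)"
    and "s = 0 \<Longrightarrow> E q \<le> energy \<epsilon> n X (cutoff M R T) u0 0 + L / real n * q"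
proof -
  have Ln: "0 \<le> L / real n" using lipschitz_on_nonneg[OF lip] by simp
  have loc: "L1_loc_continuous u" using sol by (simp add: entropy_solution_def)
  have Xc: "continuous_on UNIV (X k)" for k
    unfolding X by (intro continuous_intros)
  have E: "continuous_on {0..} E"
    unfolding E_def by (rule energy_continuous[OF eps M Xc loc u_measurable u_range])
  have near: "\<exists>d>0. \<forall>t\<in>{r..r+d}. \<bar>E t - E r\<bar> \<le> \<eta>" if r: "r \<ge> 0" and \<eta>: "\<eta> > 0" for r \<eta>
  proof -
    have "r \<in> {0..}" using r by simp
    then obtain d where d: "d > 0" "\<And>t. t \<in> {0..} \<Longrightarrow> dist t r < d \<Longrightarrow> dist (E t) (E r) < \<eta>"
      using E \<eta> unfolding continuous_on_iff by blast
    have "\<bar>E t - E r\<bar> \<le> \<eta>" if "t \<in> {r..r+d/2}" for t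
      using d(2)[of t] that r d(1) by (simp add: dist_real_def)
    then show ?thesis using d(1) by (intro exI[of _ "d/2"]) auto
  qed
  \<comment> \<open>A cut-off width at which all the error terms are below \<open>\<eta>\<close>.\<close>
  have small: "\<exists>d>0. d \<le> 1 \<and> q + d \<le> s + \<delta> \<and> L / real n * d \<le> \<eta> \<and>
      (\<forall>t\<in>{s..s+d}. \<bar>E t - E s\<bar> \<le> \<eta>) \<and> (\<forall>t\<in>{q..q+d}. \<bar>E t - E q\<bar> \<le> \<eta>)" if \<eta>: "\<eta> > 0" for \<eta>
  proof -
    obtain d1 where d1: "d1 > 0" "\<forall>t\<in>{s..s+d1}. \<bar>E t - E s\<bar> \<le> \<eta>" using near[OF s \<eta>] by blast
    have "q \<ge> 0" using s q by simp
    then obtain d2 where d2: "d2 > 0" "\<forall>t\<in>{q..q+d2}. \<bar>E t - E q\<bar> \<le> \<eta>" using near[OF _ \<eta>] by blast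
    \<comment> \<open>The first bound makes the plateau equal to one at time zero in the second estimate.\<close>
    define d where "d = Min {1, s + \<delta> - q, \<eta> / (L / real n + 1), d1, d2}"
    have d: "d \<le> 1" "d \<le> s + \<delta> - q" "d \<le> \<eta> / (L / real n + 1)" "d \<le> d1" "d \<le> d2"
      unfolding d_def by simp_all
    have "d > 0" unfolding d_def using q \<eta> d1(1) d2(1) Ln by (auto intro!: divide_pos_pos)
    have "(L / real n + 1) * d \<le> \<eta>" using d(3) Ln by (simp add: pos_le_divide_eq mult.commute)
    then have "L / real n * d \<le> \<eta>" using \<open>d > 0\<close> unfolding distrib_right by linarith
    then show ?thesis using \<open>d > 0\<close> d d1(2) d2(2) by (intro exI[of _ d]) auto
  qed
  note avg = mollified_average[OF _ _ E]
  show "E q \<le> E s + L / real n * (q - s)"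
  proof (rule field_le_epsilon)
    fix \<eta> :: real assume "\<eta> > 0"
    then have "\<eta> / 3 > 0" by simp
    then obtain d where d: "d > 0" "q + d \<le> s + \<delta>" "L / real n * d \<le> \<eta> / 3"
        "\<And>t. t \<in> {s..s+d} \<Longrightarrow> \<bar>E t - E s\<bar> \<le> \<eta> / 3" "\<And>t. t \<in> {q..q+d} \<Longrightarrow> \<bar>E t - E q\<bar> \<le> \<eta> / 3"
      using small by blast
    have q0: "0 \<le> q" using s q by simp
    note As = avg[OF d(1) s d(4)] and Aq = avg[OF d(1) q0 d(5)]
    let ?A = "LBINT t. indicator {0..} t * (mollifier d s t * E t)"
    let ?B = "LBINT t. indicator {0..} t * (mollifier d q t * E t)"
    have "0 \<le> (LBINT t. indicator {0..} t * ((mollifier d s t - mollifier d q t) * E t))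
      + L / real n * (q + d - max 0 s) + plateau d s q 0 * energy \<epsilon> n X (cutoff M R T) u0 0"
      unfolding E_def
      by (rule weak_energy_inequality[OF n eps X d(1) _ q0 e \<beta> stick sorted]) (use q d(2) s in auto)
    moreover have "(LBINT t. indicator {0..} t * ((mollifier d s t - mollifier d q t) * E t))
        = ?A - ?B"
      using As(1) Aq(1) by (simp add: left_diff_distrib right_diff_distrib)
    moreover have "plateau d s q 0 = 0" using s q by (intro plateau_outside[OF d(1)]) auto
    moreover have "max 0 s = s" using s by simp
    ultimately have "0 \<le> ?A - ?B + L / real n * (q + d - s)" by (simp only: mult_zero_left add_0_right)
    moreover have "?A - E s \<le> \<eta> / 3" "- (?B - E q) \<le> \<eta> / 3" using As(2) Aq(2) by (simp_all only: abs_le_iff)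
    moreover have "L / real n * (q + d - s) = L / real n * (q - s) + L / real n * d"
      by (simp add: algebra_simps add_divide_distrib diff_divide_distrib)
    ultimately show "E q \<le> E s + L / real n * (q - s) + \<eta>" using d(3) by linarith
  qed
  show "E q \<le> energy \<epsilon> n X (cutoff M R T) u0 0 + L / real n * q" if s0: "s = 0"
  proof (rule field_le_epsilon)
    fix \<eta> :: real assume "\<eta> > 0"
    then have "\<eta> / 2 > 0" by simp
    then obtain d where d: "d > 0" "d \<le> 1" "q + d \<le> s + \<delta>" "L / real n * d \<le> \<eta> / 2"
        "\<And>t. t \<in> {q..q+d} \<Longrightarrow> \<bar>E t - E q\<bar> \<le> \<eta> / 2"
      using small by blast
    have q0: "0 \<le> q" using s q by simp
    note Aq = avg[OF d(1) q0 d(5)]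
    let ?B = "LBINT t. indicator {0..} t * (mollifier d q t * E t)"
    \<comment> \<open>The plateau has risen to one before time zero, as the cut-off width is at most one.\<close>
    have "0 \<le> (LBINT t. indicator {0..} t * ((mollifier d (-2) t - mollifier d q t) * E t))
      + L / real n * (q + d - max 0 (-2)) + plateau d (-2) q 0 * energy \<epsilon> n X (cutoff M R T) u0 0"
      unfolding E_def
      by (rule weak_energy_inequality[OF n eps X d(1) _ q0 e \<beta> stick sorted]) (use q0 d(3) s0 in auto)
    moreover have "(LBINT t. indicator {0..} t * ((mollifier d (-2) t - mollifier d q t) * E t)) = - ?B"
    proof -
      have "indicator {0..} t * ((mollifier d (-2) t - mollifier d q t) * E t)
          = - (indicator {0..} t * (mollifier d q t * E t))" for t
        using mollifier_outside[OF d(1), of t "-2"] d(2) by (cases "t \<ge> 0") auto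
      then show ?thesis by simp
    qed
    moreover have "max 0 (-2) = (0 :: real)" by simp
    moreover have "plateau d (-2) q 0 = 1"
    proof -
      have "1 \<le> 2 / d" "(0 - q) / d \<le> 0" using d q0 by (auto simp: pos_le_divide_eq divide_le_0_iff)
      then show ?thesis by (simp add: plateau_def step_ge_1 step_le_0)
    qed
    ultimately have "0 \<le> - ?B + L / real n * (q + d) + energy \<epsilon> n X (cutoff M R T) u0 0"
      by (simp only: mult_1_left diff_0_right)
    moreover have "- (?B - E q) \<le> \<eta> / 2" using Aq(2) by (simp_all only: abs_le_iff)
    moreover have "L / real n * (q + d) = L / real n * q + L / real n * d" by (rule distrib_left)
    ultimately show "E q \<le> energy \<epsilon> n X (cutoff M R T) u0 0 + L / real n * q + \<eta>"
      using d(4) by linarith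
  qed
qed

text \<open>The local estimates hold to the right of every time, and the energy is continuous, so they chain together.
  The value at time zero is compared with the given initial datum by letting time tend to zero.\<close>

lemma energy_decay:
  assumes n: "n \<ge> 1" and eps: "\<epsilon> > 0" and X: "sticky_motion \<Lambda> n X" and t: "t \<ge> 0"
  shows "energy \<epsilon> n X (cutoff M R T) (u t) t \<le> energy \<epsilon> n X (cutoff M R T) u0 0 + L / real n * t"
proof -
  let ?E = "\<lambda>t. energy \<epsilon> n X (cutoff M R T) (u t) t"
  let ?init = "energy \<epsilon> n X (cutoff M R T) u0 0"
  have loc: "L1_loc_continuous u" using sol by (simp add: entropy_solution_def)
  have E: "continuous_on {0..} ?E"
    by (rule energy_continuous[OF eps M _ loc u_measurable u_range]) (use X in \<open>auto simp: sticky_motion_def\<close>)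
  have local: "\<exists>\<delta>>0. \<forall>q\<in>{s<..<s+\<delta>}. ?E q \<le> ?E s + L / real n * (q - s) \<and> (s = 0 \<longrightarrow> ?E q \<le> ?init + L / real n * q)"
    if s: "s \<ge> 0" for s
  proof -
    from X s obtain \<delta> \<alpha> \<beta> e where \<delta>: "\<delta> > 0" and am: "affine_motion \<Lambda> n X {s..s+\<delta>} \<alpha> \<beta> e"
      unfolding sticky_motion_def by blast
    have aff: "X k t = \<alpha> k + \<beta> k * t" if "t \<in> {s..s+\<delta>}" "k \<in> {1..n}" for t k
      using am that unfolding affine_motion_def by blast
    have \<beta>: "\<beta> k = real n * (\<Lambda> (real k / real n) - \<Lambda> (real (k - 1) / real n)) + e k - e (k - 1)" if "k \<in> {1..n}" for k
      using am that unfolding affine_motion_def by blast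
    have e: "e 0 = 0" "e n = 0" "k \<le> n \<Longrightarrow> e k \<le> 0" for k
      using am unfolding affine_motion_def by blast+
    have stick: "\<alpha> k = \<alpha> (Suc k) \<and> \<beta> k = \<beta> (Suc k)" if "1 \<le> k" "k < n" "e k \<noteq> 0" for k
      using am that unfolding affine_motion_def by blast
    define Y where "Y k t = \<alpha> k + \<beta> k * t" for k t
    have sorted: "Y k t \<le> Y (Suc k) t" if "t \<in> {s..s+\<delta>}" "1 \<le> k" "k < n" for k t
    proof -
      have "X k t \<le> X (Suc k) t" using X that by (simp add: sticky_motion_def)
      then show ?thesis using aff[OF that(1), of k] aff[OF that(1), of "Suc k"] that by (simp add: Y_def)
    qed
    have eq: "energy \<epsilon> n X (cutoff M R T) v t = energy \<epsilon> n Y (cutoff M R T) v t" if "t \<in> {s..s+\<delta>}" for t v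
      by (rule energy_cong) (use aff that in \<open>simp add: Y_def\<close>)
    show ?thesis
    proof (intro exI conjI ballI impI)
      show "\<delta> > 0" by (rule \<delta>)
      fix q assume q: "q \<in> {s<..<s+\<delta>}"
      then have q': "s < q" "q < s + \<delta>" "q \<in> {s..s+\<delta>}" "s \<in> {s..s+\<delta>}" by auto
      show "?E q \<le> ?E s + L / real n * (q - s)"
        unfolding eq[OF q'(3)] eq[OF q'(4)] by (rule energy_local_decay(1)[OF n eps Y_def s q'(1,2) e \<beta> stick sorted])
      assume s0: "s = 0"
      have z: "0 \<in> {s..s+\<delta>}" using s0 \<delta> by simp
      show "?E q \<le> ?init + L / real n * q"
        unfolding eq[OF q'(3)] eq[OF z] by (rule energy_local_decay(2)[OF n eps Y_def s q'(1,2) e \<beta> stick sorted s0])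
    qed
  qed
  have "?E t - L / real n * t \<le> ?E 0 - L / real n * 0"
  proof (rule right_nonincreasing_le[of "\<lambda>t. ?E t - L / real n * t", OF _ _ t])
    show "continuous_on {0..} (\<lambda>t. ?E t - L / real n * t)" by (intro continuous_intros E)
    fix s :: real assume "s \<ge> 0"
    then obtain \<delta> where \<delta>: "\<delta> > 0" "\<And>q. q \<in> {s<..<s+\<delta>} \<Longrightarrow> ?E q \<le> ?E s + L / real n * (q - s)"
      using local[of s] by blast
    then show "\<exists>\<delta>>0. \<forall>q\<in>{s<..<s+\<delta>}. ?E q - L / real n * q \<le> ?E s - L / real n * s"
    proof (intro exI conjI ballI)
      fix q assume "q \<in> {s<..<s+\<delta>}"
      then have "?E q \<le> ?E s + L / real n * (q - s)" by (rule \<delta>(2))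
      moreover have "L / real n * (q - s) = L / real n * q - L / real n * s" by (rule right_diff_distrib)
      ultimately show "?E q - L / real n * q \<le> ?E s - L / real n * s" by linarith
    qed
  qed
  moreover have "?E 0 \<le> ?init"
  proof -
    obtain \<delta> where \<delta>: "\<delta> > 0" "\<And>q. q \<in> {0<..<\<delta>} \<Longrightarrow> ?E q \<le> ?init + L / real n * q"
      using local[of 0] by auto
    have "((\<lambda>q. ?E q - L / real n * q) \<longlongrightarrow> ?E 0 - L / real n * 0) (at 0 within {0..})"
      using E by (intro tendsto_intros) (simp add: continuous_on_def)
    then have "((\<lambda>q. ?E q - L / real n * q) \<longlongrightarrow> ?E 0) (at_right 0)"
    proof -
      assume "((\<lambda>q. ?E q - L / real n * q) \<longlongrightarrow> ?E 0 - L / real n * 0) (at 0 within {0..})"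
      from tendsto_within_subset[OF this, of "{0<..}"] show ?thesis by (simp add: subset_iff)
    qed
    moreover have "eventually (\<lambda>q. ?E q - L / real n * q \<le> ?init) (at_right 0)"
      unfolding eventually_at_right_field
    proof (intro exI conjI allI impI)
      fix q assume "0 < q" "q < \<delta>"
      then have "?E q \<le> ?init + L / real n * q" by (intro \<delta>(2)) simp
      then show "?E q - L / real n * q \<le> ?init" by linarith
    qed (rule \<delta>(1))
    ultimately show ?thesis by (rule tendsto_upperbound) simp
  qed
  ultimately show ?thesis by simp
qed

end

section \<open>Removing the regularisation\<close>

definition particle_cdf :: "nat \<Rightarrow> (nat \<Rightarrow> real) \<Rightarrow> real \<Rightarrow> real" where
  "particle_cdf n y x = real (card {k \<in> {1..n}. y k \<le> x}) / real n"

lemma particle_cdf_measurable: "particle_cdf n y \<in> borel_measurable borel"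
proof -
  have "particle_cdf n y = (\<lambda>x. (\<Sum>k=1..n. indicator {y k..} x) / real n)"
  proof
    fix x
    have "real (card {k \<in> {1..n}. y k \<le> x}) = (\<Sum>k\<in>{k \<in> {1..n}. y k \<le> x}. 1)" by simp
    also have "\<dots> = (\<Sum>k=1..n. if y k \<le> x then 1 else 0)" by (rule sum.inter_filter) simp
    also have "\<dots> = (\<Sum>k=1..n. indicator {y k..} x)" by (intro sum.cong) (auto simp: indicator_def)
    finally show "particle_cdf n y x = (\<Sum>k=1..n. indicator {y k..} x) / real n" by (simp add: particle_cdf_def)
  qed
  then show ?thesis by simp
qed

lemma down_closed_initial_segment:
  assumes "A \<subseteq> {1..n::nat}" "\<And>k. 1 \<le> k \<Longrightarrow> Suc k \<in> A \<Longrightarrow> k \<in> A"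
  shows "A = {1..card A}"
proof (cases "A = {}")
  case False
  have fin: "finite A" using assms(1) by (rule finite_subset) simp
  have "Max A \<in> A" using fin False by (rule Max_in)
  have down: "k \<in> A" if "1 \<le> k" "k \<le> Max A" for k
    using that(2)
  proof (rule inc_induct)
    show "Max A \<in> A" by fact
    fix i assume i: "k \<le> i" "Suc i \<in> A"
    have "1 \<le> i" using that(1) i(1) by linarith
    then show "i \<in> A" using i(2) by (rule assms(2))
  qed
  have "A = {1..Max A}"
  proof
    show "A \<subseteq> {1..Max A}" using assms(1) fin by auto
    show "{1..Max A} \<subseteq> A" using down by (simp add: subset_iff)
  qed
  then have "card A = card {1..Max A}" by (rule arg_cong)
  then show ?thesis using \<open>A = {1..Max A}\<close> by simp
qed simp

text \<open>Without regularisation the sum has the single nonzero term in which \<open>k / n\<close> is the value of the step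
  function. Smoothing changes a front only within distance \<open>\<epsilon>\<close>, and each front borders two layers.\<close>

lemma discrepancy_approx:
  assumes n: "n \<ge> 1" and eps: "\<epsilon> > 0" and w: "w \<in> {0..1}"
    and sorted: "\<And>k. 1 \<le> k \<Longrightarrow> k < n \<Longrightarrow> X k t \<le> X (Suc k) t"
  shows "\<bar>discrepancy \<epsilon> n X w t x - \<bar>w - particle_cdf n (\<lambda>k. X k t) x\<bar>\<bar>
    \<le> 2 * (\<Sum>k=1..n. indicator {X k t..X k t + \<epsilon>} x)"
proof -
  define A where "A = {k \<in> {1..n}. X k t \<le> x}"
  define K where "K = card A"
  have A: "A = {1..K}" unfolding K_def
  proof (rule down_closed_initial_segment)
    show "A \<subseteq> {1..n}" by (auto simp: A_def)
    fix k assume "1 \<le> k" "Suc k \<in> A"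
    then show "k \<in> A" using sorted[of k] by (auto simp: A_def)
  qed
  have "A \<subseteq> {1..n}" by (auto simp: A_def)
  then have "K \<le> n" using card_mono[of "{1..n}" A] by (simp add: K_def)
  let ?a = "\<lambda>k. \<bar>w - real k / real n\<bar>"
  \<comment> \<open>The unsmoothed fronts at \<open>x\<close>: exactly the first \<open>K\<close> particles are at or to the left of \<open>x\<close>.\<close>
  define g where "g k = (if k \<le> K then 1 else 0 :: real)" for k
  define \<eta> where "\<eta> k = (if k \<in> {1..n} then indicator {X k t..X k t + \<epsilon>} x else 0 :: real)" for k
  have front: "\<bar>front \<epsilon> n X k t x - g k\<bar> \<le> \<eta> k" for k
  proof (cases "k \<in> {1..n}")
    case True
    have "k \<in> A \<longleftrightarrow> X k t \<le> x" using True by (simp add: A_def)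
    moreover have "k \<in> A \<longleftrightarrow> k \<le> K" using True by (subst A) simp
    ultimately have gk: "g k = (if X k t \<le> x then 1 else 0)" by (simp add: g_def)
    consider "x < X k t" | "X k t + \<epsilon> < x" | "x \<in> {X k t..X k t + \<epsilon>}" by fastforce
    then show ?thesis
    proof cases
      case 1
      then have "(x - X k t) / \<epsilon> \<le> 0" using eps by (simp add: divide_le_0_iff)
      then show ?thesis using True 1 gk by (simp add: front_def \<eta>_def step_le_0)
    next
      case 2
      then have "1 \<le> (x - X k t) / \<epsilon>" using eps by (simp add: pos_le_divide_eq)
      then show ?thesis using True 2 gk eps by (simp add: front_def \<eta>_def step_ge_1)
    next
      case 3
      then show ?thesis using True gk step_range[of "(x - X k t) / \<epsilon>"] by (simp add: front_def \<eta>_def)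
    qed
  next
    case False
    then show ?thesis using \<open>K \<le> n\<close> by (auto simp: front_def g_def \<eta>_def)
  qed
  have "(\<Sum>k\<le>n. ?a k * (g k - g (Suc k))) = (\<Sum>k\<le>n. if k = K then ?a k else 0)"
    by (intro sum.cong refl) (auto simp: g_def)
  also have "\<dots> = \<bar>w - particle_cdf n (\<lambda>k. X k t) x\<bar>"
    using \<open>K \<le> n\<close> by (simp add: particle_cdf_def K_def A_def)
  finally have sharp: "\<bar>w - particle_cdf n (\<lambda>k. X k t) x\<bar> = (\<Sum>k\<le>n. ?a k * (g k - g (Suc k)))" by simp
  have "\<bar>discrepancy \<epsilon> n X w t x - \<bar>w - particle_cdf n (\<lambda>k. X k t) x\<bar>\<bar>
      = \<bar>\<Sum>k\<le>n. ?a k * ((front \<epsilon> n X k t x - g k) - (front \<epsilon> n X (Suc k) t x - g (Suc k)))\<bar>"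
    unfolding sharp discrepancy_def layer_def sum_subtractf[symmetric]
    by (intro arg_cong[where f=abs] sum.cong refl) (simp add: algebra_simps)
  also have "\<dots> \<le> (\<Sum>k\<le>n. \<bar>?a k * ((front \<epsilon> n X k t x - g k) - (front \<epsilon> n X (Suc k) t x - g (Suc k)))\<bar>)"
    by (rule sum_abs)
  also have "\<dots> \<le> (\<Sum>k\<le>n. 1 * (\<eta> k + \<eta> (Suc k)))"
    unfolding abs_mult
  proof (intro sum_mono mult_mono)
    fix k assume "k \<in> {..n}"
    show "\<bar>?a k\<bar> \<le> 1" using abs_diff_grid_le[OF w, of k n] \<open>k \<in> {..n}\<close> by simp
    show "\<bar>(front \<epsilon> n X k t x - g k) - (front \<epsilon> n X (Suc k) t x - g (Suc k))\<bar> \<le> \<eta> k + \<eta> (Suc k)"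
      using front[of k] front[of "Suc k"] by linarith
  qed auto
  also have "\<dots> = (\<Sum>k\<le>n. \<eta> k) + (\<Sum>k\<le>n. \<eta> (Suc k))" by (simp add: sum.distrib)
  also have "(\<Sum>k\<le>n. \<eta> k) = (\<Sum>k=1..n. \<eta> k)"
    by (rule sum.mono_neutral_right) (auto simp: \<eta>_def)
  also have "(\<Sum>k\<le>n. \<eta> (Suc k)) = (\<Sum>k=1..n. \<eta> k)"
  proof -
    have "(\<Sum>k\<le>n. \<eta> (Suc k)) = (\<Sum>k<Suc n. \<eta> (Suc k))" by (simp only: lessThan_Suc_atMost)
    also have "\<dots> = (\<Sum>k=1..Suc n. \<eta> k)" unfolding One_nat_def by (rule sum.atLeast1_atMost_eq[symmetric])
    also have "\<dots> = (\<Sum>k=1..n. \<eta> k)" by (simp add: \<eta>_def)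
    finally show ?thesis .
  qed
  also have "(\<Sum>k=1..n. \<eta> k) = (\<Sum>k=1..n. indicator {X k t..X k t + \<epsilon>} x)"
    by (intro sum.cong refl) (simp add: \<eta>_def)
  finally show ?thesis by simp
qed

lemma nn_integral_transition_layers:
  assumes "\<epsilon> > 0"
  shows "(\<integral>\<^sup>+x. ennreal (2 * (\<Sum>k=1..n. indicator {y k..y k + \<epsilon>} x)) \<partial>lborel) = ennreal (2 * real n * \<epsilon>)"
proof -
  have "(\<integral>\<^sup>+x. ennreal (2 * (\<Sum>k=1..n. indicator {y k..y k + \<epsilon>} x)) \<partial>lborel)
      = (\<integral>\<^sup>+x. 2 * (\<Sum>k=1..n. indicator {y k..y k + \<epsilon>} x) \<partial>lborel)"
    by (intro nn_integral_cong)
      (simp add: ennreal_mult sum_nonneg sum_ennreal[symmetric] ennreal_indicator del: sum_ennreal)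
  also have "\<dots> = 2 * (\<Sum>k=1..n. emeasure lborel {y k..y k + \<epsilon>})"
    by (simp add: nn_integral_cmult nn_integral_sum)
  also have "\<dots> = ennreal (2 * real n * \<epsilon>)"
    using assms by (simp add: ennreal_mult ennreal_of_nat_eq_real_of_nat mult.assoc)
  finally show ?thesis .
qed

lemma L1_dist_le_if_local:
  assumes f: "f \<in> borel_measurable borel" and g: "g \<in> borel_measurable borel"
    and le: "\<And>R. R \<ge> 0 \<Longrightarrow> (\<integral>\<^sup>+x. ennreal \<bar>f x - g x\<bar> * indicator {-R..R} x \<partial>lborel) \<le> B"
  shows "L1_dist f g \<le> B"
proof -
  let ?h = "\<lambda>i::nat. \<lambda>x. ennreal \<bar>f x - g x\<bar> * indicator {- real i..real i} x"
  have sup: "(SUP i. ?h i x) = ennreal \<bar>f x - g x\<bar>" for x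
  proof (rule antisym)
    show "(SUP i. ?h i x) \<le> ennreal \<bar>f x - g x\<bar>"
      by (rule SUP_least) (auto simp: indicator_def)
    obtain i :: nat where "\<bar>x\<bar> \<le> real i" using real_arch_simple by blast
    then have "x \<in> {- real i..real i}" by (simp add: abs_le_iff)
    then have "ennreal \<bar>f x - g x\<bar> = ?h i x" by simp
    also have "\<dots> \<le> (SUP i. ?h i x)" by (rule SUP_upper) (rule UNIV_I)
    finally show "ennreal \<bar>f x - g x\<bar> \<le> (SUP i. ?h i x)" .
  qed
  have "L1_dist f g = (\<integral>\<^sup>+x. (SUP i. ?h i x) \<partial>lborel)" by (simp add: L1_dist_def sup)
  also have "\<dots> = (SUP i. \<integral>\<^sup>+x. ?h i x \<partial>lborel)"
  proof (rule nn_integral_monotone_convergence_SUP)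
    show "incseq ?h"
      by (auto simp: incseq_def le_fun_def indicator_def)
    show "?h i \<in> borel_measurable lborel" for i using f g by measurable
  qed
  also have "\<dots> \<le> B" by (rule SUP_least) (use le in auto)
  finally show ?thesis .
qed

context entropy_comparison
begin

text \<open>In the limit of vanishing regularisation and growing cones, the decay of the energy becomes stability in
  \<open>L\<^sup>1\<close>. The argument works on bounded intervals first, since the distance of the initial data may be
  infinite.\<close>

theorem L1_stability:
  assumes n: "n \<ge> 1" and X: "sticky_motion \<Lambda> n X" and t: "t \<ge> 0"
  shows "L1_dist (u t) (particle_cdf n (\<lambda>k. X k t))
    \<le> L1_dist u0 (particle_cdf n (\<lambda>k. X k 0)) + ennreal (t * L / real n)"
proof (rule ennreal_le_epsilon)
  fix \<eta> :: real assume "\<eta> > 0"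
  \<comment> \<open>Smoothing costs \<open>2 n \<epsilon>\<close> at time zero and again at time \<open>t\<close>.\<close>
  define \<epsilon> where "\<epsilon> = \<eta> / (4 * real n)"
  have eps: "\<epsilon> > 0" using \<open>\<eta> > 0\<close> n by (simp add: \<epsilon>_def)
  have four: "2 * real n * \<epsilon> + 2 * real n * \<epsilon> = \<eta>" using n by (simp add: \<epsilon>_def)
  let ?v = "\<lambda>t. particle_cdf n (\<lambda>k. X k t)"
  let ?N = "\<lambda>t x. 2 * (\<Sum>k=1..n. indicator {X k t..X k t + \<epsilon>} x) :: real"
  have sorted: "X k s \<le> X (Suc k) s" if "1 \<le> k" "k < n" for k s
    using X that by (simp add: sticky_motion_def)
  have N0: "0 \<le> ?N s x" for s x by (intro mult_nonneg_nonneg sum_nonneg) auto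
  have Nm: "(\<lambda>x. ennreal (?N s x)) \<in> borel_measurable lborel" for s by measurable
  have disc0: "0 \<le> discrepancy \<epsilon> n X w s x" for w s x
    unfolding discrepancy_def by (intro sum_nonneg mult_nonneg_nonneg layer_nonneg[OF eps] sorted) auto
  have approx: "\<bar>discrepancy \<epsilon> n X w s x - \<bar>w - ?v s x\<bar>\<bar> \<le> ?N s x" if "w \<in> {0..1}" for w s x
    by (rule discrepancy_approx[where X=X and t=s, OF n eps that sorted])
  have addN: "(\<integral>\<^sup>+x. f x + ennreal (?N s x) \<partial>lborel) = (\<integral>\<^sup>+x. f x \<partial>lborel) + ennreal (2 * real n * \<epsilon>)"
    if "f \<in> borel_measurable lborel" for f s
    unfolding nn_integral_transition_layers[where n=n and y="\<lambda>k. X k s", OF eps, symmetric]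
    by (rule nn_integral_add[OF that Nm])
  have L: "L \<ge> 0" using lip by (rule lipschitz_on_nonneg)
  show "L1_dist (u t) (?v t) \<le> L1_dist u0 (?v 0) + ennreal (t * L / real n) + ennreal \<eta>"
  proof (rule L1_dist_le_if_local[OF u_measurable[OF t] particle_cdf_measurable])
    fix R :: real assume "R \<ge> 0"
    let ?C = "cutoff M R t"
    let ?E = "energy \<epsilon> n X ?C (u t) t" and ?init = "energy \<epsilon> n X ?C u0 0"
    have C1: "?C t x = 1" if "x \<in> {-R..R}" for x
      using that by (simp add: cutoff_def step_ge_1)
    have intE: "integrable lborel (\<lambda>x. ?C t x * discrepancy \<epsilon> n X (u t x) t x)"
      by (rule energy_integrable[OF eps u_measurable[OF t] u_range[OF t]])
    have int0: "integrable lborel (\<lambda>x. ?C 0 x * discrepancy \<epsilon> n X (u0 x) 0 x)"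
      by (rule energy_integrable[OF eps u0])
    have E_nn: "(\<integral>\<^sup>+x. ennreal (?C t x * discrepancy \<epsilon> n X (u t x) t x) \<partial>lborel) = ennreal ?E"
      unfolding energy_def using disc0 cutoff_range
      by (intro nn_integral_eq_integral[OF intE] AE_I2 mult_nonneg_nonneg)
    have E0_nn: "(\<integral>\<^sup>+x. ennreal (?C 0 x * discrepancy \<epsilon> n X (u0 x) 0 x) \<partial>lborel) = ennreal ?init"
      unfolding energy_def using disc0 cutoff_range
      by (intro nn_integral_eq_integral[OF int0] AE_I2 mult_nonneg_nonneg)
    have init0: "0 \<le> ?init"
      unfolding energy_def using disc0 cutoff_range by (intro integral_nonneg_AE AE_I2 mult_nonneg_nonneg)
    have "(\<integral>\<^sup>+x. ennreal \<bar>u t x - ?v t x\<bar> * indicator {-R..R} x \<partial>lborel)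
        \<le> (\<integral>\<^sup>+x. ennreal (?C t x * discrepancy \<epsilon> n X (u t x) t x) + ennreal (?N t x) \<partial>lborel)"
    proof (rule nn_integral_mono)
      fix x
      show "ennreal \<bar>u t x - ?v t x\<bar> * indicator {-R..R} x
        \<le> ennreal (?C t x * discrepancy \<epsilon> n X (u t x) t x) + ennreal (?N t x)"
      proof (cases "x \<in> {-R..R}")
        case True
        have "\<bar>u t x - ?v t x\<bar> \<le> discrepancy \<epsilon> n X (u t x) t x + ?N t x"
          using approx[OF u_range[OF t, of x], of t x] by linarith
        then have "ennreal \<bar>u t x - ?v t x\<bar> \<le> ennreal (discrepancy \<epsilon> n X (u t x) t x + ?N t x)"
          by (rule ennreal_leI)
        then show ?thesis using True C1[OF True] disc0 N0 by (simp add: ennreal_plus del: ennreal_plus[symmetric])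
      qed simp
    qed
    also have "\<dots> = ennreal ?E + ennreal (2 * real n * \<epsilon>)"
      using intE by (subst addN) (simp_all add: E_nn)
    also have "ennreal ?E \<le> ennreal (?init + L / real n * t)"
      by (rule ennreal_leI) (rule energy_decay[OF n eps X t])
    also have "\<dots> = ennreal ?init + ennreal (t * L / real n)"
      using init0 L t by (simp add: ennreal_plus mult.commute)
    also have "ennreal ?init \<le> (\<integral>\<^sup>+x. ennreal \<bar>u0 x - ?v 0 x\<bar> + ennreal (?N 0 x) \<partial>lborel)"
      unfolding E0_nn[symmetric]
    proof (rule nn_integral_mono)
      fix x
      have "?C 0 x * discrepancy \<epsilon> n X (u0 x) 0 x \<le> 1 * discrepancy \<epsilon> n X (u0 x) 0 x"
        using disc0 cutoff_range by (intro mult_right_mono)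
      also have "\<dots> \<le> \<bar>u0 x - ?v 0 x\<bar> + ?N 0 x"
        using approx[OF u0(2)[of x], of 0 x] by linarith
      finally have "ennreal (?C 0 x * discrepancy \<epsilon> n X (u0 x) 0 x) \<le> ennreal (\<bar>u0 x - ?v 0 x\<bar> + ?N 0 x)"
        by (rule ennreal_leI)
      then show "ennreal (?C 0 x * discrepancy \<epsilon> n X (u0 x) 0 x) \<le> ennreal \<bar>u0 x - ?v 0 x\<bar> + ennreal (?N 0 x)"
        using N0 by (simp add: ennreal_plus)
    qed
    also have "\<dots> = L1_dist u0 (?v 0) + ennreal (2 * real n * \<epsilon>)"
      using u0(1) particle_cdf_measurable[of n "\<lambda>k. X k 0"]
      by (subst addN) (simp_all add: L1_dist_def)
    finally have "(\<integral>\<^sup>+x. ennreal \<bar>u t x - ?v t x\<bar> * indicator {-R..R} x \<partial>lborel)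
        \<le> L1_dist u0 (?v 0) + ennreal (2 * real n * \<epsilon>) + ennreal (t * L / real n) + ennreal (2 * real n * \<epsilon>)"
      by (simp add: add_mono)
    also have "\<dots> = L1_dist u0 (?v 0) + ennreal (t * L / real n) + (ennreal (2 * real n * \<epsilon>) + ennreal (2 * real n * \<epsilon>))"
      by (simp only: ac_simps)
    also have "ennreal (2 * real n * \<epsilon>) + ennreal (2 * real n * \<epsilon>) = ennreal \<eta>"
      unfolding four[symmetric] using eps by (intro ennreal_plus[symmetric]) auto
    finally show "(\<integral>\<^sup>+x. ennreal \<bar>u t x - ?v t x\<bar> * indicator {-R..R} x \<partial>lborel)
        \<le> L1_dist u0 (?v 0) + ennreal (t * L / real n) + ennreal \<eta>" .
  qed
qed

end

section \<open>Distances at time zero\<close>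

lemma real_line_indicator_distance:
  fixes a b :: real
  shows "(\<integral>\<^sup>+x. ennreal \<bar>indicator {..x} a - indicator {..x} b\<bar> \<partial>lborel) = ennreal \<bar>a - b\<bar>"
proof -
  have "(\<integral>\<^sup>+x. ennreal \<bar>indicator {..x} a - indicator {..x} b\<bar> \<partial>lborel)
      = (\<integral>\<^sup>+x. indicator {min a b..<max a b} x \<partial>lborel)"
    by (intro nn_integral_cong) (auto simp: indicator_def min_def max_def)
  also have "\<dots> = ennreal (max a b - min a b)" by (simp add: min_le_iff_disj)
  also have "max a b - min a b = \<bar>a - b\<bar>" by (simp add: max_def min_def)
  finally show ?thesis .
qed

text \<open>For any coupling, the difference of the distribution functions at \<open>x\<close> is the expected difference of two
  indicators; integrating over \<open>x\<close> first turns the indicators into the transport cost.\<close>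

lemma L1_dist_cdf_le_W1: "L1_dist (cdf m) (cdf m') \<le> W1 m m'"
  unfolding W1_def
proof (rule INF_greatest)
  fix \<pi> assume "\<pi> \<in> couplings m m'"
  then have p: "prob_space \<pi>" and sets: "sets \<pi> = sets borel"
    and m: "m = distr \<pi> borel fst" "m' = distr \<pi> borel snd" by (auto simp: couplings_def)
  interpret prob_space \<pi> by (rule p)
  interpret pair_sigma_finite \<pi> lborel ..
  have sp: "space \<pi> = UNIV" using sets_eq_imp_space_eq[OF sets] by simp
  have fs: "fst \<in> borel_measurable \<pi>" "snd \<in> borel_measurable \<pi>"
    unfolding measurable_cong_sets[OF sets refl]
    by (auto intro!: borel_measurable_continuous_onI continuous_intros)
  let ?d = "\<lambda>q x. indicator {..x} (fst q) - indicator {..x} (snd q) :: real"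
  have le: "ennreal \<bar>cdf m x - cdf m' x\<bar> \<le> (\<integral>\<^sup>+q. ennreal \<bar>?d q x\<bar> \<partial>\<pi>)" for x
  proof -
    have i: "integrable \<pi> (\<lambda>q. indicator {..x} (fst q) :: real)" "integrable \<pi> (\<lambda>q. indicator {..x} (snd q) :: real)"
      using fs by (auto intro!: integrable_const_bound[where B=1])
    have "cdf m x = (LINT q|\<pi>. indicator {..x} (fst q))" "cdf m' x = (LINT q|\<pi>. indicator {..x} (snd q))"
      unfolding cdf_def m using fs
      by (simp_all add: measure_distr sp indicator_vimage[symmetric] vimage_def comp_def)
    then have "cdf m x - cdf m' x = (LINT q|\<pi>. ?d q x)" using i by simp
    then show ?thesis using integral_norm_bound_ennreal[of \<pi> "\<lambda>q. ?d q x"] i by simp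
  qed
  have "L1_dist (cdf m) (cdf m') \<le> (\<integral>\<^sup>+x. \<integral>\<^sup>+q. ennreal \<bar>?d q x\<bar> \<partial>\<pi> \<partial>lborel)"
    unfolding L1_dist_def by (intro nn_integral_mono le)
  also have "\<dots> = (\<integral>\<^sup>+q. \<integral>\<^sup>+x. ennreal \<bar>?d q x\<bar> \<partial>lborel \<partial>\<pi>)"
  proof (rule Fubini')
    have "Measurable.pred (\<pi> \<Otimes>\<^sub>M lborel) (\<lambda>z. fst (fst z) \<le> snd z)" "Measurable.pred (\<pi> \<Otimes>\<^sub>M lborel) (\<lambda>z. snd (fst z) \<le> snd z)"
      using fs by measurable
    then show "(\<lambda>(q, x). ennreal \<bar>?d q x\<bar>) \<in> borel_measurable (\<pi> \<Otimes>\<^sub>M lborel)"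
      unfolding indicator_def case_prod_beta atMost_iff of_bool_def by measurable
  qed
  also have "\<dots> = (\<integral>\<^sup>+q. ennreal \<bar>fst q - snd q\<bar> \<partial>\<pi>)"
    by (simp only: real_line_indicator_distance)
  finally show "L1_dist (cdf m) (cdf m') \<le> (\<integral>\<^sup>+q. ennreal \<bar>fst q - snd q\<bar> \<partial>\<pi>)" .
qed

lemma cdf_empirical_measure:
  assumes "n \<ge> 1" shows "cdf (empirical_measure n y) = particle_cdf n y"
proof
  fix x
  have "measure (distr (uniform_count_measure {1..n}) borel y) {..x}
      = measure (uniform_count_measure {1..n}) (y -` {..x} \<inter> space (uniform_count_measure {1..n}))"
    by (rule measure_distr) (auto simp: measurable_def space_uniform_count_measure sets_uniform_count_measure)
  also have "y -` {..x} \<inter> space (uniform_count_measure {1..n}) = {k \<in> {1..n}. y k \<le> x}"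
    by (auto simp: space_uniform_count_measure)
  also have "measure (uniform_count_measure {1..n}) {k \<in> {1..n}. y k \<le> x} = particle_cdf n y x"
    by (subst measure_uniform_count_measure) (auto simp: particle_cdf_def)
  finally show "cdf (empirical_measure n y) x = particle_cdf n y x"
    by (simp add: cdf_def empirical_measure_def)
qed

text \<open>The count is the integer nearest to \<open>n y\<close>, halves being rounded up.\<close>

lemma midpoint_count:
  assumes n: "n \<ge> 1" and y: "0 \<le> y" "y \<le> 1"
  shows "\<bar>y - real (card {k \<in> {1..n}. (2 * real k - 1) / (2 * real n) \<le> y}) / real n\<bar> \<le> 1 / (2 * real n)"
proof -
  \<comment> \<open>The level \<open>(2 k - 1) / (2 n)\<close> is at most \<open>y\<close> exactly if \<open>k\<close> is at most \<open>z\<close>.\<close>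
  define z where "z = real n * y + 1 / 2"
  define N where "N = nat \<lfloor>z\<rfloor>"
  have n0: "real n > 0" using n by simp
  have "0 \<le> real n * y" "real n * y \<le> real n" using y n0 by (simp_all add: mult_left_le)
  then have z: "0 \<le> z" "z < real n + 1" by (simp_all add: z_def)
  have N: "real N \<le> z" "z < real N + 1" using z(1) by (simp_all add: N_def) 
  have "N \<le> n" using N z by linarith
  have iff: "(2 * real k - 1) / (2 * real n) \<le> y \<longleftrightarrow> k \<le> N" for k
  proof -
    have "(2 * real k - 1) / (2 * real n) \<le> y \<longleftrightarrow> real k \<le> z"
      using n0 by (simp add: pos_divide_le_eq z_def field_simps)
    also have "\<dots> \<longleftrightarrow> k \<le> N" using N by linarith
    finally show ?thesis .
  qed
  have "{k \<in> {1..n}. (2 * real k - 1) / (2 * real n) \<le> y} = {1..N}"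
    unfolding iff using \<open>N \<le> n\<close> by auto
  then have card: "card {k \<in> {1..n}. (2 * real k - 1) / (2 * real n) \<le> y} = N" by simp
  have "\<bar>real n * y - real N\<bar> \<le> 1 / 2" using N unfolding z_def by linarith
  moreover have "y - real N / real n = (real n * y - real N) / real n" using n0 by (simp add: field_simps)
  ultimately show ?thesis unfolding card using n0 by (simp add: divide_right_mono[of _ "1/2" "real n", simplified])
qed

context
  fixes m :: "real measure"
  assumes m: "real_distribution m"
begin

interpretation cdf_distribution m
  using m by (simp add: cdf_distribution_def)

lemma cdf_inverse_le_iff:
  assumes "0 < v" "v < 1" shows "cdf_inverse (cdf m) v \<le> x \<longleftrightarrow> v \<le> cdf m x"
  using pseudoinverse[OF assms, of x] by (simp add: cdf_inverse_def)

lemma cdf_inverse_mono: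
  assumes "0 < v" "v \<le> w" "w < 1" shows "cdf_inverse (cdf m) v \<le> cdf_inverse (cdf m) w"
proof -
  have "w \<le> cdf m (cdf_inverse (cdf m) w)" 
    using cdf_inverse_le_iff[of w "cdf_inverse (cdf m) w"] assms by linarith
  then show ?thesis
    using cdf_inverse_le_iff[of v "cdf_inverse (cdf m) w"] assms by linarith
qed

lemma midpoint_level: "k \<in> {1..n} \<Longrightarrow> 0 < (2 * real k - 1) / (2 * real n)"
  "k \<in> {1..n} \<Longrightarrow> (2 * real k - 1) / (2 * real n) < 1"
  by (auto simp: field_simps)

lemma midpoint_quantiles_sorted:
  assumes x: "\<forall>k\<in>{1..n}. x k = cdf_inverse (cdf m) ((2 * real k - 1) / (2 * real n))"
  shows "x \<in> D n"
  unfolding D_def mono_on_def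
proof (intro CollectI allI impI)
  fix i j assume ij: "i \<in> {1..n} \<and> j \<in> {1..n} \<and> i \<le> j"
  then have "(2 * real i - 1) / (2 * real n) \<le> (2 * real j - 1) / (2 * real n)"
    by (intro divide_right_mono) auto
  then have "cdf_inverse (cdf m) ((2 * real i - 1) / (2 * real n)) \<le> cdf_inverse (cdf m) ((2 * real j - 1) / (2 * real n))"
    using ij by (intro cdf_inverse_mono midpoint_level) auto
  then show "x i \<le> x j" using x ij by simp
qed

text \<open>By the Galois connection between a distribution function and its generalised inverse, the particle
  distribution function is the rounding of \<open>cdf m\<close> to the grid of multiples of \<open>1/n\<close>. Both agree outside
  \<open>[a, b]\<close>.\<close>

lemma midpoint_quantiles_L1:
  assumes n: "n \<ge> 1" and ab: "a < b" "measure m {a..b} = 1"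
    and x: "\<forall>k\<in>{1..n}. x k = cdf_inverse (cdf m) ((2 * real k - 1) / (2 * real n))"
  shows "L1_dist (cdf m) (particle_cdf n x) \<le> ennreal ((b - a) / (2 * real n))"
proof -
  let ?c = "1 / (2 * real n)"
  have pc: "particle_cdf n x y = real (card {k \<in> {1..n}. (2 * real k - 1) / (2 * real n) \<le> cdf m y}) / real n" for y
  proof -
    have "{k \<in> {1..n}. x k \<le> y} = {k \<in> {1..n}. (2 * real k - 1) / (2 * real n) \<le> cdf m y}"
      using x midpoint_level cdf_inverse_le_iff by auto
    then show ?thesis by (simp add: particle_cdf_def)
  qed
  have F: "0 \<le> cdf m y" "cdf m y \<le> 1" for y
    by (simp_all add: cdf_nonneg cdf_bounded_prob)
  have below: "cdf m y = 0" if "y < a" for y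
  proof -
    have "measure m ({..y} \<union> {a..b}) = measure m {..y} + measure m {a..b}"
      using that by (intro finite_measure_Union) auto
    then show ?thesis
      using ab(2) prob_le_1[of "{..y} \<union> {a..b}"] measure_nonneg[of m "{..y}"] unfolding cdf_def by linarith
  qed
  have above: "cdf m y = 1" if "b \<le> y" for y
  proof -
    have "measure m {a..b} \<le> measure m {..y}" using that by (intro finite_measure_mono) auto
    then show ?thesis using ab(2) F(2)[of y] unfolding cdf_def by linarith
  qed
  have bound: "\<bar>cdf m y - particle_cdf n x y\<bar> \<le> ?c * indicator {a..b} y" for y
  proof -
    consider "y < a" | "y \<in> {a..b}" | "b < y" by fastforce
    then show ?thesis
    proof cases
      case 1
      have "{k \<in> {1..n}. (2 * real k - 1) / (2 * real n) \<le> 0} = {}"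
      proof -
        have "\<not> (2 * real k - 1) / (2 * real n) \<le> 0" if "k \<in> {1..n}" for k
          using midpoint_level(1)[OF that] by linarith
        then show ?thesis by blast
      qed
      then show ?thesis using 1 by (simp only: pc below[OF 1]) simp
    next
      case 2
      then show ?thesis using midpoint_count[OF n F, of y] by (simp add: pc)
    next
      case 3
      have "{k \<in> {1..n}. (2 * real k - 1) / (2 * real n) \<le> 1} = {1..n}"
        using less_imp_le[OF midpoint_level(2)] by blast
      then show ?thesis using 3 n by (simp only: pc above[OF less_imp_le[OF 3]]) simp
    qed
  qed
  have "L1_dist (cdf m) (particle_cdf n x) \<le> (\<integral>\<^sup>+y. ennreal ?c * indicator {a..b} y \<partial>lborel)"
    unfolding L1_dist_def
  proof (rule nn_integral_mono)
    fix y
    have "ennreal \<bar>cdf m y - particle_cdf n x y\<bar> \<le> ennreal (?c * indicator {a..b} y)"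
      by (rule ennreal_leI[OF bound])
    also have "\<dots> = ennreal ?c * indicator {a..b} y" by (cases "y \<in> {a..b}") simp_all
    finally show "ennreal \<bar>cdf m y - particle_cdf n x y\<bar> \<le> ennreal ?c * indicator {a..b} y" .
  qed
  also have "\<dots> = ennreal ?c * ennreal (b - a)"
    using ab(1) by (simp add: nn_integral_cmult_indicator)
  also have "\<dots> = ennreal ((b - a) / (2 * real n))"
    using ab(1) by (simp add: ennreal_mult[symmetric])
  finally show ?thesis .
qed

end

section \<open>The error estimate\<close>

lemma spd_sticky_motion:
  assumes n: "n \<ge> 1" and x: "x \<in> D n"
    and \<Lambda>: "\<forall>v\<in>{0..1}. (\<Lambda> has_real_derivative lam v) (at v within {0..1})"
  shows "sticky_motion \<Lambda> n (\<lambda>k t. spd n (initial_velocity lam n) x t k)"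
  unfolding sticky_motion_def
proof (intro conjI ballI allI impI)
  fix s :: real assume "s \<ge> 0"
  from spd_locally_affine[OF n x this, of "initial_velocity lam n"]
  obtain \<delta> \<alpha> \<beta> e where *: "\<delta> > 0"
    "\<And>t k. t \<in> {s..s+\<delta>} \<Longrightarrow> k \<in> {1..n} \<Longrightarrow> spd n (initial_velocity lam n) x t k = \<alpha> k + \<beta> k * t"
    "\<And>k. k \<in> {1..n} \<Longrightarrow> \<beta> k = initial_velocity lam n k + e k - e (k - 1)"
    "e 0 = 0" "e n = 0" "\<And>k. k \<le> n \<Longrightarrow> e k \<le> 0"
    "\<And>k. 1 \<le> k \<Longrightarrow> k < n \<Longrightarrow> e k \<noteq> 0 \<Longrightarrow> \<alpha> k = \<alpha> (Suc k) \<and> \<beta> k = \<beta> (Suc k)"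
    by blast
  have speed: "\<beta> k = real n * (\<Lambda> (real k / real n) - \<Lambda> (real (k - 1) / real n)) + e k - e (k - 1)"
    if "k \<in> {1..n}" for k
    unfolding *(3)[OF that] initial_velocity_eq[OF \<Lambda> that] ..
  have "affine_motion \<Lambda> n (\<lambda>k t. spd n (initial_velocity lam n) x t k) {s..s+\<delta>} \<alpha> \<beta> e"
    unfolding affine_motion_def by (intro conjI ballI allI impI speed *(2,4-6) *(7)[THEN conjunct1] *(7)[THEN conjunct2])
  then show "\<exists>\<delta>>0. \<exists>\<alpha> \<beta> e. affine_motion \<Lambda> n (\<lambda>k t. spd n (initial_velocity lam n) x t k) {s..s+\<delta>} \<alpha> \<beta> e"
    using *(1) by blast
qed (use spd_continuous[OF n] spd_sorted[OF n] in auto)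

text \<open>A Lipschitz speed on \<open>[0,1]\<close> is bounded, which gives a finite speed of propagation.\<close>

lemma entropy_solution_spd_L1:
  assumes \<Lambda>: "\<forall>v\<in>{0..1}. (\<Lambda> has_real_derivative lam v) (at v within {0..1})"
    and lip: "L-lipschitz_on {0..1} lam"
    and m: "real_distribution m" and sol: "entropy_solution \<Lambda> (cdf m) u"
    and n: "n \<ge> 1" and x: "x \<in> D n" and t: "t \<ge> 0"
  shows "L1_dist (u t) (spd_cdf lam n x t) \<le> L1_dist (cdf m) (spd_cdf lam n x 0) + ennreal (t * L / real n)"
proof -
  interpret real_distribution m by (rule m)
  let ?M = "\<bar>lam 0\<bar> + L"
  have L: "L \<ge> 0" using lip by (rule lipschitz_on_nonneg)
  have lam: "\<bar>lam z\<bar> \<le> ?M" if "z \<in> {0..1}" for z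
  proof -
    have "\<bar>lam z - lam 0\<bar> \<le> L * \<bar>z - 0\<bar>" using lipschitz_onD[OF lip, of z 0] that by (simp add: dist_real_def)
    also have "\<dots> \<le> L * 1" using that L by (intro mult_left_mono) auto
    finally show ?thesis by linarith
  qed
  have speed: "\<bar>\<Lambda> a - \<Lambda> b\<bar> \<le> ?M * \<bar>a - b\<bar>" if "a \<in> {0..1}" "b \<in> {0..1}" for a b
  proof -
    have *: "\<bar>\<Lambda> b - \<Lambda> a\<bar> \<le> ?M * \<bar>b - a\<bar>" if ab: "0 \<le> a" "a \<le> b" "b \<le> 1" for a b
    proof -
      obtain z where z: "a \<le> z" "z \<le> b" "\<Lambda> b - \<Lambda> a = lam z * (b - a)" by (rule mean_value_01[OF \<Lambda> ab])
      then show ?thesis using lam[of z] ab unfolding z(3) abs_mult by (intro mult_right_mono) auto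
    qed
    show ?thesis
    proof (cases "a \<le> b")
      case True
      then show ?thesis using *[of a b] that by (simp add: abs_minus_commute)
    next
      case False
      then show ?thesis using *[of b a] that by simp
    qed
  qed
  interpret entropy_comparison \<Lambda> lam L ?M "cdf m" u
  proof
    show "cdf m \<in> borel_measurable borel"
      by (intro borel_measurable_mono monoI cdf_nondecreasing)
  qed (use \<Lambda> lip speed sol L in \<open>auto simp: cdf_nonneg cdf_bounded_prob\<close>)
  have cdf: "spd_cdf lam n x t = particle_cdf n (\<lambda>k. spd n (initial_velocity lam n) x t k)" for t
    by (simp add: spd_cdf_def spd_measure_def cdf_empirical_measure[OF n])
  show ?thesis
    unfolding cdf by (rule L1_stability[OF n spd_sticky_motion[OF n x \<Lambda>] t])
qed

lemma discrete_hull_of_sorted: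
  assumes "x \<in> D n" "k \<le> n"
  shows "discrete_hull n (\<lambda>k. \<Sum>j=1..k. x j) k = (\<Sum>j=1..k. x j)"
  by (rule discrete_hull_cases[of n "\<lambda>k. \<Sum>j=1..k. x j" k])
    (use chord_partial_sums_ge[OF assms(1)] discrete_hull_le[of n "\<lambda>k. \<Sum>j=1..k. x j" k] in fastforce)+

lemma spd_0:
  assumes n: "n \<ge> 1" and x: "x \<in> D n" and k: "k \<in> {1..n}"
  shows "spd n l x 0 k = x k"
proof -
  obtain i where i: "k = Suc i" using k by (cases k) auto
  then show ?thesis
    using k spd_discrete_hull[OF n, of i l x 0] discrete_hull_of_sorted[OF x, of "Suc i"] discrete_hull_of_sorted[OF x, of i]
    by simp
qed

theorem theorem3p1:
  fixes \<Lambda> lam :: "real \<Rightarrow> real" and L :: real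
    and m :: "real measure" and u :: "real \<Rightarrow> real \<Rightarrow> real"
  assumes "\<forall>v\<in>{0..1}. (\<Lambda> has_real_derivative lam v) (at v within {0..1})"
    and "continuous_on {0..1} lam"
    and "L-lipschitz_on {0..1} lam"
    and "real_distribution m"
    and "entropy_solution \<Lambda> (cdf m) u"
  shows "(\<forall>n\<ge>1. \<forall>x\<in>D n. \<forall>t\<ge>0.
            L1_dist (u t) (spd_cdf lam n x t)
              \<le> W1 m (spd_measure lam n x 0) + ennreal (t * L / real n))
       \<and> (\<forall>a b. a < b \<and> measure m {a..b} = 1 \<longrightarrow>
            (\<forall>n\<ge>1. \<forall>x. (\<forall>k\<in>{1..n}. x k = cdf_inverse (cdf m) ((2 * real k - 1) / (2 * real n))) \<longrightarrow>
              (\<forall>t\<ge>0. L1_dist (u t) (spd_cdf lam n x t)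
                 \<le> ennreal ((b - a + 2 * t * L) / (2 * real n)))))"
proof (intro conjI allI ballI impI)
  fix n :: nat and x t assume n: "n \<ge> 1" and x: "x \<in> D n" and t: "t \<ge> (0::real)"
  have "L1_dist (u t) (spd_cdf lam n x t) \<le> L1_dist (cdf m) (spd_cdf lam n x 0) + ennreal (t * L / real n)"
    by (rule entropy_solution_spd_L1[OF assms(1,3,4,5) n x t])
  also have "\<dots> \<le> W1 m (spd_measure lam n x 0) + ennreal (t * L / real n)"
    unfolding spd_cdf_def by (intro add_right_mono L1_dist_cdf_le_W1)
  finally show "L1_dist (u t) (spd_cdf lam n x t) \<le> W1 m (spd_measure lam n x 0) + ennreal (t * L / real n)" .
next
  fix a b :: real and n :: nat and x t
  assume ab: "a < b \<and> measure m {a..b} = 1" and n: "n \<ge> 1" and t: "t \<ge> (0::real)"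
    and x: "\<forall>k\<in>{1..n}. x k = cdf_inverse (cdf m) ((2 * real k - 1) / (2 * real n))"
  have xD: "x \<in> D n" by (rule midpoint_quantiles_sorted[OF assms(4) x])
  have L: "L \<ge> 0" using assms(3) by (rule lipschitz_on_nonneg)
  have "{k \<in> {1..n}. spd n (initial_velocity lam n) x 0 k \<le> y} = {k \<in> {1..n}. x k \<le> y}" for y
    using spd_0[OF n xD] by auto
  then have cdf0: "spd_cdf lam n x 0 = particle_cdf n x"
    by (simp add: spd_cdf_def spd_measure_def cdf_empirical_measure[OF n] particle_cdf_def fun_eq_iff)
  have "L1_dist (u t) (spd_cdf lam n x t) \<le> L1_dist (cdf m) (spd_cdf lam n x 0) + ennreal (t * L / real n)"
    by (rule entropy_solution_spd_L1[OF assms(1,3,4,5) n xD t])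
  also have "\<dots> \<le> ennreal ((b - a) / (2 * real n)) + ennreal (t * L / real n)"
    unfolding cdf0 using ab by (intro add_right_mono midpoint_quantiles_L1[OF assms(4) n _ _ x]) auto
  also have "\<dots> = ennreal ((b - a) / (2 * real n) + t * L / real n)"
    using ab t L by (intro ennreal_plus[symmetric]) auto
  also have "(b - a) / (2 * real n) + t * L / real n = (b - a + 2 * t * L) / (2 * real n)"
    using n by (simp add: field_simps)
  finally show "L1_dist (u t) (spd_cdf lam n x t) \<le> ennreal ((b - a + 2 * t * L) / (2 * real n))" .
qed

end
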